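(* Let $X$ and $\{X_{i,j} : i,j\ge 1\}$ be i.i.d. real random variables. (i) Let $a^{(1)}_m = m/\log m$ and $a^{(2)}_n = n/\log n$. If $$E\,X^2\frac{(\log^+|X|)^3}{\log^+\log^+|X|}<\infty,\quad E\,X=0,\quad E\,X^2=\sigma^2,$$ then $$\limsup_{m,n\to\infty}\frac{T_{(m,n),(m+m/\log m,\,n+n/\log n)}}{\sqrt{4mn\,\frac{\log\log m+\log\log n}{\log m\,\log n}}}=\sigma\quad\text{a.s.}$$ Conversely, if $$P\Big(\limsup_{m,n\to\infty}\frac{|T_{(m,n),(m+m/\log m,\,n+n/\log n)}|}{\sqrt{mn\,\frac{\log\log m+\log\log n}{\log m\,\log n}}}<\infty\Big)>0,$$ then $E\,X^2\frac{(\log^+|X|)^3}{\log^+\log^+|X|}<\infty$ and $E\,X=0$. (ii) Let $a^{(1)}_m = m/\log\log m$ and $a^{(2)}_n = n/\log\log n$. If $$E\,X^2\log^+|X|\,\log^+\log^+|X|<\infty,\quad E\,X=0,\quad E\,X^2=\sigma^2,$$ then $$\limsup_{m,n\to\infty}\frac{T_{(m,n),(m+m/\log\log m,\,n+n/\log\log n)}}{\sqrt{2mn\,\frac{\log\log m+\log\log n}{\log\log m\,\log\log n}}}=\sigma\quad\text{a.s.}$$ Conversely, if $$P\Big(\limsup_{m,n\to\infty}\frac{|T_{(m,n),(m+m/\log\log m,\,n+n/\log\log n)}|}{\sqrt{mn\,\frac{\log\log m+\log\log n}{\log\log m\,\log\log n}}}<\infty\Big)>0,$$ then $E\,X^2\log^+|X|\,\log^+\log^+|X|<\infty$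 and $E\,X=0$. (iii) Let $a^{(1)}_m = m/\log m$ and $a^{(2)}_n = n/\log\log n$. If $$E\,X^2(\log^+|X|)^2<\infty,\quad E\,X=0,\quad E\,X^2=\sigma^2,$$ then $$\limsup_{m,n\to\infty}\frac{T_{(m,n),(m+m/\log m,\,n+n/\log\log n)}}{\sqrt{4mn\,\frac{\log\log m+\log\log n}{\log m\,\log\log n}}}=\sigma\quad\text{a.s.}$$ Conversely, if $$P\Big(\limsup_{m,n\to\infty}\frac{|T_{(m,n),(m+m/\log m,\,n+n/\log\log n)}|}{\sqrt{4mn\,\frac{\log\log m+\log\log n}{\log m\,\log\log n}}}<\infty\Big)>0,$$ then $E\,X^2(\log^+|X|)^2<\infty$ and $E\,X=0$.
   Context: For positive sequences $a^{(1)}_m$, $a^{(2)}_n$, the window (delayed sum) is $$T_{(m,n),(m+a^{(1)}_m,\,n+a^{(2)}_n)}=\sum_{\substack{m\le i\le m+a^{(1)}_m\\ n\le j\le n+a^{(2)}_n}}X_{i,j},$$ where $i,j$ range over positive integers (quantities such as $n/\log n$ are treated as integers for convenience). The limit $m,n\to\infty$ means that both $m\to\infty$ and $n\to\infty$, i.e. $\limsup_{m,n\to\infty}$ is $\lim_{k\to\infty}\sup_{m,n\ge k}$. Here $\log^+x=\max\{\log x,1\}$ for $x>0$ (with value $1$ at $0$), and $\log^+\log^+|X|=\log^+(\log^+|X|)$; $\sigma=\sqrt{\sigma^2}\ge 0$. *)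

theory Defs
  imports "HOL-Probability.Probability"
begin

(* log^+ x = max(log x, 1), not max(log x, 0); since ln 0 = 0 the value at 0 is 1. *)
definition log_plus :: "real \<Rightarrow> real" where
  "log_plus x = max (ln x) 1"

(* X and all X_{i,j} with i, j >= 1 are jointly independent with a common law.
   None is the index of X and Some (i, j) that of X_{i,j}; entries of the array Y with
   i = 0 or j = 0 are unconstrained. *)
definition iid_field :: "'a measure \<Rightarrow> ('a \<Rightarrow> real) \<Rightarrow> (nat \<Rightarrow> nat \<Rightarrow> 'a \<Rightarrow> real) \<Rightarrow> bool" where
  "iid_field M X Y \<longleftrightarrow>
     prob_space M \<and>
     prob_space.indep_vars M (\<lambda>_. borel)
       (\<lambda>k. case k of None \<Rightarrow> X | Some (i, j) \<Rightarrow> Y i j)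
       (insert None (Some ` ({1..} \<times> {1..}))) \<and>
     (\<forall>i\<ge>1. \<forall>j\<ge>1. distr M borel (Y i j) = distr M borel X)"

(* The window bounds are real numbers; i and j range over the positive integers between them,
   so a window has floor (a1 m) + 1 by floor (a2 n) + 1 entries when m, n >= 1 and
   a1 m, a2 n >= 0. *)
definition delayed_sum ::
    "(nat \<Rightarrow> nat \<Rightarrow> 'a \<Rightarrow> real) \<Rightarrow> (nat \<Rightarrow> real) \<Rightarrow> (nat \<Rightarrow> real) \<Rightarrow> nat \<Rightarrow> nat \<Rightarrow> 'a \<Rightarrow> real" where
  "delayed_sum Y a1 a2 m n \<omega> =
     (\<Sum>i\<in>{i::nat. 1 \<le> i \<and> real m \<le> real i \<and> real i \<le> real m + a1 m}.
      \<Sum>j\<in>{j::nat. 1 \<le> j \<and> real n \<le> real j \<and> real j \<le> real n + a2 n}. Y i j \<omega>)"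

(* A set is eventual for the product filter iff it contains all (m, n) with m, n >= k for
   some k, so this is the limit over k of the supremum over m, n >= k. *)
abbreviation limsup2 :: "(nat \<Rightarrow> nat \<Rightarrow> real) \<Rightarrow> ereal" where
  "limsup2 f \<equiv> Limsup (sequentially \<times>\<^sub>F sequentially) (\<lambda>(m, n). ereal (f m n))"

lemma limsup2_eq_INF_SUP: "limsup2 f = (INF k. SUP (m, n)\<in>{k..} \<times> {k..}. ereal (f m n))"
proof (rule antisym)
  show "limsup2 f \<le> (INF k. SUP (m, n)\<in>{k..} \<times> {k..}. ereal (f m n))"
  proof (rule INF_greatest)
    fix k :: nat
    have "eventually (\<lambda>x. x \<in> {k..} \<times> {k..}) (sequentially \<times>\<^sub>F sequentially)"
      unfolding eventually_prod_filter
      by (intro exI[of _ "\<lambda>m. k \<le> m"]) (auto simp: eventually_ge_at_top)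
    then show "limsup2 f \<le> (SUP (m, n)\<in>{k..} \<times> {k..}. ereal (f m n))"
      unfolding Limsup_def
      by (intro INF_lower2[where i = "\<lambda>x. x \<in> {k..} \<times> {k..}"]) (auto simp: Collect_mem_eq)
  qed
  show "(INF k. SUP (m, n)\<in>{k..} \<times> {k..}. ereal (f m n)) \<le> limsup2 f"
    unfolding Limsup_def
  proof (rule INF_greatest)
    fix P :: "nat \<times> nat \<Rightarrow> bool"
    assume "P \<in> {P. eventually P (sequentially \<times>\<^sub>F sequentially)}"
    then obtain Q R where "eventually Q sequentially" "eventually R sequentially"
      and QR: "\<And>m n. Q m \<Longrightarrow> R n \<Longrightarrow> P (m, n)"
      unfolding eventually_prod_filter by auto
    then obtain k l where "\<And>m. m \<ge> k \<Longrightarrow> Q m" "\<And>n. n \<ge> l \<Longrightarrow> R n"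
      unfolding eventually_sequentially by auto
    with QR have "{max k l..} \<times> {max k l..} \<subseteq> {x. P x}" by auto
    then show "(INF k. SUP (m, n)\<in>{k..} \<times> {k..}. ereal (f m n))
               \<le> (SUP (m, n)\<in>{x. P x}. ereal (f m n))"
      by (intro INF_lower2[of "max k l"] SUP_subset_mono) auto
  qed
qed

end

theory Submission
  imports Defs "HOL-Real_Asymp.Real_Asymp"
begin

text \<open>
  A window at \<open>(m, n)\<close> has area \<open>A = (m / f m) * (n / g n)\<close>, where \<open>f\<close> and \<open>g\<close> are
  \<open>ln\<close> or \<open>ln \<circ> ln\<close>. With \<open>L = ln (ln m) + ln (ln n)\<close> the sum over it exceeds
  \<open>x * \<sigma> * sqrt (2 * \<theta> * A * L)\<close> with probability about \<open>exp (- x\<^sup>2 *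
  \<theta> * L) = (ln m * ln n) powr (- x\<^sup>2 * \<theta>)\<close>. The essentially different
  window positions have, as a function of \<open>u = ln m\<close>, density \<open>u\<close> for windows of length
  \<open>m / ln m\<close>, and density \<open>ln u\<close> for windows of length \<open>m / ln (ln m)\<close>. So the
  exceptional windows are summable for \<open>x > 1\<close>, and not summable for \<open>x < 1\<close>, if
  \<open>\<theta> = 2\<close> when at least one of the scales is \<open>ln\<close>, and \<open>\<theta> = 1\<close>
  otherwise. In the mixed case the direction with scale \<open>ln\<close> decides.

  The upper bound \<open>window_sum_upper_bound\<close> needs all positions, not only separated ones.
  The plane is cut into cells that are short compared with the windows. At the corner of a
  cell the window sum is handled by Chernoff's method after truncation at a small multiple
  of the normalizer (\<open>moderate_deviation_upper\<close>); all other windows of the cell differ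
  from it by thin strips, whose maximum is controlled by Etemadi's inequality in both
  coordinates (\<open>etemadi_rectangles\<close>, \<open>grid_cell_prob\<close>). The probability bound for a cell
  is a product of functions of the two coordinates, so the series over cells converges.

  For the lower bound \<open>window_sum_lower_bound\<close> the column position can be kept fixed,
  because the limsup only asks for arbitrarily large rows. What remains is a one-dimensional
  problem with independent disjoint windows. The lower deviation probability
  (\<open>moderate_deviation_lower\<close>) comes from the central limit theorem, applied to a number
  of blocks proportional to the exponent.

  The moment conditions say exactly that the probabilities \<open>P (\<bar>X\<bar> > normalizer m
  n)\<close> have a finite sum, because there are about \<open>x\<^sup>2 * \<psi> x * ln x\<close> pairs with
  normalizer below \<open>x\<close> for a function \<open>\<psi>\<close> depending on the case (\<open>moment_rate\<close>,
  \<open>sum_prob_exceeds_bounded\<close>, \<open>integrable_of_sum_prob_exceeds\<close>). In one direction this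
  removes the truncation. In the other, window sums that stay bounded with positive
  probability force the entries to stay bounded as well
  (\<open>sum_prob_large_entries_bounded\<close>), and Chebyshev's inequality excludes a nonzero mean.
\<close>

section \<open>Independent blocks, maximal inequalities and a Borel-Cantelli lemma for pairs\<close>

text \<open>
  The form in which independence is used throughout: events that are determined by the
  entries with indices in two disjoint, possibly infinite, sets multiply. Stating them as
  predicates on the restricted family lets sums over different blocks be handled without
  naming any sub-sigma-algebra.
\<close>

lemma (in prob_space) prob_disjoint_blocks:
  fixes V :: "'i \<Rightarrow> 'a \<Rightarrow> real"
  assumes ind: "indep_vars (\<lambda>_. borel) V I" and AB: "A \<inter> B = {}" "A \<subseteq> I" "B \<subseteq> I"
    and P: "Measurable.pred (PiM A (\<lambda>_. borel)) P" and Q: "Measurable.pred (PiM B (\<lambda>_. borel)) Q"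
  shows "\<P>(\<omega> in M. P (\<lambda>i\<in>A. V i \<omega>) \<and> Q (\<lambda>i\<in>B. V i \<omega>))
    = \<P>(\<omega> in M. P (\<lambda>i\<in>A. V i \<omega>)) * \<P>(\<omega> in M. Q (\<lambda>i\<in>B. V i \<omega>))"
proof -
  have iv: "indep_var (PiM A (\<lambda>_. borel)) (\<lambda>\<omega>. \<lambda>i\<in>A. V i \<omega>) (PiM B (\<lambda>_. borel)) (\<lambda>\<omega>. \<lambda>i\<in>B. V i \<omega>)"
    by (rule indep_var_restrict[OF ind AB])
  have *: "(\<lambda>i\<in>A. V i \<omega>) \<in> space (PiM A (\<lambda>_. borel))" for A \<omega>
    by (simp add: space_PiM)
  have "prob ((\<lambda>\<omega>. (\<lambda>i\<in>A. V i \<omega>, \<lambda>i\<in>B. V i \<omega>)) -`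
          ({v \<in> space (PiM A (\<lambda>_. borel)). P v} \<times> {v \<in> space (PiM B (\<lambda>_. borel)). Q v}) \<inter> space M)
      = prob ((\<lambda>\<omega>. \<lambda>i\<in>A. V i \<omega>) -` {v \<in> space (PiM A (\<lambda>_. borel)). P v} \<inter> space M)
      * prob ((\<lambda>\<omega>. \<lambda>i\<in>B. V i \<omega>) -` {v \<in> space (PiM B (\<lambda>_. borel)). Q v} \<inter> space M)"
    by (rule indep_varD[OF iv]) (use P Q in \<open>auto simp: pred_def\<close>)
  also have "(\<lambda>\<omega>. (\<lambda>i\<in>A. V i \<omega>, \<lambda>i\<in>B. V i \<omega>)) -`
          ({v \<in> space (PiM A (\<lambda>_. borel)). P v} \<times> {v \<in> space (PiM B (\<lambda>_. borel)). Q v}) \<inter> space M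
        = {\<omega>\<in>space M. P (\<lambda>i\<in>A. V i \<omega>) \<and> Q (\<lambda>i\<in>B. V i \<omega>)}"
    using * by (auto simp: space_PiM)
  also have "(\<lambda>\<omega>. \<lambda>i\<in>A. V i \<omega>) -` {v \<in> space (PiM A (\<lambda>_. borel)). P v} \<inter> space M
        = {\<omega>\<in>space M. P (\<lambda>i\<in>A. V i \<omega>)}" using * by (auto simp: space_PiM)
  also have "(\<lambda>\<omega>. \<lambda>i\<in>B. V i \<omega>) -` {v \<in> space (PiM B (\<lambda>_. borel)). Q v} \<inter> space M
        = {\<omega>\<in>space M. Q (\<lambda>i\<in>B. V i \<omega>)}" using * by (auto simp: space_PiM)
  finally show ?thesis .
qed

lemma pred_block_sum_exceeds [measurable (raw)]:
  fixes x :: real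
  assumes "finite \<B>" "C \<subseteq> A"
  shows "Measurable.pred (PiM A (\<lambda>_. borel)) (\<lambda>v. \<exists>B\<in>\<B>. \<bar>\<Sum>c\<in>C \<inter> B. v c\<bar> > x)"
proof -
  have "(\<lambda>v. \<Sum>c\<in>C \<inter> B. (\<lambda>c w. w c) c v) \<in> borel_measurable (PiM A (\<lambda>_. borel :: real measure))" for B
    by (rule borel_measurable_sum) (use assms in \<open>auto intro!: measurable_component_singleton\<close>)
  then have [measurable]: "(\<lambda>v. \<Sum>c\<in>C \<inter> B. v c) \<in> borel_measurable (PiM A (\<lambda>_. borel :: real measure))" for B
    by simp
  have [simp]: "countable \<B>" using assms by (simp add: countable_finite)
  show ?thesis by measurable
qed

text \<open>
  Etemadi's maximal inequality for the sup norm over a finite family \<open>\<B>\<close> of index sets.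
  At the first stage at which the norm exceeds \<open>3 x\<close>, either the final norm already
  exceeds \<open>x\<close>, or the increment from there to the end, which is independent of the past,
  exceeds \<open>2 x\<close>. The norm, rather than the absolute value of a single sum, is what makes a
  second application in the other coordinate possible.
\<close>

lemma (in prob_space) etemadi_chain:
  fixes V :: "'i \<Rightarrow> 'a \<Rightarrow> real" and R :: "nat \<Rightarrow> 'i set"
  assumes ind: "indep_vars (\<lambda>_. borel) V I" and fin: "finite \<B>"
    and R: "mono R" "\<And>p. finite (R p)" "\<And>p. R p \<subseteq> I"
    and r: "\<And>p. p \<le> n \<Longrightarrow> \<P>(\<omega> in M. \<exists>B\<in>\<B>. \<bar>\<Sum>c\<in>R p \<inter> B. V c \<omega>\<bar> > x) \<le> r"
  shows "\<P>(\<omega> in M. \<exists>p\<le>n. \<exists>B\<in>\<B>. \<bar>\<Sum>c\<in>R p \<inter> B. V c \<omega>\<bar> > 3 * x) \<le> 3 * r"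
proof -
  define big where "big = (\<lambda>x A v. \<exists>B\<in>\<B>. \<bar>\<Sum>c\<in>A \<inter> B. v c\<bar> > (x::real))"
  \<comment> \<open>Stage \<open>p\<close> is the first one at which the level \<open>3 x\<close> is exceeded.\<close>
  define E where "E = (\<lambda>p v. big (3*x) (R p) v \<and> (\<forall>p'<p. \<not> big (3*x) (R p') v))"
  have [measurable]: "V c \<in> borel_measurable M" if "c \<in> I" for c
    using ind that by (auto simp: indep_vars_def)
  have [simp]: "countable \<B>" using fin by (simp add: countable_finite)
  have sumV [measurable]: "(\<lambda>\<omega>. \<Sum>c\<in>A \<inter> B. V c \<omega>) \<in> borel_measurable M" if "A \<subseteq> I" for A B
    using that by (intro borel_measurable_sum) auto
  have bigM [measurable]: "Measurable.pred M (\<lambda>\<omega>. big y A (\<lambda>c. V c \<omega>))" if "A \<subseteq> I" for y A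
    unfolding big_def using that by measurable
  have bigP: "Measurable.pred (PiM A (\<lambda>_. borel)) (big y C)" if "C \<subseteq> A" for y A C
    unfolding big_def by (rule pred_block_sum_exceeds[OF fin that])
  have Rle: "R p \<subseteq> R q" if "p \<le> q" for p q using R(1) that by (auto simp: mono_def)
  have EM [measurable]: "Measurable.pred M (\<lambda>\<omega>. E p (\<lambda>c. V c \<omega>))" for p
    unfolding E_def using R(3) by measurable
  have EP: "Measurable.pred (PiM (R p) (\<lambda>_. borel)) (E p)" for p
  proof -
    have [measurable]: "Measurable.pred (PiM (R p) (\<lambda>_. borel)) (big y (R p'))" if "p' \<le> p" for p' y
      by (rule bigP) (use Rle that in auto)
    have [measurable]: "Measurable.pred (PiM (R p) (\<lambda>_. borel)) (\<lambda>v. p' < p \<longrightarrow> \<not> big (3*x) (R p') v)" for p'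
      by (cases "p' < p") auto
    show ?thesis unfolding E_def by measurable
  qed
  have restr: "big y C (\<lambda>i\<in>A. V i \<omega>) = big y C (\<lambda>i. V i \<omega>)" if "C \<subseteq> A" for y C A \<omega>
  proof -
    have "(\<Sum>c\<in>C \<inter> B. (\<lambda>i\<in>A. V i \<omega>) c) = (\<Sum>c\<in>C \<inter> B. V c \<omega>)" for B
      by (rule sum.cong) (use that in auto)
    then show ?thesis by (simp add: big_def)
  qed
  have restrE: "E p (\<lambda>i\<in>R p. V i \<omega>) = E p (\<lambda>i. V i \<omega>)" for p \<omega>
    unfolding E_def using restr[of "R p" "R p"] restr[of "R p'" "R p" for p'] Rle by (auto simp: less_imp_le)
  have r': "\<P>(\<omega> in M. big x (R p) (\<lambda>c. V c \<omega>)) \<le> r" if "p \<le> n" for p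
    using r[OF that] by (simp add: big_def)
  have r0: "0 \<le> r" using r'[of n] measure_nonneg order_trans by (metis order_refl)
  have step: "\<P>(\<omega> in M. E p (\<lambda>c. V c \<omega>) \<and> \<not> big x (R n) (\<lambda>c. V c \<omega>))
      \<le> \<P>(\<omega> in M. E p (\<lambda>c. V c \<omega>)) * (2 * r)" if pn: "p \<le> n" for p
  proof -
    have split: "(\<Sum>c\<in>R n \<inter> B. v c) = (\<Sum>c\<in>R p \<inter> B. v c) + (\<Sum>c\<in>(R n - R p) \<inter> B. v c)" for B and v :: "'i \<Rightarrow> real"
    proof -
      have "R n \<inter> B = (R p \<inter> B) \<union> ((R n - R p) \<inter> B)" using Rle[OF pn] by auto
      then show ?thesis using R(2) by (metis (no_types, lifting) Diff_disjoint finite_Diff finite_Int inf.assoc inf_assoc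
         inf_bot_left inf_commute sum.union_disjoint)
    qed
    have "\<P>(\<omega> in M. E p (\<lambda>c. V c \<omega>) \<and> \<not> big x (R n) (\<lambda>c. V c \<omega>))
      \<le> \<P>(\<omega> in M. E p (\<lambda>c. V c \<omega>) \<and> big (2*x) (R n - R p) (\<lambda>c. V c \<omega>))"
    proof (rule finite_measure_mono)
      show "{\<omega> \<in> space M. E p (\<lambda>c. V c \<omega>) \<and> \<not> big x (R n) (\<lambda>c. V c \<omega>)}
        \<subseteq> {\<omega> \<in> space M. E p (\<lambda>c. V c \<omega>) \<and> big (2 * x) (R n - R p) (\<lambda>c. V c \<omega>)}"
      proof safe
        fix \<omega> assume "E p (\<lambda>c. V c \<omega>)" and nb: "\<not> big x (R n) (\<lambda>c. V c \<omega>)"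
        then obtain B where B: "B \<in> \<B>" "\<bar>\<Sum>c\<in>R p \<inter> B. V c \<omega>\<bar> > 3 * x" by (auto simp: E_def big_def)
        with nb have "\<bar>\<Sum>c\<in>R n \<inter> B. V c \<omega>\<bar> \<le> x" by (auto simp: big_def not_less)
        with B split[of "\<lambda>c. V c \<omega>" B] have "\<bar>\<Sum>c\<in>(R n - R p) \<inter> B. V c \<omega>\<bar> > 2 * x" by linarith
        with B(1) show "big (2 * x) (R n - R p) (\<lambda>c. V c \<omega>)" by (auto simp: big_def)
      qed
      have [measurable]: "Measurable.pred M (\<lambda>\<omega>. big (2*x) (R n - R p) (\<lambda>c. V c \<omega>))"
        by (rule bigM) (use R(3) in auto)
      show "{\<omega> \<in> space M. E p (\<lambda>c. V c \<omega>) \<and> big (2 * x) (R n - R p) (\<lambda>c. V c \<omega>)} \<in> events"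
        by measurable
    qed
    also have "\<dots> = \<P>(\<omega> in M. E p (\<lambda>i\<in>R p. V i \<omega>) \<and> big (2*x) (R n - R p) (\<lambda>i\<in>R n - R p. V i \<omega>))"
      by (simp add: restr restrE)
    also have "\<dots> = \<P>(\<omega> in M. E p (\<lambda>i\<in>R p. V i \<omega>)) * \<P>(\<omega> in M. big (2*x) (R n - R p) (\<lambda>i\<in>R n - R p. V i \<omega>))"
      by (rule prob_disjoint_blocks[OF ind]) (use R(3) EP bigP in auto)
    also have "\<dots> = \<P>(\<omega> in M. E p (\<lambda>i. V i \<omega>)) * \<P>(\<omega> in M. big (2*x) (R n - R p) (\<lambda>i. V i \<omega>))"
      by (simp add: restr restrE)
    also have "\<dots> \<le> \<P>(\<omega> in M. E p (\<lambda>i. V i \<omega>)) * (2 * r)"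
    proof (rule mult_left_mono)
      have "\<P>(\<omega> in M. big (2*x) (R n - R p) (\<lambda>i. V i \<omega>)) \<le>
         prob ({\<omega>\<in>space M. big x (R n) (\<lambda>c. V c \<omega>)} \<union> {\<omega>\<in>space M. big x (R p) (\<lambda>c. V c \<omega>)})"
      proof (rule finite_measure_mono)
        show "{\<omega> \<in> space M. big (2 * x) (R n - R p) (\<lambda>i. V i \<omega>)}
           \<subseteq> {\<omega> \<in> space M. big x (R n) (\<lambda>c. V c \<omega>)} \<union> {\<omega> \<in> space M. big x (R p) (\<lambda>c. V c \<omega>)}"
        proof safe
          fix \<omega> assume "big (2 * x) (R n - R p) (\<lambda>i. V i \<omega>)" and np: "\<not> big x (R p) (\<lambda>c. V c \<omega>)"
          then obtain B where B: "B \<in> \<B>" "\<bar>\<Sum>c\<in>(R n - R p) \<inter> B. V c \<omega>\<bar> > 2 * x" by (auto simp: big_def)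
          with np have "\<bar>\<Sum>c\<in>R p \<inter> B. V c \<omega>\<bar> \<le> x" by (auto simp: big_def not_less)
          with B split[of "\<lambda>c. V c \<omega>" B] have "\<bar>\<Sum>c\<in>R n \<inter> B. V c \<omega>\<bar> > x" by linarith
          with B(1) show "big x (R n) (\<lambda>c. V c \<omega>)" by (auto simp: big_def)
        qed
      qed (use R(3) in measurable)
      also have "\<dots> \<le> \<P>(\<omega> in M. big x (R n) (\<lambda>c. V c \<omega>)) + \<P>(\<omega> in M. big x (R p) (\<lambda>c. V c \<omega>))"
        by (rule measure_Un_le) (use R(3) in measurable)
      also have "\<dots> \<le> 2 * r" using r'[of n] r'[OF pn] by simp
      finally show "\<P>(\<omega> in M. big (2*x) (R n - R p) (\<lambda>i. V i \<omega>)) \<le> 2 * r" .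
    qed simp
    finally show ?thesis .
  qed
  have disj: "disjoint_family_on (\<lambda>p. {\<omega>\<in>space M. E p (\<lambda>c. V c \<omega>)}) {..n}"
    unfolding disjoint_family_on_def E_def by (auto) (metis linorder_neqE_nat)
  have sumE: "(\<Sum>p\<le>n. \<P>(\<omega> in M. E p (\<lambda>c. V c \<omega>))) \<le> 1"
  proof -
    have "(\<Sum>p\<le>n. \<P>(\<omega> in M. E p (\<lambda>c. V c \<omega>))) = prob (\<Union>p\<in>{..n}. {\<omega>\<in>space M. E p (\<lambda>c. V c \<omega>)})"
      by (rule finite_measure_finite_Union[symmetric]) (use disj in auto)
    then show ?thesis by simp
  qed
  have "\<P>(\<omega> in M. \<exists>p\<le>n. \<exists>B\<in>\<B>. \<bar>\<Sum>c\<in>R p \<inter> B. V c \<omega>\<bar> > 3 * x)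
     \<le> prob ({\<omega>\<in>space M. big x (R n) (\<lambda>c. V c \<omega>)} \<union>
         (\<Union>p\<in>{..n}. {\<omega>\<in>space M. E p (\<lambda>c. V c \<omega>) \<and> \<not> big x (R n) (\<lambda>c. V c \<omega>)}))"
  proof (rule finite_measure_mono)
    show "{\<omega> \<in> space M. \<exists>p\<le>n. \<exists>B\<in>\<B>. 3 * x < \<bar>\<Sum>c\<in>R p \<inter> B. V c \<omega>\<bar>}
      \<subseteq> {\<omega>\<in>space M. big x (R n) (\<lambda>c. V c \<omega>)} \<union>
         (\<Union>p\<in>{..n}. {\<omega>\<in>space M. E p (\<lambda>c. V c \<omega>) \<and> \<not> big x (R n) (\<lambda>c. V c \<omega>)})"
    proof (intro subsetI)
      fix \<omega> assume w: "\<omega> \<in> {\<omega> \<in> space M. \<exists>p\<le>n. \<exists>B\<in>\<B>. 3 * x < \<bar>\<Sum>c\<in>R p \<inter> B. V c \<omega>\<bar>}"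
      define p where "p = (LEAST p. big (3*x) (R p) (\<lambda>c. V c \<omega>))"
      from w obtain p0 where p0: "p0 \<le> n" "big (3*x) (R p0) (\<lambda>c. V c \<omega>)" by (auto simp: big_def)
      then have "big (3*x) (R p) (\<lambda>c. V c \<omega>)" "p \<le> p0" "\<forall>p'<p. \<not> big (3*x) (R p') (\<lambda>c. V c \<omega>)"
        unfolding p_def by (auto intro: LeastI Least_le dest: not_less_Least)
      then have "E p (\<lambda>c. V c \<omega>)" "p \<le> n" using p0 by (auto simp: E_def)
      then show "\<omega> \<in> {\<omega>\<in>space M. big x (R n) (\<lambda>c. V c \<omega>)} \<union>
         (\<Union>p\<in>{..n}. {\<omega>\<in>space M. E p (\<lambda>c. V c \<omega>) \<and> \<not> big x (R n) (\<lambda>c. V c \<omega>)})" using w by auto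
    qed
  qed (use R(3) in measurable)
  also have "\<dots> \<le> \<P>(\<omega> in M. big x (R n) (\<lambda>c. V c \<omega>)) +
       prob (\<Union>p\<in>{..n}. {\<omega>\<in>space M. E p (\<lambda>c. V c \<omega>) \<and> \<not> big x (R n) (\<lambda>c. V c \<omega>)})"
    by (rule measure_Un_le) (use R(3) in measurable)
  also have "\<dots> \<le> \<P>(\<omega> in M. big x (R n) (\<lambda>c. V c \<omega>)) +
       (\<Sum>p\<le>n. \<P>(\<omega> in M. E p (\<lambda>c. V c \<omega>) \<and> \<not> big x (R n) (\<lambda>c. V c \<omega>)))"
    by (intro add_left_mono finite_measure_subadditive_finite) (use R(3) in \<open>auto\<close>)
  also have "\<dots> \<le> r + (\<Sum>p\<le>n. \<P>(\<omega> in M. E p (\<lambda>c. V c \<omega>)) * (2 * r))"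
    using r'[of n] step by (intro add_mono sum_mono) auto
  also have "\<dots> = r + (\<Sum>p\<le>n. \<P>(\<omega> in M. E p (\<lambda>c. V c \<omega>))) * (2 * r)"
    by (simp add: sum_distrib_right)
  also have "\<dots> \<le> r + 1 * (2 * r)"
    using sumE r0 by (intro add_left_mono mult_right_mono) auto
  finally show ?thesis by simp
qed

text \<open>
  One application along the rows with the column sets as norm, and one along the columns for
  fixed rows; each costs a factor 3 in the level and in the probability.
\<close>

lemma (in prob_space) etemadi_rectangles:
  fixes V :: "nat \<times> nat \<Rightarrow> 'a \<Rightarrow> real" and R C :: "nat \<Rightarrow> nat set"
  assumes ind: "indep_vars (\<lambda>_. borel) V I"
    and R: "mono R" "\<And>p. finite (R p)" and C: "mono C" "\<And>q. finite (C q)"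
    and I: "\<And>p q. R p \<times> C q \<subseteq> I"
    and r: "\<And>p q. p \<le> m \<Longrightarrow> q \<le> n \<Longrightarrow> \<P>(\<omega> in M. \<bar>\<Sum>c\<in>R p \<times> C q. V c \<omega>\<bar> > x) \<le> r"
  shows "\<P>(\<omega> in M. \<exists>p\<le>m. \<exists>q\<le>n. \<bar>\<Sum>c\<in>R p \<times> C q. V c \<omega>\<bar> > 9 * x) \<le> 9 * r"
proof -
  have eq1: "(R p \<times> C q) \<inter> UNIV = R p \<times> C q" for p q by auto
  have eq2: "(R p \<times> C n) \<inter> (UNIV \<times> C q) = R p \<times> C q" if "q \<le> n" for p q
    using C(1) that by (auto simp: mono_def)
  have 1: "\<P>(\<omega> in M. \<exists>q\<le>n. \<bar>\<Sum>c\<in>R p \<times> C q. V c \<omega>\<bar> > 3 * x) \<le> 3 * r" if "p \<le> m" for p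
    using etemadi_chain[OF ind, of "{UNIV}" "\<lambda>q. R p \<times> C q" n x r] R C I r[OF that]
    by (simp add: mono_def Sigma_mono)
  have "\<P>(\<omega> in M. \<exists>p\<le>m. \<exists>B\<in>(\<lambda>q. UNIV \<times> C q) ` {..n}. \<bar>\<Sum>c\<in>(R p \<times> C n) \<inter> B. V c \<omega>\<bar> > 3 * (3 * x)) \<le> 3 * (3 * r)"
  proof (rule etemadi_chain[OF ind])
    fix p assume p: "p \<le> m"
    have "{\<omega>\<in>space M. \<exists>B\<in>(\<lambda>q. UNIV \<times> C q) ` {..n}. \<bar>\<Sum>c\<in>(R p \<times> C n) \<inter> B. V c \<omega>\<bar> > 3 * x}
        = {\<omega>\<in>space M. \<exists>q\<le>n. \<bar>\<Sum>c\<in>R p \<times> C q. V c \<omega>\<bar> > 3 * x}"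
      using eq2 by force
    with 1[OF p] show "\<P>(\<omega> in M. \<exists>B\<in>(\<lambda>q. UNIV \<times> C q) ` {..n}. \<bar>\<Sum>c\<in>(R p \<times> C n) \<inter> B. V c \<omega>\<bar> > 3 * x) \<le> 3 * r"
      by simp
  qed (use R C I in \<open>auto simp: mono_def\<close>)
  moreover have "{\<omega>\<in>space M. \<exists>p\<le>m. \<exists>B\<in>(\<lambda>q. UNIV \<times> C q) ` {..n}. \<bar>\<Sum>c\<in>(R p \<times> C n) \<inter> B. V c \<omega>\<bar> > 3 * (3 * x)}
        = {\<omega>\<in>space M. \<exists>p\<le>m. \<exists>q\<le>n. \<bar>\<Sum>c\<in>R p \<times> C q. V c \<omega>\<bar> > 9 * x}"
      using eq2 by force
  ultimately show ?thesis by simp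
qed

text \<open>
  The limsup over \<open>m, n \<rightarrow> \<infinity>\<close> only sees pairs with both coordinates
  large, so it is enough to enumerate all pairs in one sequence and to exclude finitely many
  of them.
\<close>

lemma (in prob_space) borel_cantelli_pairs:
  fixes E :: "nat \<Rightarrow> nat \<Rightarrow> 'a set"
  assumes E: "\<And>i j. E i j \<in> events"
    and bnd: "\<And>F. finite F \<Longrightarrow> (\<Sum>(i,j)\<in>F. prob (E i j)) \<le> B"
  shows "AE \<omega> in M. \<exists>k. \<forall>i\<ge>k. \<forall>j\<ge>k. \<omega> \<notin> E i j"
proof -
  define A where "A n = (case prod_decode n of (i, j) \<Rightarrow> E i j)" for n
  have "summable (\<lambda>n. prob (A n))"
  proof (rule summableI_nonneg_bounded)
    fix n
    have "(\<Sum>i<n. prob (A i)) = (\<Sum>(i,j)\<in>prod_decode ` {..<n}. prob (E i j))"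
      by (subst sum.reindex) (auto simp: A_def case_prod_beta inj_prod_decode intro: inj_on_subset)
    also have "\<dots> \<le> B" by (rule bnd) simp
    finally show "(\<Sum>i<n. prob (A i)) \<le> B" .
  qed simp
  then have "AE \<omega> in M. eventually (\<lambda>n. \<omega> \<in> space M - A n) sequentially"
    by (intro borel_cantelli_AE1) (auto simp: A_def E emeasure_eq_measure split: prod.split)
  then show ?thesis
  proof (rule AE_mp, intro AE_I2 impI)
    fix \<omega> assume "eventually (\<lambda>n. \<omega> \<in> space M - A n) sequentially"
    then obtain k where k: "\<And>n. n \<ge> k \<Longrightarrow> \<omega> \<notin> A n" by (auto simp: eventually_sequentially)
    \<comment> \<open>A pair \<open>(i, j)\<close> has a code not smaller than \<open>i\<close>.\<close>
    have "\<omega> \<notin> E i j" if "i \<ge> k" for i j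
      using k[of "prod_encode (i,j)"] le_prod_encode_1[of i j] that by (auto simp: A_def)
    then show "\<exists>k. \<forall>i\<ge>k. \<forall>j\<ge>k. \<omega> \<notin> E i j" by blast
  qed
qed

section \<open>Upper deviations of truncated sums\<close>

definition trunc :: "real \<Rightarrow> real \<Rightarrow> real" where
  "trunc \<beta> x = (if \<bar>x\<bar> \<le> \<beta> then x else 0)"

lemma trunc_measurable [measurable]: "trunc \<beta> \<in> borel_measurable borel"
  unfolding trunc_def by measurable

lemma abs_trunc_le: "0 \<le> \<beta> \<Longrightarrow> \<bar>trunc \<beta> x\<bar> \<le> \<beta>"
  by (simp add: trunc_def)

lemma log_plus_ge_1: "1 \<le> log_plus x"
  by (simp add: log_plus_def)

lemma log_plus_pos: "0 < log_plus x"
  using log_plus_ge_1[of x] by linarith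

lemma log_plus_mono: "0 < x \<Longrightarrow> x \<le> y \<Longrightarrow> log_plus x \<le> log_plus y"
  unfolding log_plus_def by (intro max.mono) auto

lemma log_plus_measurable [measurable]: "log_plus \<in> borel_measurable borel"
  unfolding log_plus_def by measurable

locale iid_family = prob_space M for M :: "'a measure" +
  fixes X :: "'a \<Rightarrow> real" and Z :: "'i \<Rightarrow> 'a \<Rightarrow> real" and I :: "'i set"
  assumes X_measurable [measurable]: "X \<in> borel_measurable M"
    and indep: "indep_vars (\<lambda>_. borel) Z I"
    and same_law: "\<And>i. i \<in> I \<Longrightarrow> distr M borel (Z i) = distr M borel X"
begin

lemma Z_measurable [measurable]: "i \<in> I \<Longrightarrow> Z i \<in> borel_measurable M"
  using indep by (auto simp: indep_vars_def)

lemma integral_Z: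
  assumes "i \<in> I" "h \<in> borel_measurable borel"
  shows "(\<integral>\<omega>. h (Z i \<omega>) \<partial>M) = (\<integral>\<omega>. (h (X \<omega>) :: real) \<partial>M)"
  using assms by (simp flip: integral_distr[where N = borel] add: same_law)

lemma integrable_Z_iff:
  fixes h :: "real \<Rightarrow> real"
  assumes "i \<in> I" "h \<in> borel_measurable borel"
  shows "integrable M (\<lambda>\<omega>. h (Z i \<omega>)) \<longleftrightarrow> integrable M (\<lambda>\<omega>. h (X \<omega>))"
  using assms integrable_distr_eq[of "Z i" M borel h] integrable_distr_eq[of X M borel h]
  by (simp add: same_law)

lemma prob_Z:
  assumes "i \<in> I" "Measurable.pred borel P"
  shows "\<P>(\<omega> in M. P (Z i \<omega>)) = \<P>(\<omega> in M. P (X \<omega>))"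
proof -
  have "\<P>(\<omega> in M. P (Y \<omega>)) = measure (distr M borel Y) {x. P x}"
    if [measurable]: "Y \<in> borel_measurable M" for Y :: "'a \<Rightarrow> real"
  proof -
    have "{x. P x} \<in> sets borel" using assms(2) by (simp add: pred_def)
    then show ?thesis by (subst measure_distr) (auto intro!: arg_cong[where f = prob])
  qed
  then show ?thesis using assms(1) by (simp add: same_law)
qed

end

lemma exp_le_quadratic: "exp y \<le> 1 + y + y\<^sup>2 / 2 * exp \<bar>y\<bar>" for y :: real
proof -
  obtain t where t: "\<bar>t\<bar> \<le> \<bar>y\<bar>" "exp y = (\<Sum>m<2. (y ^ m) / fact m) + (exp t / fact 2) * y ^ 2"
    using Maclaurin_exp_le[of y 2] by blast
  have "exp t * y\<^sup>2 \<le> exp \<bar>y\<bar> * y\<^sup>2" using t(1) by (intro mult_right_mono) auto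
  with t(2) show ?thesis by (simp add: numeral_2_eq_2 mult.commute)
qed

text \<open>
  Entries below \<open>c\<close> contribute the Gaussian term. Those between \<open>c\<close> and \<open>\<beta>\<close> are
  rare, which is expressed by the factor \<open>1 / log_plus c\<close> bought with the moment
  \<open>x\<^sup>2 log_plus \<bar>x\<bar>\<close>. The first error term pays for the mean lost by
  truncation at \<open>\<beta>\<close>; keeping the untruncated \<open>t * x\<close> makes it vanish in
  expectation.
\<close>

lemma exp_trunc_le:
  fixes t x c \<beta> :: real
  assumes c: "0 < c" and \<beta>: "0 < \<beta>"
  shows "exp (t * trunc \<beta> x) \<le> 1 + t * x + \<bar>t\<bar> / (\<beta> * log_plus \<beta>) * (x\<^sup>2 * log_plus \<bar>x\<bar>)
    + t\<^sup>2 / 2 * (exp (\<bar>t\<bar> * c) * x\<^sup>2 + exp (\<bar>t\<bar> * \<beta>) / log_plus c * (x\<^sup>2 * log_plus \<bar>x\<bar>))"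
proof -
  have lp: "0 \<le> x\<^sup>2 * log_plus \<bar>x\<bar>" "0 < log_plus \<beta>" "0 < log_plus c"
    using log_plus_pos[of "\<bar>x\<bar>"] log_plus_pos by (auto simp: less_imp_le)
  have nn: "0 \<le> \<bar>t\<bar> / (\<beta> * log_plus \<beta>) * (x\<^sup>2 * log_plus \<bar>x\<bar>)"
     "0 \<le> exp (\<bar>t\<bar> * c) * x\<^sup>2" "0 \<le> exp (\<bar>t\<bar> * \<beta>) / log_plus c * (x\<^sup>2 * log_plus \<bar>x\<bar>)"
    using lp \<beta> by auto
  show ?thesis
  proof (cases "\<bar>x\<bar> \<le> \<beta>")
    case True
    have "exp (t * x) \<le> 1 + t * x + (t * x)\<^sup>2 / 2 * exp \<bar>t * x\<bar>" by (rule exp_le_quadratic)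
    also have "x\<^sup>2 * exp \<bar>t * x\<bar> \<le> exp (\<bar>t\<bar> * c) * x\<^sup>2 + exp (\<bar>t\<bar> * \<beta>) / log_plus c * (x\<^sup>2 * log_plus \<bar>x\<bar>)"
    proof (cases "\<bar>x\<bar> \<le> c")
      case True
      then have "exp \<bar>t * x\<bar> \<le> exp (\<bar>t\<bar> * c)" by (simp add: abs_mult mult_left_mono)
      then have "x\<^sup>2 * exp \<bar>t * x\<bar> \<le> x\<^sup>2 * exp (\<bar>t\<bar> * c)" by (intro mult_left_mono) auto
      then show ?thesis using nn by (simp add: mult.commute)
    next
      case False
      then have l: "1 \<le> log_plus \<bar>x\<bar> / log_plus c"
        using log_plus_mono[of c "\<bar>x\<bar>"] c lp by (simp add: field_simps)
      have "exp \<bar>t * x\<bar> \<le> exp (\<bar>t\<bar> * \<beta>)" using \<open>\<bar>x\<bar> \<le> \<beta>\<close> by (simp add: abs_mult mult_left_mono)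
      then have "x\<^sup>2 * exp \<bar>t * x\<bar> \<le> x\<^sup>2 * exp (\<bar>t\<bar> * \<beta>) * 1" by (simp add: mult_left_mono)
      also have "\<dots> \<le> x\<^sup>2 * exp (\<bar>t\<bar> * \<beta>) * (log_plus \<bar>x\<bar> / log_plus c)"
        using l by (intro mult_left_mono) auto
      also have "\<dots> = exp (\<bar>t\<bar> * \<beta>) / log_plus c * (x\<^sup>2 * log_plus \<bar>x\<bar>)" by (simp add: mult_ac)
      finally show ?thesis using nn(2) by linarith
    qed
    then have "(t * x)\<^sup>2 / 2 * exp \<bar>t * x\<bar> \<le> t\<^sup>2 / 2 * (exp (\<bar>t\<bar> * c) * x\<^sup>2 + exp (\<bar>t\<bar> * \<beta>) / log_plus c * (x\<^sup>2 * log_plus \<bar>x\<bar>))"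
      using mult_left_mono[of "x\<^sup>2 * exp \<bar>t * x\<bar>" _ "t\<^sup>2 / 2"] by (simp add: power_mult_distrib mult.assoc)
    finally show ?thesis using True nn(1) by (simp add: trunc_def)
  next
    case False
    then have "log_plus \<beta> \<le> log_plus \<bar>x\<bar>" using log_plus_mono \<beta> by simp
    then have "\<beta> * log_plus \<beta> \<le> \<bar>x\<bar> * log_plus \<bar>x\<bar>" using False lp \<beta> by (intro mult_mono) auto
    then have "\<bar>x\<bar> * (\<beta> * log_plus \<beta>) \<le> \<bar>x\<bar> * (\<bar>x\<bar> * log_plus \<bar>x\<bar>)" by (intro mult_left_mono) auto
    then have "\<bar>x\<bar> \<le> x\<^sup>2 * log_plus \<bar>x\<bar> / (\<beta> * log_plus \<beta>)"
      using lp \<beta> by (simp add: pos_le_divide_eq power2_eq_square mult_ac)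
    then have "\<bar>t\<bar> * \<bar>x\<bar> \<le> \<bar>t\<bar> * (x\<^sup>2 * log_plus \<bar>x\<bar> / (\<beta> * log_plus \<beta>))" by (rule mult_left_mono) auto
    then have "- (t * x) \<le> \<bar>t\<bar> / (\<beta> * log_plus \<beta>) * (x\<^sup>2 * log_plus \<bar>x\<bar>)"
      using abs_ge_minus_self[of "t * x"] by (simp add: abs_mult)
    moreover have "0 \<le> t\<^sup>2 / 2 * (exp (\<bar>t\<bar> * c) * x\<^sup>2 + exp (\<bar>t\<bar> * \<beta>) / log_plus c * (x\<^sup>2 * log_plus \<bar>x\<bar>))"
      using add_nonneg_nonneg[OF nn(2,3)] by simp
    moreover have "exp (t * trunc \<beta> x) = 1" using False by (simp add: trunc_def)
    ultimately show ?thesis by linarith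
  qed
qed

context iid_family
begin

context
  fixes m1 s2 :: real
  assumes int: "integrable M (\<lambda>\<omega>. (X \<omega>)\<^sup>2 * log_plus \<bar>X \<omega>\<bar>)"
    and mean: "expectation X = 0"
  defines "m1 \<equiv> expectation (\<lambda>\<omega>. (X \<omega>)\<^sup>2 * log_plus \<bar>X \<omega>\<bar>)"
    and "s2 \<equiv> expectation (\<lambda>\<omega>. (X \<omega>)\<^sup>2)"
begin

lemma integrable_square: "integrable M (\<lambda>\<omega>. (X \<omega>)\<^sup>2)"
proof (rule Bochner_Integration.integrable_bound[OF int])
  show "AE \<omega> in M. norm ((X \<omega>)\<^sup>2) \<le> norm ((X \<omega>)\<^sup>2 * log_plus \<bar>X \<omega>\<bar>)"
  proof (intro AE_I2)
    fix \<omega>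
    have "(X \<omega>)\<^sup>2 * 1 \<le> (X \<omega>)\<^sup>2 * log_plus \<bar>X \<omega>\<bar>" using log_plus_ge_1 by (intro mult_left_mono) auto
    then show "norm ((X \<omega>)\<^sup>2) \<le> norm ((X \<omega>)\<^sup>2 * log_plus \<bar>X \<omega>\<bar>)" by simp
  qed
qed simp

lemma integrable_X: "integrable M X"
  by (rule square_integrable_imp_integrable[OF X_measurable integrable_square])

lemma m1_nonneg: "0 \<le> m1" "0 \<le> s2"
  unfolding m1_def s2_def by (auto intro!: Bochner_Integration.integral_nonneg simp: log_plus_pos less_imp_le)

lemma expectation_exp_trunc:
  assumes c: "0 < c" and \<beta>: "0 < \<beta>"
  shows "integrable M (\<lambda>\<omega>. exp (t * trunc \<beta> (X \<omega>)))"
    and "expectation (\<lambda>\<omega>. exp (t * trunc \<beta> (X \<omega>)))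
     \<le> exp (\<bar>t\<bar> / (\<beta> * log_plus \<beta>) * m1 + t\<^sup>2 / 2 * (exp (\<bar>t\<bar> * c) * s2 + exp (\<bar>t\<bar> * \<beta>) / log_plus c * m1))"
proof -
  have "t * trunc \<beta> x \<le> \<bar>t\<bar> * \<beta>" for x
  proof -
    have "\<bar>t * trunc \<beta> x\<bar> \<le> \<bar>t\<bar> * \<beta>" unfolding abs_mult using abs_trunc_le[of \<beta> x] \<beta> by (intro mult_left_mono) auto
    then show ?thesis by linarith
  qed
  then show i: "integrable M (\<lambda>\<omega>. exp (t * trunc \<beta> (X \<omega>)))"
    by (intro integrable_const_bound[where B = "exp (\<bar>t\<bar> * \<beta>)"]) auto
  let ?g = "\<lambda>x. 1 + t * x + \<bar>t\<bar> / (\<beta> * log_plus \<beta>) * (x\<^sup>2 * log_plus \<bar>x\<bar>)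
    + t\<^sup>2 / 2 * (exp (\<bar>t\<bar> * c) * x\<^sup>2 + exp (\<bar>t\<bar> * \<beta>) / log_plus c * (x\<^sup>2 * log_plus \<bar>x\<bar>))"
  have ig: "integrable M (\<lambda>\<omega>. ?g (X \<omega>))"
    by (intro Bochner_Integration.integrable_add integrable_mult_right integrable_const integrable_X int integrable_square)
  have "expectation (\<lambda>\<omega>. exp (t * trunc \<beta> (X \<omega>))) \<le> expectation (\<lambda>\<omega>. ?g (X \<omega>))"
    by (rule integral_mono[OF i ig]) (rule exp_trunc_le[OF c \<beta>])
  also have "\<dots> = 1 + (\<bar>t\<bar> / (\<beta> * log_plus \<beta>) * m1 + t\<^sup>2 / 2 * (exp (\<bar>t\<bar> * c) * s2 + exp (\<bar>t\<bar> * \<beta>) / log_plus c * m1))"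
    using int integrable_square integrable_X mean by (simp add: m1_def s2_def prob_space)
  also have "\<dots> \<le> exp (\<bar>t\<bar> / (\<beta> * log_plus \<beta>) * m1 + t\<^sup>2 / 2 * (exp (\<bar>t\<bar> * c) * s2 + exp (\<bar>t\<bar> * \<beta>) / log_plus c * m1))"
    by (rule exp_ge_add_one_self)
  finally show "expectation (\<lambda>\<omega>. exp (t * trunc \<beta> (X \<omega>)))
     \<le> exp (\<bar>t\<bar> / (\<beta> * log_plus \<beta>) * m1 + t\<^sup>2 / 2 * (exp (\<bar>t\<bar> * c) * s2 + exp (\<bar>t\<bar> * \<beta>) / log_plus c * m1))" .
qed

lemma prob_sum_trunc_ge:
  assumes c: "0 < c" and \<beta>: "0 < \<beta>" and t: "0 < t" and F: "finite F" "F \<subseteq> I" and r: "r \<in> {1, -1}"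
  shows "\<P>(\<omega> in M. r * (\<Sum>i\<in>F. trunc \<beta> (Z i \<omega>)) \<ge> x)
    \<le> exp (- t * x + card F * (t / (\<beta> * log_plus \<beta>) * m1
         + t\<^sup>2 / 2 * (exp (t * c) * s2 + exp (t * \<beta>) / log_plus c * m1)))"
proof -
  let ?K = "t / (\<beta> * log_plus \<beta>) * m1 + t\<^sup>2 / 2 * (exp (t * c) * s2 + exp (t * \<beta>) / log_plus c * m1)"
  define g where "g = (\<lambda>x. exp (t * r * trunc \<beta> x))"
  have [measurable]: "g \<in> borel_measurable borel" unfolding g_def by measurable
  have ind: "indep_vars (\<lambda>_. borel) (\<lambda>i \<omega>. g (Z i \<omega>)) F"
    by (rule indep_vars_compose2[OF indep_vars_subset[OF indep F(2)]]) auto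
  have gX: "integrable M (\<lambda>\<omega>. g (X \<omega>))" "expectation (\<lambda>\<omega>. g (X \<omega>)) \<le> exp ?K"
    using expectation_exp_trunc[OF c \<beta>, of "t * r"] r t by (auto simp: g_def)
  have gZ: "integrable M (\<lambda>\<omega>. g (Z i \<omega>))" "expectation (\<lambda>\<omega>. g (Z i \<omega>)) \<le> exp ?K" if "i \<in> F" for i
    using that F gX by (auto simp: integrable_Z_iff integral_Z subset_iff)
  have eq: "exp (t * (r * (\<Sum>i\<in>F. trunc \<beta> (Z i \<omega>)))) = (\<Prod>i\<in>F. g (Z i \<omega>))" for \<omega>
    by (simp add: g_def exp_sum[OF F(1), symmetric] sum_distrib_left mult.assoc)
  have int: "integrable M (\<lambda>\<omega>. exp (t * (r * (\<Sum>i\<in>F. trunc \<beta> (Z i \<omega>)))))"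
    unfolding eq by (rule indep_vars_integrable[OF F(1) ind gZ(1)])
  have "\<P>(\<omega> in M. r * (\<Sum>i\<in>F. trunc \<beta> (Z i \<omega>)) \<ge> x)
     \<le> exp (- t * x) * (\<integral>\<omega>\<in>space M. exp (t * (r * (\<Sum>i\<in>F. trunc \<beta> (Z i \<omega>)))) \<partial>M)"
    by (rule Chernoff_ineq_ge[OF t]) (use int in \<open>auto simp: set_integrable_def intro: integrable_mult_indicator[where 'b = real, simplified]\<close>)
  also have "(\<integral>\<omega>\<in>space M. exp (t * (r * (\<Sum>i\<in>F. trunc \<beta> (Z i \<omega>)))) \<partial>M) = expectation (\<lambda>\<omega>. \<Prod>i\<in>F. g (Z i \<omega>))"
    unfolding eq set_lebesgue_integral_def by (rule Bochner_Integration.integral_cong) auto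
  also have "\<dots> = (\<Prod>i\<in>F. expectation (\<lambda>\<omega>. g (Z i \<omega>)))"
    by (rule indep_vars_lebesgue_integral[OF F(1) ind gZ(1)])
  also have "\<dots> \<le> (\<Prod>i\<in>F. exp ?K)"
    by (rule prod_mono) (use gZ in \<open>auto intro!: Bochner_Integration.integral_nonneg simp: g_def\<close>)
  also have "\<dots> = exp (card F * ?K)" by (simp add: exp_of_nat_mult)
  finally show ?thesis by (simp add: exp_add[symmetric])
qed

text \<open>
  Here \<open>A\<close> stands for the area of a window and \<open>L\<close> for the iterated logarithm in the
  normalizer \<open>sqrt (2 * \<theta> * A * L)\<close>. Truncation at a small multiple \<open>\<eta>\<close> of
  the normalizer is enough: for the Chernoff parameter \<open>t = \<tau> * sqrt (2 * \<theta> * L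
  / A)\<close> the entries close to the truncation level are inflated by at most \<open>exp (L / 8)\<close>,
  while the logarithmic moment gains a factor of order \<open>exp (L / 2)\<close>, since \<open>A\<close> is about
  \<open>exp (2 * exp (L / 2))\<close> or larger.
\<close>

lemma moderate_deviation_upper:
  assumes pos: "0 < \<tau>" "0 < \<kappa>" "0 < \<eta>" "0 < \<theta>" and \<eta>: "16 * \<theta> * \<tau> * \<eta> \<le> 1"
  obtains L0 where "1 \<le> L0" "\<And>L A F y r. L0 \<le> L \<Longrightarrow> 0 < A \<Longrightarrow> 2 * exp (L / 2) - L \<le> ln A \<Longrightarrow> finite F \<Longrightarrow> F \<subseteq> I
      \<Longrightarrow> r \<in> {1, -1} \<Longrightarrow>
      \<P>(\<omega> in M. r * (\<Sum>i\<in>F. trunc (\<eta> * sqrt (2 * \<theta> * A * L)) (Z i \<omega>)) \<ge> y * sqrt (2 * \<theta> * A * L))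
      \<le> exp (- 2 * \<theta> * \<tau> * y * L + card F / A * (\<tau>\<^sup>2 * \<theta> * (s2 + \<kappa>) * L))"
proof -
  \<comment> \<open>The three errors: the mean lost by truncation, the exponential factor below the lower level
    \<open>c = sqrt A / L\<close>, and the entries between \<open>c\<close> and the truncation level.\<close>
  have "\<forall>\<^sub>F L in at_top. \<tau> * m1 / \<eta> \<le> \<kappa> / 3 * (\<tau>\<^sup>2 * \<theta>) * L"
    using pos by real_asymp
  moreover have "\<forall>\<^sub>F L in at_top. exp (\<tau> * sqrt (2 * \<theta>) / sqrt L) * s2 \<le> s2 + \<kappa> / 3"
  proof -
    have "((\<lambda>L. exp (\<tau> * sqrt (2 * \<theta>) / sqrt L) * s2) \<longlongrightarrow> exp 0 * s2) at_top" by real_asymp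
    then have "\<forall>\<^sub>F L in at_top. exp (\<tau> * sqrt (2 * \<theta>) / sqrt L) * s2 < s2 + \<kappa> / 3"
      by (rule order_tendstoD) (use pos in auto)
    then show ?thesis by eventually_elim simp
  qed
  moreover have "\<forall>\<^sub>F L in at_top. exp (L / 8) * m1 \<le> \<kappa> / 3 * (exp (L / 2) - L / 2 - ln L)"
    using pos by real_asymp
  moreover have "\<forall>\<^sub>F L in at_top. 0 < exp (L / 2) - L / 2 - ln (L::real)" by real_asymp
  ultimately have "\<forall>\<^sub>F L in at_top. \<tau> * m1 / \<eta> \<le> \<kappa> / 3 * (\<tau>\<^sup>2 * \<theta>) * L \<and>
     exp (\<tau> * sqrt (2 * \<theta>) / sqrt L) * s2 \<le> s2 + \<kappa> / 3 \<and>
     exp (L / 8) * m1 \<le> \<kappa> / 3 * (exp (L / 2) - L / 2 - ln L) \<and> 0 < exp (L / 2) - L / 2 - ln L"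
    by eventually_elim auto
  then obtain L1 where L1: "\<And>L. L1 \<le> L \<Longrightarrow> \<tau> * m1 / \<eta> \<le> \<kappa> / 3 * (\<tau>\<^sup>2 * \<theta>) * L \<and>
     exp (\<tau> * sqrt (2 * \<theta>) / sqrt L) * s2 \<le> s2 + \<kappa> / 3 \<and>
     exp (L / 8) * m1 \<le> \<kappa> / 3 * (exp (L / 2) - L / 2 - ln L) \<and> 0 < exp (L / 2) - L / 2 - ln L"
    by (auto simp: eventually_at_top_linorder)
  show ?thesis
  proof (rule that[of "max 1 L1"])
    fix L A y r :: real and F
    assume L: "max 1 L1 \<le> L" and A: "0 < A" "2 * exp (L / 2) - L \<le> ln A"
      and F: "finite F" "F \<subseteq> I" and r: "r \<in> {1, -1}"
    have Lpos: "0 < L" using L by auto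
    define b where "b = sqrt (2 * \<theta> * A * L)"
    define t where "t = \<tau> * sqrt (2 * \<theta> * L / A)"
    define c where "c = sqrt A / L"
    have bpos: "0 < b" "0 < t" "0 < c" using A Lpos pos by (auto simp: b_def t_def c_def)
    have b2: "b * b = 2 * \<theta> * A * L" using A Lpos pos by (simp add: b_def)
    have t_b: "t = \<tau> * b / A"
    proof -
      have "sqrt (2 * \<theta> * L / A) = sqrt (2 * \<theta> * A * L) / A"
        using A by (simp add: real_sqrt_mult real_sqrt_divide field_simps)
      then show ?thesis by (simp add: t_def b_def)
    qed
    have tb: "t * b = 2 * \<theta> * \<tau> * L" using b2 A by (simp add: t_b field_simps)
    have At: "A * t\<^sup>2 / 2 = \<tau>\<^sup>2 * \<theta> * L" using A Lpos pos by (simp add: t_def power_mult_distrib)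
    have tc: "t * c = \<tau> * sqrt (2 * \<theta>) / sqrt L"
    proof -
      have "sqrt L / L = 1 / sqrt L" using Lpos by (simp add: field_simps)
      then show ?thesis using A Lpos by (simp add: t_def c_def real_sqrt_mult real_sqrt_divide field_simps)
    qed
    have tbeta: "t * (\<eta> * b) \<le> L / 8"
    proof -
      have "t * (\<eta> * b) = (16 * \<theta> * \<tau> * \<eta>) * (L / 8)" using tb by (simp add: algebra_simps)
      also have "\<dots> \<le> 1 * (L / 8)" using \<eta> Lpos by (intro mult_right_mono) auto
      finally show ?thesis by simp
    qed
    have lnc: "exp (L / 2) - L / 2 - ln L \<le> log_plus c"
    proof -
      have "ln c = ln A / 2 - ln L" using A Lpos by (simp add: c_def ln_div ln_sqrt)
      then show ?thesis using A by (simp add: log_plus_def)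
    qed
    note l1 = L1[of L]
    have e1: "A * (t / (\<eta> * b * log_plus (\<eta> * b)) * m1) \<le> \<kappa> / 3 * (\<tau>\<^sup>2 * \<theta>) * L"
    proof -
      have "A * (t / (\<eta> * b * log_plus (\<eta> * b)) * m1) = (\<tau> * m1 / \<eta>) / log_plus (\<eta> * b)"
        using A bpos pos log_plus_pos[of "\<eta> * b"] by (simp add: t_b field_simps)
      also have "\<dots> \<le> (\<tau> * m1 / \<eta>) / 1"
        using pos m1_nonneg log_plus_ge_1[of "\<eta> * b"] by (intro divide_left_mono) auto
      also have "\<dots> \<le> \<kappa> / 3 * (\<tau>\<^sup>2 * \<theta>) * L" using l1 L by simp
      finally show ?thesis .
    qed
    have e2: "exp (t * c) * s2 \<le> s2 + \<kappa> / 3" using l1 L by (simp add: tc)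
    have e3: "exp (t * (\<eta> * b)) / log_plus c * m1 \<le> \<kappa> / 3"
    proof -
      have "exp (t * (\<eta> * b)) * m1 \<le> exp (L / 8) * m1" using tbeta m1_nonneg by (intro mult_right_mono) auto
      also have "\<dots> \<le> \<kappa> / 3 * (exp (L / 2) - L / 2 - ln L)" using l1 L by simp
      also have "\<dots> \<le> \<kappa> / 3 * log_plus c" using lnc pos by (intro mult_left_mono) auto
      finally show ?thesis using log_plus_pos[of c] by (simp add: field_simps)
    qed
    let ?K = "t / (\<eta> * b * log_plus (\<eta> * b)) * m1
         + t\<^sup>2 / 2 * (exp (t * c) * s2 + exp (t * (\<eta> * b)) / log_plus c * m1)"
    have "A * ?K = A * (t / (\<eta> * b * log_plus (\<eta> * b)) * m1) + (A * t\<^sup>2 / 2) * (exp (t * c) * s2 + exp (t * (\<eta> * b)) / log_plus c * m1)"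
      by (simp add: algebra_simps)
    also have "\<dots> \<le> \<kappa> / 3 * (\<tau>\<^sup>2 * \<theta>) * L + (\<tau>\<^sup>2 * \<theta> * L) * (s2 + \<kappa> / 3 + \<kappa> / 3)"
      unfolding At using e1 e2 e3 pos Lpos by (intro add_mono mult_left_mono) auto
    also have "\<dots> = \<tau>\<^sup>2 * \<theta> * (s2 + \<kappa>) * L" by (simp add: algebra_simps)
    finally have "?K \<le> (\<tau>\<^sup>2 * \<theta> * (s2 + \<kappa>) * L) / A" using A by (simp add: field_simps)
    then have K: "card F * ?K \<le> card F * ((\<tau>\<^sup>2 * \<theta> * (s2 + \<kappa>) * L) / A)" by (rule mult_left_mono) simp
    have "\<P>(\<omega> in M. r * (\<Sum>i\<in>F. trunc (\<eta> * b) (Z i \<omega>)) \<ge> y * b)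
      \<le> exp (- t * (y * b) + card F * ?K)"
      by (rule prob_sum_trunc_ge) (use bpos pos F r in auto)
    also have "\<dots> \<le> exp (- 2 * \<theta> * \<tau> * y * L + card F / A * (\<tau>\<^sup>2 * \<theta> * (s2 + \<kappa>) * L))"
    proof -
      have "t * (y * b) = y * (t * b)" by (simp add: mult_ac)
      then have "- t * (y * b) = - 2 * \<theta> * \<tau> * y * L" unfolding minus_mult_left[symmetric] by (simp add: tb)
      then have "- t * (y * b) + card F * ?K \<le> - 2 * \<theta> * \<tau> * y * L + card F * ((\<tau>\<^sup>2 * \<theta> * (s2 + \<kappa>) * L) / A)"
        using K by linarith
      then show ?thesis by simp
    qed
    finally show "\<P>(\<omega> in M. r * (\<Sum>i\<in>F. trunc (\<eta> * sqrt (2 * \<theta> * A * L)) (Z i \<omega>)) \<ge> y * sqrt (2 * \<theta> * A * L))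
      \<le> exp (- 2 * \<theta> * \<tau> * y * L + card F / A * (\<tau>\<^sup>2 * \<theta> * (s2 + \<kappa>) * L))"
      unfolding b_def by simp
  qed simp
qed

end
end

section \<open>Windows, normalizers and grids\<close>

definition window_end :: "(nat \<Rightarrow> real) \<Rightarrow> nat \<Rightarrow> nat" where
  "window_end f m = nat \<lfloor>real m + real m / f m\<rfloor>"

definition window :: "(nat \<Rightarrow> real) \<Rightarrow> nat \<Rightarrow> nat set" where
  "window f m = {m..window_end f m}"

text \<open>
  The windows have relative length \<open>1 / f m\<close>. The threshold 16 exceeds \<open>exp (exp 1)\<close>, so
  that \<open>ln (ln m)\<close> is at least 1 from there on.
\<close>

definition window_scale :: "(nat \<Rightarrow> real) \<Rightarrow> bool" where
  "window_scale f \<longleftrightarrow> (\<forall>m\<ge>16. 1 \<le> f m \<and> f m \<le> ln (real m)) \<and>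
     (\<forall>m\<ge>16. \<forall>n\<ge>m. f m \<le> f n \<and> real m / f m \<le> real n / f n)"

definition normalizer :: "real \<Rightarrow> (nat \<Rightarrow> real) \<Rightarrow> (nat \<Rightarrow> real) \<Rightarrow> nat \<Rightarrow> nat \<Rightarrow> real" where
  "normalizer c f g m n =
     sqrt (c * real m * real n * ((ln (ln (real m)) + ln (ln (real n))) / (f m * g n)))"

text \<open>
  Cells of this grid have relative length about \<open>i powr (\<alpha> - 1)\<close>, where \<open>i powr
  \<alpha>\<close> is the logarithm of the position. For \<open>\<alpha> < 1 / \<theta>\<close> they are
  short compared with the windows, and for \<open>\<alpha>\<close> close to \<open>1 / \<theta>\<close> there are
  few enough of them for a union bound.
\<close>

definition grid :: "real \<Rightarrow> nat \<Rightarrow> nat" where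
  "grid \<alpha> i = nat \<lfloor>exp (real i powr \<alpha>)\<rfloor>"

lemma ln_16_gt_2: "2 < ln (16::real)"
proof -
  have "exp (1::real) < 3" using e_less_272 by simp
  then have "exp 1 ^ 2 < (3::real) ^ 2" by (intro power_strict_mono) auto
  then have "exp (2::real) < 16" by (simp add: exp_of_nat_mult[of 2 "1::real", simplified, symmetric] power2_eq_square flip: exp_add)
  then show ?thesis using ln_less_cancel_iff[of "exp 2" 16] by simp
qed

lemma ln_gt_2: "2 < ln (real m)" if "16 \<le> m"
  using ln_16_gt_2 that ln_le_cancel_iff[of 16 "real m"] by (simp del: ln_le_cancel_iff)

lemma ln_ln_pos: "0 < ln (ln (real m))" if "16 \<le> m"
  using ln_gt_2[OF that] by simp

lemma window_scaleD:
  assumes "window_scale f" "16 \<le> m"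
  shows "1 \<le> f m" "f m \<le> ln (real m)" "m \<le> n \<Longrightarrow> f m \<le> f n" "m \<le> n \<Longrightarrow> real m / f m \<le> real n / f n"
  using assms by (auto simp: window_scale_def)

lemma window_finite [simp]: "finite (window f m)" by (simp add: window_def)

lemma window_subset: "1 \<le> m \<Longrightarrow> window f m \<subseteq> {1..}" by (auto simp: window_def)

lemma window_end_bounds:
  assumes "0 \<le> real m / f m"
  shows "real (window_end f m) \<le> real m + real m / f m" "real m + real m / f m < real (window_end f m) + 1"
  using assms by (simp_all add: window_end_def)

lemma window_end_ge: "0 \<le> real m / f m \<Longrightarrow> m \<le> window_end f m"
  using window_end_bounds[of m f] by linarith

lemma exp_minus_one_le: "exp d - 1 \<le> 2 * d" if "0 \<le> d" "d \<le> 1" for d :: real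
  proof -
  have "d\<^sup>2 \<le> d" using that mult_left_mono[of d 1 d] by (simp add: power2_eq_square)
  with exp_bound[of d] that show ?thesis by simp
qed

lemma mono_grid: "0 \<le> \<alpha> \<Longrightarrow> mono (grid \<alpha>)"
  unfolding grid_def by (intro monoI nat_mono floor_mono) (auto intro!: powr_mono2)

lemma grid_bounds:
  shows "real (grid \<alpha> i) \<le> exp (real i powr \<alpha>)" "exp (real i powr \<alpha>) < real (grid \<alpha> i) + 1" "1 \<le> grid \<alpha> i"
proof -
  have "(0::real) \<le> exp (real i powr \<alpha>)" by simp
  then show a: "real (grid \<alpha> i) \<le> exp (real i powr \<alpha>)" "exp (real i powr \<alpha>) < real (grid \<alpha> i) + 1"
    unfolding grid_def by linarith+
  have "1 \<le> exp (real i powr \<alpha>)" by simp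
  with a(2) show "1 \<le> grid \<alpha> i" by linarith
qed

lemma filterlim_grid: "0 < \<alpha> \<Longrightarrow> filterlim (grid \<alpha>) at_top sequentially"
proof -
  assume "0 < \<alpha>"
  then have "filterlim (\<lambda>i. exp (real i powr \<alpha>)) at_top sequentially"
    by real_asymp
  then show ?thesis unfolding grid_def
    by (intro filterlim_compose[OF filterlim_nat_sequentially] filterlim_compose[OF filterlim_floor_sequentially])
qed

lemma ln_grid_le: "ln (real (grid \<alpha> i)) \<le> real i powr \<alpha>"
  using ln_mono[OF grid_bounds(1)[of \<alpha> i]] grid_bounds(3)[of \<alpha> i] by simp

lemma ln_grid_ge:
  assumes "2 \<le> real i powr \<alpha>" shows "real i powr \<alpha> / 2 \<le> ln (real (grid \<alpha> i))"
proof -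
  let ?x = "real i powr \<alpha>"
  have "exp (?x / 2) \<ge> 1 + ?x / 2" by (rule exp_ge_add_one_self)
  with assms have "2 \<le> exp (?x / 2)" by linarith
  then have "exp (?x / 2) * 2 \<le> exp (?x / 2) * exp (?x / 2)" by (intro mult_left_mono) auto
  then have "exp (?x / 2) * 2 \<le> exp ?x" by (simp flip: exp_add)
  moreover have "1 \<le> exp (?x / 2)" by simp
  ultimately have "exp (?x / 2) \<le> real (grid \<alpha> i)" using grid_bounds(2)[of i \<alpha>] by linarith
  then show ?thesis using ln_mono[of "exp (?x / 2)" "real (grid \<alpha> i)"] by simp
qed

text \<open>
  The grid starts at 1, because \<open>0 powr \<alpha> = 0\<close>.
\<close>

lemma in_grid_cell:
  assumes "0 < \<alpha>" "1 \<le> m"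
  obtains i where "grid \<alpha> i \<le> m" "m < grid \<alpha> (Suc i)"
proof -
  have "\<forall>\<^sub>F k in sequentially. Suc m \<le> grid \<alpha> k"
    using filterlim_grid[OF assms(1)] unfolding filterlim_at_top by blast
  then have "\<exists>k. m < grid \<alpha> k" by (auto simp: eventually_sequentially Suc_le_eq)
  define k where "k = (LEAST k. m < grid \<alpha> k)"
  have k: "m < grid \<alpha> k" "\<And>l. l < k \<Longrightarrow> grid \<alpha> l \<le> m"
    using LeastI_ex[OF \<open>\<exists>k. m < grid \<alpha> k\<close>] not_less_Least[of _ "\<lambda>k. m < grid \<alpha> k"]
    unfolding k_def[symmetric] not_less by blast+
  have "grid \<alpha> 0 = 1" using assms by (simp add: grid_def)
  with k(1) assms have "k \<noteq> 0" by (intro notI) auto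
  then obtain i where "k = Suc i" by (cases k) auto
  with k show ?thesis by (intro that[of i]) auto
qed

lemma powr_Suc_diff_le:
  assumes "0 < \<alpha>" "\<alpha> \<le> 1" "1 \<le> i"
  shows "real (Suc i) powr \<alpha> - real i powr \<alpha> \<le> real i powr (\<alpha> - 1)"
proof -
  have "real (Suc i) = real i * (1 + 1 / real i)" using assms by (simp add: field_simps)
  then have "real (Suc i) powr \<alpha> = real i powr \<alpha> * (1 + 1 / real i) powr \<alpha>" by (simp add: powr_mult)
  also have "\<dots> \<le> real i powr \<alpha> * (1 + 1 / real i) powr 1"
    using assms by (intro mult_left_mono powr_mono) auto
  also have "\<dots> = real i powr \<alpha> + real i powr (\<alpha> - 1)" using assms by (simp add: powr_diff field_simps)
  finally show ?thesis by simp
qed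

text \<open>
  The constants 2 and 3 leave room for the rounding of window ends and for the displacement
  of the right end of a window, which moves at most twice as fast as its left end.
\<close>

lemma grid_step_small:
  assumes f: "window_scale f" and \<alpha>: "0 < \<alpha>" "\<alpha> < 1"
    and fine: "(\<lambda>i. f (grid \<alpha> i) * real i powr (\<alpha> - 1)) \<longlonglongrightarrow> 0" and \<delta>: "0 < \<delta>"
  shows "\<forall>\<^sub>F i in sequentially. 16 \<le> grid \<alpha> i \<and>
     2 * (real (grid \<alpha> (Suc i)) - real (grid \<alpha> i)) + 3 \<le> \<delta> * (real (grid \<alpha> i) / f (grid \<alpha> i))"
proof -
  have "(\<lambda>m::nat. ln (real m) / real m) \<longlonglongrightarrow> 0" by real_asymp
  then have "(\<lambda>i. ln (real (grid \<alpha> i)) / real (grid \<alpha> i)) \<longlonglongrightarrow> 0"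
    by (rule filterlim_compose[OF _ filterlim_grid[OF \<alpha>(1)]])
  with fine have "(\<lambda>i. 8 * (f (grid \<alpha> i) * real i powr (\<alpha> - 1)) + 5 * (ln (real (grid \<alpha> i)) / real (grid \<alpha> i))) \<longlonglongrightarrow> 8 * 0 + 5 * 0"
    by (intro tendsto_intros)
  then have "\<forall>\<^sub>F i in sequentially. 8 * (f (grid \<alpha> i) * real i powr (\<alpha> - 1)) + 5 * (ln (real (grid \<alpha> i)) / real (grid \<alpha> i)) < \<delta>"
    by (rule order_tendstoD(2)) (use \<delta> in simp)
  moreover have "\<forall>\<^sub>F i in sequentially. 16 \<le> grid \<alpha> i"
    using filterlim_grid[OF \<alpha>(1)] by (auto simp: filterlim_at_top)
  moreover have "\<forall>\<^sub>F i in sequentially. (1::nat) \<le> i" by (rule eventually_ge_at_top)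
  ultimately show ?thesis
  proof eventually_elim
    case (elim i)
    let ?M = "grid \<alpha> i" and ?d = "real i powr (\<alpha> - 1)" and ?x = "real i powr \<alpha>"
    have M: "16 \<le> real ?M" using elim by simp
    have fM: "1 \<le> f ?M" "f ?M \<le> ln (real ?M)" using window_scaleD[OF f, of ?M] elim by auto
    have d: "0 \<le> ?d" "?d \<le> 1" using elim \<alpha> powr_mono[of "\<alpha> - 1" 0 "real i"] by auto
    have "real (grid \<alpha> (Suc i)) \<le> exp (real (Suc i) powr \<alpha>)" by (rule grid_bounds)
    also have "\<dots> \<le> exp (?x + ?d)" using powr_Suc_diff_le[of \<alpha> i] \<alpha> elim by simp
    also have "\<dots> = exp ?x + exp ?x * (exp ?d - 1)" by (simp add: exp_add algebra_simps)
    also have "\<dots> \<le> exp ?x + exp ?x * (2 * ?d)" using exp_minus_one_le[OF d] by (intro add_left_mono mult_left_mono) auto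
    also have "\<dots> \<le> (real ?M + 1) + (2 * real ?M) * (2 * ?d)"
      using grid_bounds(2)[of i \<alpha>] M d by (intro add_mono mult_right_mono) auto
    finally have step: "2 * (real (grid \<alpha> (Suc i)) - real ?M) + 3 \<le> 8 * ?d * real ?M + 5" by (simp add: algebra_simps)
    also have "\<dots> \<le> \<delta> * (real ?M / f ?M)"
    proof -
      have "f ?M * (8 * ?d * real ?M + 5) = real ?M * (8 * (f ?M * ?d) + 5 * (f ?M / real ?M))" using M by (simp add: field_simps)
      also have "\<dots> \<le> real ?M * (8 * (f ?M * ?d) + 5 * (ln (real ?M) / real ?M))"
        using M fM by (intro mult_left_mono add_left_mono divide_right_mono) auto
      also have "\<dots> \<le> real ?M * \<delta>" using elim M by (intro mult_left_mono) auto
      finally show ?thesis using fM by (simp add: field_simps)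
    qed
    finally show ?case using elim by simp
  qed
qed

lemma window_in_grid_cell:
  assumes f: "window_scale f" and M: "16 \<le> M" and \<delta>: "\<delta> \<le> 1"
    and step: "2 * (real M' - real M) + 3 \<le> \<delta> * (real M / f M)"
    and m: "M \<le> m" "m < M'"
  shows "m \<le> window_end f M" "window_end f M \<le> window_end f m"
    "window_end f m \<le> window_end f M + (2 * (M' - M) + 2)"
    "window_end f m \<le> 4 * M"
    "real (card {M..window_end f M}) \<le> (1 + \<delta>) * (real M / f M)"
    "real (2 * (M' - M) + 2) \<le> \<delta> * (real M / f M)"
proof -
  have fM: "1 \<le> f M" "1 \<le> f m" "f M \<le> f m" "real M / f M \<le> real m / f m"
    using window_scaleD[OF f, of M] window_scaleD[OF f, of m] M m by auto
  let ?a = "real M / f M"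
  have apos: "0 < ?a" using M fM by simp
  have aM: "?a \<le> real M" using fM M by (simp add: field_simps)
  have \<delta>a: "\<delta> * ?a \<le> ?a" using \<delta> apos by (simp add: mult_left_le_one_le del: times_divide_eq_right)
  have MM: "real (M' - M) = real M' - real M" using m by simp
  have "real m / f m \<le> real m / f M" using fM by (intro divide_left_mono) auto
  also have "\<dots> = ?a + (real m - real M) / f M" by (simp add: diff_divide_distrib)
  also have "\<dots> \<le> ?a + (real m - real M)"
    using fM m divide_left_mono[of 1 "f M" "real m - real M"] by simp
  finally have am: "real m / f m \<le> ?a + (real m - real M)" .
  define a am' \<delta>a where "a = ?a" and "am' = real m / f m" and "\<delta>a = \<delta> * ?a"
  have w: "real (window_end f M) \<le> real M + a" "real M + a < real (window_end f M) + 1"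
    "real (window_end f m) \<le> real m + am'" "real m + am' < real (window_end f m) + 1"
    unfolding a_def am'_def using window_end_bounds[of M f] window_end_bounds[of m f] fM by auto
  have mM: "real m + 1 \<le> real M'" using m by linarith
  have rm: "real M \<le> real m" using m by simp
  have facts: "am' \<le> a + (real m - real M)" "0 < a" "a \<le> real M" "\<delta>a \<le> a" "a \<le> am'" "2 * real M' - 2 * real M + 3 \<le> \<delta>a"
    unfolding a_def am'_def \<delta>a_def using am apos aM \<delta>a fM step unfolding right_diff_distrib by auto
  have "real m < real (Suc (window_end f M))" using w facts mM rm unfolding of_nat_Suc by linarith
  then show "m \<le> window_end f M" by (simp only: of_nat_less_iff less_Suc_eq_le)
  have "real (window_end f M) < real (Suc (window_end f m))" using w facts rm unfolding of_nat_Suc by linarith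
  then show "window_end f M \<le> window_end f m" by (simp only: of_nat_less_iff less_Suc_eq_le)
  have "real (window_end f m) < real (window_end f M) + 1 + (2 * (real M' - real M) + 2)" using w facts mM rm unfolding right_diff_distrib by linarith
  also have "\<dots> = real (Suc (window_end f M + (2 * (M' - M) + 2)))" using MM by simp
  finally show "window_end f m \<le> window_end f M + (2 * (M' - M) + 2)" by (simp only: of_nat_less_iff less_Suc_eq_le)
  have "real (window_end f m) \<le> 4 * real M" using w facts mM rm by linarith
  then have "real (window_end f m) \<le> real (4 * M)" by simp
  then show "window_end f m \<le> 4 * M" by (simp only: of_nat_le_iff)
  show "real (2 * (M' - M) + 2) \<le> \<delta> * (real M / f M)" using step unfolding of_nat_add of_nat_mult MM by simp
  have "3 \<le> \<delta>a" using facts mM rm by linarith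
  moreover have "real (card {M..window_end f M}) = real (window_end f M) + 1 - real M"
    using w(2) facts(2) by (simp add: of_nat_diff)
  ultimately have "real (card {M..window_end f M}) \<le> a + \<delta>a" using w by linarith
  then show "real (card {M..window_end f M}) \<le> (1 + \<delta>) * (real M / f M)" unfolding a_def \<delta>a_def by (simp add: distrib_right del: times_divide_eq_right)
qed

text \<open>
  A window starting inside a cell arises from the window at the corner of the cell by
  removing a short initial piece and appending a short final piece.
\<close>

lemma sum_shifted_interval:
  fixes r :: "nat \<Rightarrow> real"
  assumes "M \<le> m" "m \<le> E" "E \<le> e"
  shows "sum r {m..e} = sum r {M..E} - sum r {M..<m} + sum r {Suc E..<Suc e}"
proof -
  have "{M..E} = {M..<m} \<union> {m..E}" "{m..e} = {m..E} \<union> {Suc E..<Suc e}" using assms by auto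
  moreover have "sum r ({M..<m} \<union> {m..E}) = sum r {M..<m} + sum r {m..E}"
    "sum r ({m..E} \<union> {Suc E..<Suc e}) = sum r {m..E} + sum r {Suc E..<Suc e}"
    by (rule sum.union_disjoint; auto)+
  ultimately have "sum r {M..E} = sum r {M..<m} + sum r {m..E}" "sum r {m..e} = sum r {m..E} + sum r {Suc E..<Suc e}"
    by metis+
  then show ?thesis by simp
qed

section \<open>Oscillation of window sums within a grid cell\<close>

text \<open>
  The three pieces of a shifted window as increasing families indexed by their length: \<open>k =
  0\<close> is the constant window at the corner, \<open>k = 1\<close> the removed and \<open>k = 2\<close> the appended
  piece.
\<close>

definition chain :: "nat \<Rightarrow> nat \<Rightarrow> nat \<Rightarrow> nat \<Rightarrow> nat set" where
  "chain M E k p = (if k = 0 then {M..E} else if k = 1 then {M..<M + p} else {Suc E..<Suc E + p})"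

lemma mono_chain: "mono (chain M E k)"
  by (auto simp: chain_def mono_def)

lemma finite_chain [simp]: "finite (chain M E k p)"
  by (simp add: chain_def)

lemma chain_subset: "1 \<le> M \<Longrightarrow> chain M E k p \<subseteq> {1..}"
  by (auto simp: chain_def)

lemma window_sum_expand:
  fixes v :: "nat \<times> nat \<Rightarrow> real"
  assumes m: "M \<le> m" "m \<le> E" "E \<le> window_end f m" and n: "N \<le> n" "n \<le> E'" "E' \<le> window_end g n"
  defines "p \<equiv> \<lambda>k::nat. if k = 1 then m - M else window_end f m - E"
    and "q \<equiv> \<lambda>k::nat. if k = 1 then n - N else window_end g n - E'"
    and "sg \<equiv> \<lambda>k::nat. if k = 1 then - 1 else (1::real)"
  shows "(\<Sum>c\<in>window f m \<times> window g n. v c) =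
    (\<Sum>k<3. \<Sum>l<3. sg k * sg l * (\<Sum>c\<in>chain M E k (p k) \<times> chain N E' l (q l). v c))"
proof -
  have F: "sum r (window f m) = (\<Sum>k<3. sg k * sum r (chain M E k (p k)))" for r :: "nat \<Rightarrow> real"
    using m sum_shifted_interval[OF m, of r] by (simp add: window_def chain_def p_def sg_def numeral_3_eq_3)
  have G: "sum r (window g n) = (\<Sum>k<3. sg k * sum r (chain N E' k (q k)))" for r :: "nat \<Rightarrow> real"
    using n sum_shifted_interval[OF n, of r] by (simp add: window_def chain_def q_def sg_def numeral_3_eq_3)
  have "(\<Sum>c\<in>window f m \<times> window g n. v c) = (\<Sum>i\<in>window f m. \<Sum>j\<in>window g n. v (i, j))"
    by (simp add: sum.cartesian_product case_prod_unfold)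
  also have "\<dots> = (\<Sum>k<3. sg k * (\<Sum>i\<in>chain M E k (p k). \<Sum>l<3. sg l * (\<Sum>j\<in>chain N E' l (q l). v (i, j))))"
    by (simp add: F G)
  also have "\<dots> = (\<Sum>k<3. \<Sum>l<3. sg k * sg l * (\<Sum>i\<in>chain M E k (p k). \<Sum>j\<in>chain N E' l (q l). v (i, j)))"
    by (subst sum.swap) (simp add: sum_distrib_left mult.assoc)
  finally show ?thesis by (simp add: sum.cartesian_product case_prod_unfold)
qed

text \<open>
  Expanding a window sum over the pieces in both directions gives the main window at the
  corner of the cell and eight strips. A strip has at most \<open>2 * \<delta>\<close> times the area
  of a window, and it is controlled for all positions in the cell at once by the maximal
  inequality. Its losses, a factor 9 in the level and in the probability for each of eight
  strips, account for the two factors 72.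
\<close>

lemma (in prob_space) grid_cell_prob:
  fixes V :: "nat \<times> nat \<Rightarrow> 'a \<Rightarrow> real"
  assumes ind: "indep_vars (\<lambda>_. borel) V ({1..} \<times> {1..})"
    and f: "window_scale f" "16 \<le> K" "2 * (real K' - real K) + 3 \<le> \<delta> * (real K / f K)"
    and g: "window_scale g" "16 \<le> N" "2 * (real N' - real N) + 3 \<le> \<delta> * (real N / g N)"
    and \<delta>: "0 < \<delta>" "\<delta> \<le> 1" and b: "0 < b"
    and r: "0 \<le> r"
    and main: "K < K' \<Longrightarrow> N < N' \<Longrightarrow> \<P>(\<omega> in M. (\<Sum>c\<in>{K..window_end f K} \<times> {N..window_end g N}. V c \<omega>) \<ge> s1 * b) \<le> r"
    and strips: "\<And>F. finite F \<Longrightarrow> F \<subseteq> {1..} \<times> {1..} \<Longrightarrow>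
       card F \<le> 2 * \<delta> * (real K / f K * (real N / g N)) \<Longrightarrow> \<P>(\<omega> in M. \<bar>\<Sum>c\<in>F. V c \<omega>\<bar> > y * b) \<le> r'"
  shows "\<P>(\<omega> in M. \<exists>m\<in>{K..<K'}. \<exists>n\<in>{N..<N'}. (\<Sum>c\<in>window f m \<times> window g n. V c \<omega>) > (s1 + 72 * y) * b)
     \<le> r + 72 * r'"
proof -
  let ?a = "real K / f K" and ?c = "real N / g N"
  have ac: "0 < ?a" "0 < ?c" using window_scaleD(1)[OF f(1,2)] window_scaleD(1)[OF g(1,2)] f(2) g(2) by auto
  show ?thesis
proof (cases "K < K' \<and> N < N'")
  case False
  then have "{\<omega>\<in>space M. \<exists>m\<in>{K..<K'}. \<exists>n\<in>{N..<N'}. (\<Sum>c\<in>window f m \<times> window g n. V c \<omega>) > (s1 + 72 * y) * b} = {}"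
    by auto
  moreover have "\<P>(\<omega> in M. \<bar>\<Sum>c\<in>{}. V c \<omega>\<bar> > y * b) \<le> r'"
  proof (rule strips)
    have "0 \<le> 2 * \<delta> * (?a * ?c)" using \<delta> ac by (intro mult_nonneg_nonneg) auto
    then show "real (card {}) \<le> 2 * \<delta> * (?a * ?c)" by (simp only: card.empty of_nat_0)
  qed auto
  then have "0 \<le> r'" by (rule order_trans[OF measure_nonneg])
  ultimately show ?thesis using r by (simp only: measure_empty)
next
  case True
  let ?E = "window_end f K" and ?E' = "window_end g N"
  define P Q where "P = 2 * (K' - K) + 2" and "Q = 2 * (N' - N) + 2"
  note wf = window_in_grid_cell[OF f(1,2) \<delta>(2) f(3)] and wg = window_in_grid_cell[OF g(1,2) \<delta>(2) g(3)]
  define S where "S = (\<lambda>k l p q \<omega>. \<Sum>c\<in>chain K ?E k p \<times> chain N ?E' l q. V c \<omega>)"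
  have V_meas [measurable]: "V c \<in> borel_measurable M" if "c \<in> {1..} \<times> {1..}" for c
    using ind that by (auto simp: indep_vars_def)
  have sub: "chain K ?E k p \<times> chain N ?E' l q \<subseteq> {1..} \<times> {1..}" for k l p q
    by (intro Sigma_mono chain_subset) (use f(2) g(2) in auto)
  have S_meas [measurable]: "S k l p q \<in> borel_measurable M" for k l p q
    unfolding S_def using sub[of k p l q] by (intro borel_measurable_sum V_meas) blast
  have card_f: "real (card (chain K ?E k p)) \<le> (if k = 0 then (1 + \<delta>) * ?a else \<delta> * ?a)" if "p \<le> P" for k p
    using wf(5)[of K] wf(6)[of K] True that
    by (cases "k = 0") (auto simp: chain_def P_def intro: order_trans[of _ "real P"] simp del: times_divide_eq_right)
  have card_g: "real (card (chain N ?E' k p)) \<le> (if k = 0 then (1 + \<delta>) * ?c else \<delta> * ?c)" if "p \<le> Q" for k p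
    using wg(5)[of N] wg(6)[of N] True that
    by (cases "k = 0") (auto simp: chain_def Q_def intro: order_trans[of _ "real Q"] simp del: times_divide_eq_right)
  have strip: "\<P>(\<omega> in M. \<exists>p\<le>P. \<exists>q\<le>Q. \<bar>S k l p q \<omega>\<bar> > 9 * (y * b)) \<le> 9 * r'" if kl: "k \<noteq> 0 \<or> l \<noteq> 0" for k l
    unfolding S_def
  proof (rule etemadi_rectangles[OF ind])
    fix p q assume pq: "p \<le> P" "q \<le> Q"
    have "real (card (chain K ?E k p \<times> chain N ?E' l q)) = real (card (chain K ?E k p)) * real (card (chain N ?E' l q))"
      by (simp add: card_cartesian_product)
    also have "\<dots> \<le> (if k = 0 then (1 + \<delta>) * ?a else \<delta> * ?a) * (if l = 0 then (1 + \<delta>) * ?c else \<delta> * ?c)"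
    proof (intro mult_mono card_f card_g pq)
      have "0 \<le> (1 + \<delta>) * ?a" "0 \<le> \<delta> * ?a" using \<delta> ac by (intro mult_nonneg_nonneg; linarith)+
      then show "0 \<le> (if k = 0 then (1 + \<delta>) * ?a else \<delta> * ?a)" by presburger
    qed simp
    also have "\<dots> = (if k = 0 then 1 + \<delta> else \<delta>) * (if l = 0 then 1 + \<delta> else \<delta>) * (?a * ?c)" by simp
    also have "\<dots> \<le> 2 * \<delta> * (?a * ?c)"
    proof (rule mult_right_mono)
      have "\<delta> * \<delta> \<le> \<delta>" using \<delta> by (simp add: mult_left_le_one_le)
      then have "\<delta> * (1 + \<delta>) \<le> 2 * \<delta>" "\<delta> * \<delta> \<le> 2 * \<delta>" using \<delta> by (auto simp: distrib_left)
      then show "(if k = 0 then 1 + \<delta> else \<delta>) * (if l = 0 then 1 + \<delta> else \<delta>) \<le> 2 * \<delta>"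
        using kl by (auto simp: mult.commute)
    qed (rule less_imp_le[OF mult_pos_pos[OF ac]])
    finally show "\<P>(\<omega> in M. \<bar>\<Sum>c\<in>chain K ?E k p \<times> chain N ?E' l q. V c \<omega>\<bar> > y * b) \<le> r'"
      by (intro strips sub) auto
  qed (use mono_chain sub in auto)
  define J where "J = ({..<3} \<times> {..<3} - {(0, 0)} :: (nat \<times> nat) set)"
  have J: "finite J" "card J = 8" unfolding J_def by (simp_all add: card_Diff_singleton_if)
  define B where "B = (\<lambda>kl. {\<omega>\<in>space M. \<exists>p\<le>P. \<exists>q\<le>Q. \<bar>S (fst kl) (snd kl) p q \<omega>\<bar> > 9 * (y * b)})"
  define B0 where "B0 = {\<omega>\<in>space M. S 0 0 0 0 \<omega> \<ge> s1 * b}"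
  have [measurable]: "B kl \<in> events" for kl unfolding B_def by measurable
  have [measurable]: "B0 \<in> events" unfolding B0_def by measurable
  have sub2: "{\<omega>\<in>space M. \<exists>m\<in>{K..<K'}. \<exists>n\<in>{N..<N'}. (\<Sum>c\<in>window f m \<times> window g n. V c \<omega>) > (s1 + 72 * y) * b}
    \<subseteq> B0 \<union> (\<Union>kl\<in>J. B kl)"
  proof (rule subsetI, rule ccontr)
    fix \<omega> assume w: "\<omega> \<in> {\<omega>\<in>space M. \<exists>m\<in>{K..<K'}. \<exists>n\<in>{N..<N'}. (\<Sum>c\<in>window f m \<times> window g n. V c \<omega>) > (s1 + 72 * y) * b}"
      and nB: "\<omega> \<notin> B0 \<union> (\<Union>kl\<in>J. B kl)"
    from w obtain m n where m: "K \<le> m" "m < K'" and n: "N \<le> n" "n < N'"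
      and big: "(\<Sum>c\<in>window f m \<times> window g n. V c \<omega>) > (s1 + 72 * y) * b" by auto
    define p where "p = (\<lambda>k::nat. if k = 1 then m - K else window_end f m - ?E)"
    define q where "q = (\<lambda>k::nat. if k = 1 then n - N else window_end g n - ?E')"
    define sg where "sg = (\<lambda>k::nat. if k = 1 then - 1 else (1::real))"
    have exp: "(\<Sum>c\<in>window f m \<times> window g n. V c \<omega>) = (\<Sum>k<3. \<Sum>l<3. sg k * sg l * S k l (p k) (q l) \<omega>)"
      unfolding S_def p_def q_def sg_def
      by (rule window_sum_expand[OF m(1) wf(1,2)[OF m] n(1) wg(1,2)[OF n]])
    have pP: "p k \<le> P" for k using wf(3)[OF m] m by (auto simp: p_def P_def)
    have qQ: "q k \<le> Q" for k using wg(3)[OF n] n by (auto simp: q_def Q_def)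
    have small: "sg k * sg l * S k l (p k) (q l) \<omega> \<le> 9 * (y * b)" if "(k, l) \<in> J" for k l
    proof -
      have "\<omega> \<in> space M" "\<omega> \<notin> B (k, l)" using w nB that by blast+
      then have "\<not> \<bar>S k l (p k) (q l) \<omega>\<bar> > 9 * (y * b)"
        unfolding B_def fst_conv snd_conv using pP qQ by blast
      moreover have "sg k * sg l = 1 \<or> sg k * sg l = - 1" by (auto simp: sg_def)
      ultimately show ?thesis by (elim disjE) auto
    qed
    have "S 0 0 (p 0) (q 0) \<omega> = S 0 0 0 0 \<omega>" by (simp add: S_def chain_def)
    then have main': "S 0 0 (p 0) (q 0) \<omega> < s1 * b" using nB w by (auto simp: B0_def)
    have "(\<Sum>k<3. \<Sum>l<3. sg k * sg l * S k l (p k) (q l) \<omega>) = (\<Sum>(k,l)\<in>{..<3}\<times>{..<3}. sg k * sg l * S k l (p k) (q l) \<omega>)"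
      by (simp add: sum.cartesian_product)
    also have "\<dots> = sg 0 * sg 0 * S 0 0 (p 0) (q 0) \<omega> + (\<Sum>(k,l)\<in>J. sg k * sg l * S k l (p k) (q l) \<omega>)"
      unfolding J_def by (subst sum.remove[of _ "(0,0)"]) auto
    also have "\<dots> \<le> s1 * b + (\<Sum>(k,l)\<in>J. 9 * (y * b))"
      using main' small by (intro add_mono sum_mono) (auto simp: sg_def)
    also have "\<dots> = (s1 + 72 * y) * b" by (simp add: J algebra_simps)
    finally show False using big exp by simp
  qed
  have "\<P>(\<omega> in M. \<exists>m\<in>{K..<K'}. \<exists>n\<in>{N..<N'}. (\<Sum>c\<in>window f m \<times> window g n. V c \<omega>) > (s1 + 72 * y) * b)
     \<le> prob (B0 \<union> (\<Union>kl\<in>J. B kl))"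
    by (rule finite_measure_mono[OF sub2]) (use J in auto)
  also have "\<dots> \<le> prob B0 + prob (\<Union>kl\<in>J. B kl)" by (rule measure_Un_le) (use J in auto)
  also have "\<dots> \<le> prob B0 + (\<Sum>kl\<in>J. prob (B kl))"
    by (intro add_left_mono measure_UNION_le) (use J in auto)
  also have "\<dots> \<le> r + (\<Sum>kl\<in>J. 9 * r')"
  proof (intro add_mono sum_mono)
    show "prob B0 \<le> r" using main True by (simp add: B0_def S_def chain_def)
    show "prob (B kl) \<le> 9 * r'" if "kl \<in> J" for kl
      unfolding B_def by (rule strip) (use that in \<open>auto simp: J_def prod_eq_iff\<close>)
  qed
  finally show ?thesis by (simp add: J)
qed
qed

section \<open>Probability of an exceptional grid cell\<close>

lemma normalizer_area:
  "normalizer (2 * \<theta>) f g m n =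
     sqrt (2 * \<theta> * (real m / f m * (real n / g n)) * (ln (ln (real m)) + ln (ln (real n))))"
  by (simp add: normalizer_def mult_ac)

lemma normalizer_mono:
  assumes f: "window_scale f" and g: "window_scale g" and \<theta>: "0 \<le> \<theta>"
    and m: "16 \<le> m" "m \<le> m'" and n: "16 \<le> n" "n \<le> n'"
  shows "normalizer (2 * \<theta>) f g m n \<le> normalizer (2 * \<theta>) f g m' n'"
proof -
  have "0 \<le> real m / f m" "0 \<le> real n / g n" "0 \<le> real m' / f m'" "0 \<le> real n' / g n'"
    using window_scaleD(1)[OF f, of m] window_scaleD(1)[OF g, of n] window_scaleD(1)[OF f, of m'] window_scaleD(1)[OF g, of n'] m n by auto
  moreover have "real m / f m \<le> real m' / f m'" "real n / g n \<le> real n' / g n'"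
    using window_scaleD(4)[OF f, of m m'] window_scaleD(4)[OF g, of n n'] m n by auto
  moreover have "ln (ln (real m)) \<le> ln (ln (real m'))" "ln (ln (real n)) \<le> ln (ln (real n'))"
    using ln_gt_2[of m] ln_gt_2[of n] m n by auto
  moreover have "0 < ln (ln (real m))" "0 < ln (ln (real n))" using ln_ln_pos m n by auto
  ultimately show ?thesis unfolding normalizer_area
    using \<theta> by (intro real_sqrt_le_mono mult_mono add_mono mult_nonneg_nonneg add_nonneg_nonneg) auto
qed

lemma normalizer_pos:
  assumes f: "window_scale f" and g: "window_scale g" and "0 < c" "16 \<le> m" "16 \<le> n"
  shows "0 < normalizer c f g m n"
proof -
  have "0 < f m" "0 < g n" "0 < ln (ln (real m)) + ln (ln (real n))"
    using window_scaleD(1)[OF f, of m] window_scaleD(1)[OF g, of n] ln_ln_pos[of m] ln_ln_pos[of n] assms by linarith+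
  then have "0 < c * real m * real n * ((ln (ln (real m)) + ln (ln (real n))) / (f m * g n))"
    using assms by (intro mult_pos_pos divide_pos_pos) auto
  then show ?thesis by (simp add: normalizer_def)
qed

text \<open>
  Needed to compare the entries of a window, which are bounded by the normalizer at their
  own position, with the truncation level belonging to the cell.
\<close>

lemma normalizer_window_le:
  assumes f: "window_scale f" and g: "window_scale g" and \<theta>: "0 \<le> \<theta>"
    and m: "16 \<le> m" "m \<le> p" "p \<le> 4 * m" and n: "16 \<le> n" "n \<le> q" "q \<le> 4 * n"
  shows "normalizer (2 * \<theta>) f g p q \<le> 6 * normalizer (2 * \<theta>) f g m n"
proof -
  have one: "real p / f p \<le> 4 * (real m / f m)" "0 \<le> real p / f p" "ln (ln (real p)) \<le> 2 * ln (ln (real m))" "0 < ln (ln (real p))"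
    if f: "window_scale f" and m: "16 \<le> m" "m \<le> p" "p \<le> 4 * m" for f m p
  proof -
    have fm: "1 \<le> f m" "f m \<le> f p" using window_scaleD[OF f m(1)] m by auto
    have "real p / f p \<le> real p / f m" using fm by (intro divide_left_mono) auto
    also have "\<dots> \<le> (4 * real m) / f m" using fm m by (intro divide_right_mono) auto
    finally show "real p / f p \<le> 4 * (real m / f m)" by simp
    show "0 \<le> real p / f p" using fm by simp
    show "0 < ln (ln (real p))" using ln_ln_pos[of p] m by simp
    have m2: "2 < ln (real m)" using ln_gt_2 m by simp
    have "ln (4::real) \<le> 2" using ln_16_gt_2 ln_add_one_self_le_self2[of 1] ln_mult_pos[of 2 2] ln_2_less_1 by simp
    have "ln (real p) \<le> ln (4 * real m)" using m by (subst ln_le_cancel_iff) auto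
    also have "\<dots> = ln 4 + ln (real m)" using m by (subst ln_mult) auto
    also have "\<dots> \<le> ln (real m) * ln (real m)"
    proof -
      have "2 * ln (real m) \<le> ln (real m) * ln (real m)" using m2 by (intro mult_right_mono) auto
      then show ?thesis using m2 \<open>ln 4 \<le> 2\<close> by linarith
    qed
    finally have "ln (ln (real p)) \<le> ln (ln (real m) * ln (real m))"
      using m2 ln_gt_2[of p] m by (subst ln_le_cancel_iff) auto
    also have "\<dots> = 2 * ln (ln (real m))" using m2 by (simp add: ln_mult_pos)
    finally show "ln (ln (real p)) \<le> 2 * ln (ln (real m))" .
  qed
  note F = one[OF f m] and G = one[OF g n]
  have nn: "0 \<le> real m / f m" "0 \<le> real n / g n" using window_scaleD(1)[OF f m(1)] window_scaleD(1)[OF g n(1)] by auto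
  have pos: "0 < ln (ln (real m))" "0 < ln (ln (real n))" using ln_ln_pos m n by auto
  have "normalizer (2 * \<theta>) f g p q \<le> sqrt (2 * \<theta> * (4 * (real m / f m) * (4 * (real n / g n))) * (2 * ln (ln (real m)) + 2 * ln (ln (real n))))"
    unfolding normalizer_area using F G \<theta> nn
    by (intro real_sqrt_le_mono mult_mono add_mono mult_nonneg_nonneg add_nonneg_nonneg) auto
  also have "\<dots> = sqrt (32 * (2 * \<theta> * (real m / f m * (real n / g n)) * (ln (ln (real m)) + ln (ln (real n)))))"
    by (rule arg_cong[where f = sqrt]) (simp add: algebra_simps)
  also have "\<dots> \<le> sqrt (36 * (2 * \<theta> * (real m / f m * (real n / g n)) * (ln (ln (real m)) + ln (ln (real n)))))"
    using \<theta> nn pos by (intro real_sqrt_le_mono mult_right_mono mult_nonneg_nonneg add_nonneg_nonneg) auto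
  also have "\<dots> = 6 * normalizer (2 * \<theta>) f g m n"
    unfolding normalizer_area by (subst real_sqrt_mult) (simp add: real_sqrt_unique[of 6])
  finally show ?thesis .
qed

text \<open>
  With \<open>u = ln m\<close> and \<open>v = ln n\<close> one has \<open>exp (L / 2) = sqrt (u * v)\<close>, at most \<open>(u +
  v) / 2\<close>. This reduces all asymptotics in two indices to the single parameter \<open>L\<close>.
\<close>

lemma area_exponentially_large:
  assumes f: "window_scale f" "16 \<le> m" and g: "window_scale g" "16 \<le> n"
  defines "L \<equiv> ln (ln (real m)) + ln (ln (real n))"
  shows "2 * exp (L / 2) - L \<le> ln (real m / f m * (real n / g n))"
proof -
  have fm: "1 \<le> f m" "f m \<le> ln (real m)" and gn: "1 \<le> g n" "g n \<le> ln (real n)"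
    using window_scaleD[OF f] window_scaleD[OF g] by auto
  let ?u = "ln (real m)" and ?v = "ln (real n)"
  have uv: "2 < ?u" "2 < ?v" using ln_gt_2 f(2) g(2) by auto
  have "(exp (L / 2))\<^sup>2 = exp L" by (simp add: power2_eq_square flip: exp_add)
  then have "exp (L / 2) = sqrt (exp L)" by (simp add: real_sqrt_unique)
  also have "exp L = ?u * ?v" using uv by (simp add: L_def exp_add)
  also have "sqrt (?u * ?v) \<le> (?u + ?v) / 2" using uv arith_geo_mean_sqrt[of ?u ?v] by simp
  finally have "2 * exp (L / 2) \<le> ?u + ?v" by simp
  moreover have "ln (real m / f m * (real n / g n)) = ?u - ln (f m) + (?v - ln (g n))"
    using fm gn f(2) g(2) by (simp add: ln_mult ln_div)
  moreover have "ln (f m) \<le> ln ?u" "ln (g n) \<le> ln ?v" using fm gn by (simp_all)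
  ultimately show ?thesis by (simp add: L_def)
qed

locale iid_array = iid_family M X Z "{1..} \<times> {1..}"
  for M :: "'a measure" and X :: "'a \<Rightarrow> real" and Z :: "nat \<times> nat \<Rightarrow> 'a \<Rightarrow> real"
begin

text \<open>
  A cell is exceptional with probability at most a constant times \<open>(ln K * ln N) powr (-
  \<theta> * (1 + \<kappa>))\<close>, a product of functions of the two coordinates. The exponent
  exceeds \<open>\<theta>\<close> because the level \<open>s\<close> exceeds the standard deviation.
\<close>

lemma grid_cell_prob_le:
  assumes int: "integrable M (\<lambda>\<omega>. (X \<omega>)\<^sup>2 * log_plus \<bar>X \<omega>\<bar>)" and mean: "expectation X = 0"
    and var: "expectation (\<lambda>\<omega>. (X \<omega>)\<^sup>2) = \<sigma>\<^sup>2" and \<sigma>: "0 \<le> \<sigma>" "\<sigma> < s" and \<theta>: "0 < \<theta>"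
    and f: "window_scale f" and g: "window_scale g"
  obtains \<kappa> \<eta> \<delta> L0 where "0 < \<kappa>" "\<kappa> \<le> 1" "0 < \<eta>" "0 < \<delta>"
    "\<And>K K' N N'. 16 \<le> K \<Longrightarrow> 2 * (real K' - real K) + 3 \<le> \<delta> * (real K / f K) \<Longrightarrow>
       16 \<le> N \<Longrightarrow> 2 * (real N' - real N) + 3 \<le> \<delta> * (real N / g N) \<Longrightarrow>
       L0 \<le> ln (ln (real K)) + ln (ln (real N)) \<Longrightarrow>
       \<P>(\<omega> in M. \<exists>m\<in>{K..<K'}. \<exists>n\<in>{N..<N'}.
          (\<Sum>c\<in>window f m \<times> window g n. trunc (\<eta> * normalizer (2 * \<theta>) f g K N) (Z c \<omega>)) > s * normalizer (2 * \<theta>) f g K N)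
       \<le> 145 * exp (- \<theta> * (1 + \<kappa>) * (ln (ln (real K)) + ln (ln (real N))))"
proof -
  \<comment> \<open>The main window may use the level \<open>s1\<close>; the rest is shared by the strips, so that
    \<open>s1 + 72 * y = s\<close>. With the Chernoff parameters \<open>\<tau>1\<close> and \<open>\<tau>2\<close> the exponents become
    \<open>- 2 * \<theta> * L + (1 - \<kappa>) * \<theta> * L\<close> for the main window and at most \<open>- 3 * \<theta> * L\<close> for a strip,
    where \<open>\<delta>\<close> is so small that the variance of a strip costs no more than \<open>\<theta> * L\<close>.\<close>
  define s1 where "s1 = (\<sigma> + s) / 2"
  define y where "y = (s - s1) / 72"
  define \<rho> where "\<rho> = \<sigma>\<^sup>2 / s1\<^sup>2"
  have s1: "0 < s1" "\<sigma> < s1" "s1 < s" using \<sigma> by (auto simp: s1_def)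
  have y: "0 < y" "s1 + 72 * y = s" using s1 by (simp_all add: y_def field_simps)
  have \<rho>: "0 \<le> \<rho>" "\<rho> < 1" using \<sigma> s1 power_strict_mono[of \<sigma> s1 2] by (auto simp: \<rho>_def)
  define \<kappa> where "\<kappa> = (1 - \<rho>) / 2"
  define \<kappa>0 where "\<kappa>0 = s1\<^sup>2 * (1 - \<rho>) / 8"
  define \<tau>1 where "\<tau>1 = 1 / s1"
  define \<tau>2 where "\<tau>2 = 2 / y"
  define \<eta> where "\<eta> = min (1 / (16 * \<theta> * \<tau>1)) (1 / (16 * \<theta> * \<tau>2))"
  define \<delta> where "\<delta> = min ((1 - \<rho>) / 8) (1 / (2 * \<tau>2\<^sup>2 * (\<sigma>\<^sup>2 + \<kappa>0)))"
  have \<tau>: "0 < \<tau>1" "0 < \<tau>2" using s1 y by (auto simp: \<tau>1_def \<tau>2_def)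
  have \<kappa>: "0 < \<kappa>" "\<kappa> \<le> 1" "0 < \<kappa>0" using \<rho> s1 by (auto simp: \<kappa>_def \<kappa>0_def)
  have \<eta>: "0 < \<eta>" "16 * \<theta> * \<tau>1 * \<eta> \<le> 1" "16 * \<theta> * \<tau>2 * \<eta> \<le> 1"
  proof -
    show "0 < \<eta>" using \<tau> \<theta> by (simp add: \<eta>_def)
    have "\<eta> \<le> 1 / (16 * \<theta> * \<tau>1)" "\<eta> \<le> 1 / (16 * \<theta> * \<tau>2)"
      unfolding \<eta>_def by (rule min.cobounded1 min.cobounded2)+
    then show "16 * \<theta> * \<tau>1 * \<eta> \<le> 1" "16 * \<theta> * \<tau>2 * \<eta> \<le> 1"
      using \<tau> \<theta> by (auto simp: pos_le_divide_eq mult_ac)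
  qed
  have pos0: "0 < \<sigma>\<^sup>2 + \<kappa>0" using \<kappa> by (simp add: add_nonneg_pos)
  have \<delta>: "0 < \<delta>" "\<delta> \<le> 1" "3 * \<delta> \<le> 3 * (1 - \<rho>) / 8" "2 * \<delta> * (\<tau>2\<^sup>2 * (\<sigma>\<^sup>2 + \<kappa>0)) \<le> 1"
  proof -
    show "0 < \<delta>" using \<rho> \<tau> pos0 by (simp add: \<delta>_def)
    have "\<delta> \<le> (1 - \<rho>) / 8" "\<delta> \<le> 1 / (2 * \<tau>2\<^sup>2 * (\<sigma>\<^sup>2 + \<kappa>0))"
      unfolding \<delta>_def by (rule min.cobounded1 min.cobounded2)+
    moreover have "0 < 2 * \<tau>2\<^sup>2 * (\<sigma>\<^sup>2 + \<kappa>0)" using \<tau> pos0 by simp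
    ultimately show "\<delta> \<le> 1" "3 * \<delta> \<le> 3 * (1 - \<rho>) / 8" "2 * \<delta> * (\<tau>2\<^sup>2 * (\<sigma>\<^sup>2 + \<kappa>0)) \<le> 1"
      using \<rho> by (auto simp: pos_le_divide_eq mult_ac)
  qed
  obtain L1 where L1: "1 \<le> L1" "\<And>L A F y r. L1 \<le> L \<Longrightarrow> 0 < A \<Longrightarrow> 2 * exp (L / 2) - L \<le> ln A \<Longrightarrow> finite F \<Longrightarrow> F \<subseteq> {1..} \<times> {1..}
      \<Longrightarrow> r \<in> {1, -1} \<Longrightarrow>
      \<P>(\<omega> in M. r * (\<Sum>i\<in>F. trunc (\<eta> * sqrt (2 * \<theta> * A * L)) (Z i \<omega>)) \<ge> y * sqrt (2 * \<theta> * A * L))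
      \<le> exp (- 2 * \<theta> * \<tau>1 * y * L + card F / A * (\<tau>1\<^sup>2 * \<theta> * (\<sigma>\<^sup>2 + \<kappa>0) * L))"
    by (rule moderate_deviation_upper[OF int mean \<tau>(1) \<kappa>(3) \<eta>(1) \<theta> \<eta>(2), unfolded var]) (rule that, assumption, assumption)
  obtain L2 where L2: "1 \<le> L2" "\<And>L A F y r. L2 \<le> L \<Longrightarrow> 0 < A \<Longrightarrow> 2 * exp (L / 2) - L \<le> ln A \<Longrightarrow> finite F \<Longrightarrow> F \<subseteq> {1..} \<times> {1..}
      \<Longrightarrow> r \<in> {1, -1} \<Longrightarrow>
      \<P>(\<omega> in M. r * (\<Sum>i\<in>F. trunc (\<eta> * sqrt (2 * \<theta> * A * L)) (Z i \<omega>)) \<ge> y * sqrt (2 * \<theta> * A * L))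
      \<le> exp (- 2 * \<theta> * \<tau>2 * y * L + card F / A * (\<tau>2\<^sup>2 * \<theta> * (\<sigma>\<^sup>2 + \<kappa>0) * L))"
    by (rule moderate_deviation_upper[OF int mean \<tau>(2) \<kappa>(3) \<eta>(1) \<theta> \<eta>(3), unfolded var]) (rule that, assumption, assumption)
  show ?thesis
  proof (rule that[OF \<kappa>(1,2) \<eta>(1) \<delta>(1), of "max L1 L2"])
    fix K K' N N' :: nat
    assume K: "16 \<le> K" "2 * (real K' - real K) + 3 \<le> \<delta> * (real K / f K)"
      and N: "16 \<le> N" "2 * (real N' - real N) + 3 \<le> \<delta> * (real N / g N)"
      and L0: "max L1 L2 \<le> ln (ln (real K)) + ln (ln (real N))"
    define L where "L = ln (ln (real K)) + ln (ln (real N))"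
    define A where "A = real K / f K * (real N / g N)"
    define b where "b = normalizer (2 * \<theta>) f g K N"
    define V where "V = (\<lambda>c \<omega>. trunc (\<eta> * b) (Z c \<omega>))"
    have b_eq: "b = sqrt (2 * \<theta> * A * L)" unfolding b_def A_def L_def by (rule normalizer_area)
    have bpos: "0 < b" unfolding b_def by (rule normalizer_pos[OF f g]) (use \<theta> K N in auto)
    have L: "L1 \<le> L" "L2 \<le> L" "0 < L" using L0 L1(1) unfolding L_def by auto
    have ac: "0 < real K / f K" "0 < real N / g N"
      using window_scaleD(1)[OF f K(1)] window_scaleD(1)[OF g N(1)] K N by auto
    then have Apos: "0 < A" unfolding A_def by (rule mult_pos_pos)
    have lnA: "2 * exp (L / 2) - L \<le> ln A" unfolding L_def A_def
      by (rule area_exponentially_large) (use f g K N in auto)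
    have ind: "indep_vars (\<lambda>_. borel) V ({1..} \<times> {1..})"
      unfolding V_def by (rule indep_vars_compose2[OF indep]) auto
    have V_meas [measurable]: "V c \<in> borel_measurable M" if "c \<in> {1..} \<times> {1..}" for c
      using ind that by (auto simp: indep_vars_def)
    define r where "r = exp (- \<theta> * (1 + \<kappa>) * L)"
    let ?W = "{K..window_end f K} \<times> {N..window_end g N}"
    have main: "\<P>(\<omega> in M. (\<Sum>c\<in>?W. V c \<omega>) \<ge> s1 * b) \<le> r" if T: "K < K'" "N < N'"
    proof -
      have W: "finite ?W" "?W \<subseteq> {1..} \<times> {1..}" using K N by auto
      have "\<P>(\<omega> in M. (\<Sum>c\<in>?W. V c \<omega>) \<ge> s1 * b) \<le> exp (- 2 * \<theta> * \<tau>1 * s1 * L + card ?W / A * (\<tau>1\<^sup>2 * \<theta> * (\<sigma>\<^sup>2 + \<kappa>0) * L))"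
        using L1(2)[OF L(1) Apos lnA W, of 1 s1] by (simp add: V_def b_eq)
      also have "\<dots> \<le> exp (- \<theta> * (1 + \<kappa>) * L)"
      proof -
        have cK: "real (card {K..window_end f K}) \<le> (1 + \<delta>) * (real K / f K)"
          by (rule window_in_grid_cell(5)[OF f K(1) \<delta>(2) K(2), of K]) (use T in auto)
        have cN: "real (card {N..window_end g N}) \<le> (1 + \<delta>) * (real N / g N)"
          by (rule window_in_grid_cell(5)[OF g N(1) \<delta>(2) N(2), of N]) (use T in auto)
        have "real (card ?W) \<le> ((1 + \<delta>) * (real K / f K)) * ((1 + \<delta>) * (real N / g N))"
          unfolding card_cartesian_product of_nat_mult
        proof (rule mult_mono[OF cK cN])
          show "0 \<le> (1 + \<delta>) * (real K / f K)" by (rule mult_nonneg_nonneg) (use \<delta> ac in linarith)+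
        qed simp
        also have "\<dots> = (1 + 2 * \<delta> + \<delta> * \<delta>) * A" by (simp add: A_def algebra_simps)
        also have "\<dots> \<le> (1 + 3 * \<delta>) * A" using \<delta> Apos by (intro mult_right_mono) (auto simp: mult_left_le_one_le)
        finally have "card ?W / A \<le> 1 + 3 * \<delta>" using Apos by (simp add: pos_divide_le_eq)
        then have c1: "card ?W / A \<le> 1 + 3 * (1 - \<rho>) / 8" using \<delta>(3) by linarith
        have c2: "\<tau>1\<^sup>2 * (\<sigma>\<^sup>2 + \<kappa>0) = \<rho> + (1 - \<rho>) / 8"
          using s1 by (simp add: \<tau>1_def \<rho>_def \<kappa>0_def field_simps)
        have "(card ?W / A) * (\<tau>1\<^sup>2 * (\<sigma>\<^sup>2 + \<kappa>0)) \<le> (1 + 3 * (1 - \<rho>) / 8) * (\<rho> + (1 - \<rho>) / 8)"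
          unfolding c2 using c1 \<rho> by (intro mult_right_mono) auto
        also have "\<dots> \<le> 1 - \<kappa>"
        proof -
          have "0 \<le> (1 - \<rho>) * (1 - \<rho>)" by simp
          then show ?thesis by (simp add: \<kappa>_def field_simps)
        qed
        finally have "(card ?W / A) * (\<tau>1\<^sup>2 * (\<sigma>\<^sup>2 + \<kappa>0)) * (\<theta> * L) \<le> (1 - \<kappa>) * (\<theta> * L)"
          using \<theta> L by (intro mult_right_mono) auto
        moreover have "\<tau>1 * s1 = 1" using s1 by (simp add: \<tau>1_def)
        then have "- 2 * \<theta> * \<tau>1 * s1 * L = - 2 * (\<theta> * L)" by simp
        moreover have "- \<theta> * (1 + \<kappa>) * L = - 2 * (\<theta> * L) + (1 - \<kappa>) * (\<theta> * L)" by (simp add: algebra_simps)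
        ultimately have "- 2 * \<theta> * \<tau>1 * s1 * L + (card ?W / A) * (\<tau>1\<^sup>2 * (\<sigma>\<^sup>2 + \<kappa>0)) * (\<theta> * L) \<le> - \<theta> * (1 + \<kappa>) * L" by linarith
        then show ?thesis by (simp add: mult_ac)
      qed
      finally show ?thesis by (simp add: r_def)
    qed
    have strips: "\<P>(\<omega> in M. \<bar>\<Sum>c\<in>F. V c \<omega>\<bar> > y * b) \<le> 2 * r"
      if F: "finite F" "F \<subseteq> {1..} \<times> {1..}" "card F \<le> 2 * \<delta> * (real K / f K * (real N / g N))" for F
    proof -
      have [measurable]: "(\<lambda>\<omega>. \<Sum>c\<in>F. V c \<omega>) \<in> borel_measurable M" using F by (intro borel_measurable_sum) auto
      have bnd: "- 2 * \<theta> * \<tau>2 * y * L + card F / A * (\<tau>2\<^sup>2 * \<theta> * (\<sigma>\<^sup>2 + \<kappa>0) * L) \<le> - \<theta> * (1 + \<kappa>) * L"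
      proof -
        have "card F / A \<le> 2 * \<delta>" using F(3) Apos unfolding A_def[symmetric] by (simp add: pos_divide_le_eq)
        then have "card F / A * (\<tau>2\<^sup>2 * (\<sigma>\<^sup>2 + \<kappa>0)) \<le> 2 * \<delta> * (\<tau>2\<^sup>2 * (\<sigma>\<^sup>2 + \<kappa>0))"
          using pos0 by (intro mult_right_mono) auto
        also have "\<dots> \<le> 1" by (rule \<delta>)
        finally have "card F / A * (\<tau>2\<^sup>2 * (\<sigma>\<^sup>2 + \<kappa>0)) * (\<theta> * L) \<le> 1 * (\<theta> * L)"
          using \<theta> L by (intro mult_right_mono) auto
        moreover have "\<tau>2 * y = 2" using y by (simp add: \<tau>2_def)
        then have "- 2 * \<theta> * \<tau>2 * y * L = - 4 * (\<theta> * L)" by (simp add: algebra_simps)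
        moreover have "\<kappa> * (\<theta> * L) \<le> 1 * (\<theta> * L)" using \<kappa> \<theta> L by (intro mult_right_mono) auto
        moreover have "- \<theta> * (1 + \<kappa>) * L = - (\<theta> * L) - \<kappa> * (\<theta> * L)" by (simp add: algebra_simps)
        moreover have "0 < \<theta> * L" using \<theta> L by simp
        ultimately have "- 2 * \<theta> * \<tau>2 * y * L + (card F / A) * (\<tau>2\<^sup>2 * (\<sigma>\<^sup>2 + \<kappa>0)) * (\<theta> * L) \<le> - \<theta> * (1 + \<kappa>) * L" by linarith
        then show ?thesis by (simp add: mult_ac)
      qed
      have each: "\<P>(\<omega> in M. e * (\<Sum>c\<in>F. V c \<omega>) \<ge> y * b) \<le> r" if "e \<in> {1, -1}" for e
      proof -
        have "\<P>(\<omega> in M. e * (\<Sum>c\<in>F. V c \<omega>) \<ge> y * b) \<le> exp (- 2 * \<theta> * \<tau>2 * y * L + card F / A * (\<tau>2\<^sup>2 * \<theta> * (\<sigma>\<^sup>2 + \<kappa>0) * L))"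
          using L2(2)[OF L(2) Apos lnA F(1,2) that, of y] by (simp add: V_def b_eq)
        also have "\<dots> \<le> r" using bnd by (simp add: r_def)
        finally show ?thesis .
      qed
      have "\<P>(\<omega> in M. \<bar>\<Sum>c\<in>F. V c \<omega>\<bar> > y * b) \<le>
         prob ({\<omega>\<in>space M. 1 * (\<Sum>c\<in>F. V c \<omega>) \<ge> y * b} \<union> {\<omega>\<in>space M. -1 * (\<Sum>c\<in>F. V c \<omega>) \<ge> y * b})"
        by (rule finite_measure_mono) auto
      also have "\<dots> \<le> \<P>(\<omega> in M. 1 * (\<Sum>c\<in>F. V c \<omega>) \<ge> y * b) + \<P>(\<omega> in M. -1 * (\<Sum>c\<in>F. V c \<omega>) \<ge> y * b)"
        by (rule measure_Un_le) auto
      also have "\<dots> \<le> 2 * r" using each[of 1] each[of "-1"] by simp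
      finally show ?thesis .
    qed
    have "\<P>(\<omega> in M. \<exists>m\<in>{K..<K'}. \<exists>n\<in>{N..<N'}. (\<Sum>c\<in>window f m \<times> window g n. V c \<omega>) > (s1 + 72 * y) * b)
      \<le> r + 72 * (2 * r)"
      by (rule grid_cell_prob[OF ind f K g N \<delta>(1,2) bpos _ main strips]) (simp_all add: r_def)
    then show "\<P>(\<omega> in M. \<exists>m\<in>{K..<K'}. \<exists>n\<in>{N..<N'}.
          (\<Sum>c\<in>window f m \<times> window g n. trunc (\<eta> * normalizer (2 * \<theta>) f g K N) (Z c \<omega>)) > s * normalizer (2 * \<theta>) f g K N)
       \<le> 145 * exp (- \<theta> * (1 + \<kappa>) * (ln (ln (real K)) + ln (ln (real N))))"
      unfolding y(2) by (simp add: r_def V_def b_def L_def)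
  qed
qed

end

section \<open>The almost sure upper bound\<close>

context iid_array
begin

text \<open>
  Since the bound for a cell factorizes, the sum over all cells is the square of a
  convergent series and only finitely many cells are exceptional. By \<open>exceed\<close>, the
  truncation has no effect on entries with large indices, and within a cell the normalizer
  is smallest at the corner.
\<close>

lemma window_sum_upper_bound:
  assumes int: "integrable M (\<lambda>\<omega>. (X \<omega>)\<^sup>2 * log_plus \<bar>X \<omega>\<bar>)" and mean: "expectation X = 0"
    and var: "expectation (\<lambda>\<omega>. (X \<omega>)\<^sup>2) = \<sigma>\<^sup>2" and \<sigma>: "0 \<le> \<sigma>" "\<sigma> < s" and \<theta>: "1 \<le> \<theta>"
    and f: "window_scale f" and g: "window_scale g"
    and fine_f: "\<And>\<alpha>. 0 < \<alpha> \<Longrightarrow> \<alpha> < 1 / \<theta> \<Longrightarrow> (\<lambda>i. f (grid \<alpha> i) * real i powr (\<alpha> - 1)) \<longlonglongrightarrow> 0"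
    and fine_g: "\<And>\<alpha>. 0 < \<alpha> \<Longrightarrow> \<alpha> < 1 / \<theta> \<Longrightarrow> (\<lambda>i. g (grid \<alpha> i) * real i powr (\<alpha> - 1)) \<longlonglongrightarrow> 0"
    and exceed: "\<And>\<eta>. 0 < \<eta> \<Longrightarrow> AE \<omega> in M. \<exists>k. \<forall>p\<ge>k. \<forall>q\<ge>k. \<bar>Z (p, q) \<omega>\<bar> \<le> \<eta> * normalizer (2 * \<theta>) f g p q"
  shows "AE \<omega> in M. \<exists>k. \<forall>m\<ge>k. \<forall>n\<ge>k.
     (\<Sum>c\<in>window f m \<times> window g n. Z c \<omega>) \<le> s * normalizer (2 * \<theta>) f g m n"
proof -
  have \<theta>0: "0 < \<theta>" using \<theta> by simp
  obtain \<kappa> \<eta> \<delta> L0 where \<kappa>: "0 < \<kappa>" "\<kappa> \<le> 1" and \<eta>: "0 < \<eta>" and \<delta>: "0 < \<delta>"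
    and cell: "\<And>K K' N N'. 16 \<le> K \<Longrightarrow> 2 * (real K' - real K) + 3 \<le> \<delta> * (real K / f K) \<Longrightarrow>
       16 \<le> N \<Longrightarrow> 2 * (real N' - real N) + 3 \<le> \<delta> * (real N / g N) \<Longrightarrow>
       L0 \<le> ln (ln (real K)) + ln (ln (real N)) \<Longrightarrow>
       \<P>(\<omega> in M. \<exists>m\<in>{K..<K'}. \<exists>n\<in>{N..<N'}.
          (\<Sum>c\<in>window f m \<times> window g n. trunc (\<eta> * normalizer (2 * \<theta>) f g K N) (Z c \<omega>)) > s * normalizer (2 * \<theta>) f g K N)
       \<le> 145 * exp (- \<theta> * (1 + \<kappa>) * (ln (ln (real K)) + ln (ln (real N))))"
    by (rule grid_cell_prob_le[OF int mean var \<sigma> \<theta>0 f g]) (rule that, assumption+)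
  define \<delta>1 where "\<delta>1 = min \<delta> 1"
  have \<delta>1: "0 < \<delta>1" "\<delta>1 \<le> 1" "\<delta>1 \<le> \<delta>" using \<delta> by (auto simp: \<delta>1_def)
  \<comment> \<open>\<open>\<alpha> * \<theta> < 1\<close> makes the cells short, and \<open>\<alpha> * p > 1\<close> makes the series of
    \<open>(i powr \<alpha>) powr (- p)\<close> converge.\<close>
  define \<alpha> where "\<alpha> = 1 / (\<theta> * (1 + \<kappa> / 2))"
  define p where "p = \<theta> * (1 + \<kappa>)"
  have \<alpha>: "0 < \<alpha>" "\<alpha> < 1 / \<theta>" "\<alpha> < 1" "1 < \<alpha> * p"
  proof -
    show "0 < \<alpha>" using \<theta> \<kappa> by (simp add: \<alpha>_def)
    have "\<theta> < \<theta> * (1 + \<kappa> / 2)" using \<theta> \<kappa> by simp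
    then show "\<alpha> < 1 / \<theta>" unfolding \<alpha>_def using \<theta> by (intro divide_strict_left_mono) auto
    also have "\<dots> \<le> 1" using \<theta> by simp
    finally show "\<alpha> < 1" .
    have "\<alpha> * p = (1 + \<kappa>) / (1 + \<kappa> / 2)" using \<theta> by (simp add: \<alpha>_def p_def)
    then show "1 < \<alpha> * p" using \<kappa> by (simp add: less_divide_eq)
  qed
  let ?G = "grid \<alpha>"
  let ?b = "\<lambda>i j. normalizer (2 * \<theta>) f g (?G i) (?G j)"
  have "\<forall>\<^sub>F i in sequentially. L0 \<le> ln (ln (real (?G i)))"
  proof -
    have "filterlim (\<lambda>m::nat. ln (ln (real m))) at_top sequentially" by real_asymp
    then have "filterlim (\<lambda>i. ln (ln (real (?G i)))) at_top sequentially"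
      by (rule filterlim_compose[OF _ filterlim_grid[OF \<alpha>(1)]])
    then show ?thesis by (simp add: filterlim_at_top)
  qed
  moreover have "\<forall>\<^sub>F i in sequentially. 2 \<le> real i powr \<alpha>"
  proof -
    have "filterlim (\<lambda>i. real i powr \<alpha>) at_top sequentially" using \<alpha>(1) by real_asymp
    then show ?thesis by (simp add: filterlim_at_top)
  qed
  moreover note grid_step_small[OF f \<alpha>(1,3) fine_f[OF \<alpha>(1,2)] \<delta>1(1)]
    grid_step_small[OF g \<alpha>(1,3) fine_g[OF \<alpha>(1,2)] \<delta>1(1)]
  ultimately have "\<forall>\<^sub>F i in sequentially. L0 \<le> ln (ln (real (?G i))) \<and> 2 \<le> real i powr \<alpha> \<and> 16 \<le> ?G i \<and>
     2 * (real (?G (Suc i)) - real (?G i)) + 3 \<le> \<delta>1 * (real (?G i) / f (?G i)) \<and>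
     2 * (real (?G (Suc i)) - real (?G i)) + 3 \<le> \<delta>1 * (real (?G i) / g (?G i))"
    by eventually_elim auto
  then obtain i1 where i1: "\<And>i. i1 \<le> i \<Longrightarrow> L0 \<le> ln (ln (real (?G i)))" "\<And>i. i1 \<le> i \<Longrightarrow> 2 \<le> real i powr \<alpha>"
     "\<And>i. i1 \<le> i \<Longrightarrow> 16 \<le> ?G i"
     "\<And>i. i1 \<le> i \<Longrightarrow> 2 * (real (?G (Suc i)) - real (?G i)) + 3 \<le> \<delta>1 * (real (?G i) / f (?G i))"
     "\<And>i. i1 \<le> i \<Longrightarrow> 2 * (real (?G (Suc i)) - real (?G i)) + 3 \<le> \<delta>1 * (real (?G i) / g (?G i))"
    unfolding eventually_sequentially by blast
  have to_\<delta>: "2 * (real (?G (Suc i)) - real (?G i)) + 3 \<le> \<delta> * (real (?G i) / h (?G i))"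
    if "2 * (real (?G (Suc i)) - real (?G i)) + 3 \<le> \<delta>1 * (real (?G i) / h (?G i))" "window_scale h" "16 \<le> ?G i" for i and h :: "nat \<Rightarrow> real"
  proof -
    have "0 \<le> real (?G i) / h (?G i)" using window_scaleD(1)[OF that(2,3)] by simp
    then have "\<delta>1 * (real (?G i) / h (?G i)) \<le> \<delta> * (real (?G i) / h (?G i))" using \<delta>1 by (intro mult_right_mono)
    then show ?thesis using that by linarith
  qed
  define E where "E = (\<lambda>i j. if i1 \<le> i \<and> i1 \<le> j then
      {\<omega>\<in>space M. \<exists>m\<in>{?G i..<?G (Suc i)}. \<exists>n\<in>{?G j..<?G (Suc j)}.
          (\<Sum>c\<in>window f m \<times> window g n. trunc (\<eta> * ?b i j) (Z c \<omega>)) > s * ?b i j} else {})"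
  have E_meas: "E i j \<in> events" for i j
  proof -
    have sum_meas: "(\<lambda>\<omega>. \<Sum>c\<in>window f m \<times> window g n. trunc \<beta> (Z c \<omega>)) \<in> borel_measurable M"
      if "m \<in> {?G i..<?G (Suc i)}" "n \<in> {?G j..<?G (Suc j)}" for m n \<beta>
    proof (rule borel_measurable_sum)
      fix c assume "c \<in> window f m \<times> window g n"
      moreover have "1 \<le> m" "1 \<le> n" using that grid_bounds(3)[of \<alpha> i] grid_bounds(3)[of \<alpha> j] by auto
      ultimately have "c \<in> {1..} \<times> {1..}" using window_subset by blast
      then show "(\<lambda>\<omega>. trunc \<beta> (Z c \<omega>)) \<in> borel_measurable M" by measurable
    qed
    have "{\<omega>\<in>space M. (\<Sum>c\<in>window f m \<times> window g n. trunc (\<eta> * ?b i j) (Z c \<omega>)) > s * ?b i j} \<in> events"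
      if "m \<in> {?G i..<?G (Suc i)}" "n \<in> {?G j..<?G (Suc j)}" for m n
      using sum_meas[OF that] by measurable
    then show ?thesis unfolding E_def
      by (cases "i1 \<le> i \<and> i1 \<le> j") (simp_all add: sets.sets_Collect_finite_Ex)
  qed
  define w where "w = (\<lambda>i::nat. 2 powr p * real i powr (- (\<alpha> * p)))"
  have w: "summable w" "\<And>i. 0 \<le> w i" unfolding w_def using \<alpha>(4) by (auto intro!: summable_mult simp: summable_real_powr_iff)
  have p_pos: "0 < p" using \<theta> \<kappa> by (simp add: p_def)
  have exp_le_w: "exp (- p * ln (ln (real (?G i)))) \<le> w i" if "i1 \<le> i" for i
  proof -
    let ?x = "real i powr \<alpha>"
    have x: "2 \<le> ?x" "0 < real i" using i1(2)[OF that] by (auto intro!: gr0I)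
    have "?x / 2 \<le> ln (real (?G i))" by (rule ln_grid_ge[OF x(1)])
    then have "ln (?x / 2) \<le> ln (ln (real (?G i)))" using x by (subst ln_le_cancel_iff) auto
    then have "exp (- p * ln (ln (real (?G i)))) \<le> exp (- p * ln (?x / 2))" using p_pos by simp
    also have "\<dots> = (?x / 2) powr (- p)" using x by (simp add: powr_def)
    also have "\<dots> = ?x powr (- p) / 2 powr (- p)" using x by (simp add: powr_divide)
    also have "\<dots> = w i" by (simp add: w_def powr_powr powr_minus field_simps)
    finally show ?thesis .
  qed
  have E_prob: "prob (E i j) \<le> 145 * (w i * w j)" for i j
  proof (cases "i1 \<le> i \<and> i1 \<le> j")
    case True
    then have ij: "i1 \<le> i" "i1 \<le> j" by auto
    have "0 < ln (ln (real (?G j)))" using ln_ln_pos i1(3) ij by blast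
    then have L: "L0 \<le> ln (ln (real (?G i))) + ln (ln (real (?G j)))" using i1(1)[OF ij(1)] by linarith
    have "prob (E i j) \<le> 145 * exp (- \<theta> * (1 + \<kappa>) * (ln (ln (real (?G i))) + ln (ln (real (?G j)))))"
      unfolding E_def using True
      cell[OF i1(3)[OF ij(1)] to_\<delta>[OF i1(4)[OF ij(1)] f i1(3)[OF ij(1)]] i1(3)[OF ij(2)] to_\<delta>[OF i1(5)[OF ij(2)] g i1(3)[OF ij(2)]] L]
      by simp
    also have "exp (- \<theta> * (1 + \<kappa>) * (ln (ln (real (?G i))) + ln (ln (real (?G j)))))
       = exp (- p * ln (ln (real (?G i)))) * exp (- p * ln (ln (real (?G j))))"
      by (simp add: p_def algebra_simps flip: exp_add)
    also have "\<dots> \<le> w i * w j" using exp_le_w ij by (intro mult_mono) (auto simp: w)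
    finally show ?thesis by simp
  next
    case False
    then have "E i j = {}" by (auto simp: E_def)
    then show ?thesis using w(2) by simp
  qed
  have "(\<Sum>(i,j)\<in>F. prob (E i j)) \<le> 145 * (suminf w * suminf w)" if F: "finite F" for F
  proof -
    have "(\<Sum>(i,j)\<in>F. prob (E i j)) \<le> (\<Sum>(i,j)\<in>F. 145 * (w i * w j))" using E_prob by (intro sum_mono) auto
    also have "\<dots> \<le> (\<Sum>(i,j)\<in>fst ` F \<times> snd ` F. 145 * (w i * w j))"
    proof (rule sum_mono2)
      show "F \<subseteq> fst ` F \<times> snd ` F" by force
    qed (use F w(2) in auto)
    also have "\<dots> = 145 * (sum w (fst ` F) * sum w (snd ` F))"
    proof -
      have "sum w (fst ` F) * sum w (snd ` F) = (\<Sum>(i,j)\<in>fst ` F \<times> snd ` F. w i * w j)"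
        by (simp only: sum_product sum.cartesian_product)
      then show ?thesis by (simp only: sum_distrib_left case_prod_unfold)
    qed
    also have "\<dots> \<le> 145 * (suminf w * suminf w)"
      using F w by (intro mult_left_mono mult_mono sum_le_suminf suminf_nonneg sum_nonneg) auto
    finally show ?thesis .
  qed
  then have BC: "AE \<omega> in M. \<exists>k. \<forall>i\<ge>k. \<forall>j\<ge>k. \<omega> \<notin> E i j"
    by (intro borel_cantelli_pairs E_meas)
  have "0 < \<eta> / 6" using \<eta> by simp
  from exceed[OF this] BC AE_space show ?thesis
  proof eventually_elim
    case (elim \<omega>)
    obtain k1 where k1: "\<And>p q. k1 \<le> p \<Longrightarrow> k1 \<le> q \<Longrightarrow> \<bar>Z (p, q) \<omega>\<bar> \<le> \<eta> / 6 * normalizer (2 * \<theta>) f g p q" using elim by blast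
    obtain k2 where k2: "\<And>i j. k2 \<le> i \<Longrightarrow> k2 \<le> j \<Longrightarrow> \<omega> \<notin> E i j" using elim by blast
    define i2 where "i2 = max i1 k2"
    show ?case
    proof (intro exI[of _ "max k1 (?G i2)"] allI impI)
      fix m n assume mn: "max k1 (?G i2) \<le> m" "max k1 (?G i2) \<le> n"
      have cell_ge: "i2 \<le> i" if "m' < ?G (Suc i)" "max k1 (?G i2) \<le> m'" for i m'
      proof (rule ccontr)
        assume "\<not> i2 \<le> i"
        then have "?G (Suc i) \<le> ?G i2" using mono_grid[of \<alpha>] \<alpha> by (auto simp: mono_def)
        then show False using that by simp
      qed
      have "1 \<le> ?G i2" by (rule grid_bounds)
      then have mn1: "1 \<le> m" "1 \<le> n" using mn by auto
      obtain i where i: "?G i \<le> m" "m < ?G (Suc i)" by (rule in_grid_cell[OF \<alpha>(1) mn1(1)])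
      obtain j where j: "?G j \<le> n" "n < ?G (Suc j)" by (rule in_grid_cell[OF \<alpha>(1) mn1(2)])
      have ij: "i1 \<le> i" "k2 \<le> i" "i1 \<le> j" "k2 \<le> j"
        using cell_ge[OF i(2) mn(1)] cell_ge[OF j(2) mn(2)] by (auto simp: i2_def)
      note wm = window_in_grid_cell(4)[OF f i1(3)[OF ij(1)] \<delta>1(2) i1(4)[OF ij(1)] i]
      note wn = window_in_grid_cell(4)[OF g i1(3)[OF ij(3)] \<delta>1(2) i1(5)[OF ij(3)] j]
      have tr: "trunc (\<eta> * ?b i j) (Z c \<omega>) = Z c \<omega>" if c: "c \<in> window f m \<times> window g n" for c
      proof -
        obtain a b where ab: "c = (a, b)" "m \<le> a" "a \<le> window_end f m" "n \<le> b" "b \<le> window_end g n"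
          using c by (auto simp: window_def)
        have "\<bar>Z c \<omega>\<bar> \<le> \<eta> / 6 * normalizer (2 * \<theta>) f g a b" unfolding ab(1) by (rule k1) (use ab mn in auto)
        also have "\<dots> \<le> \<eta> / 6 * (6 * ?b i j)"
          by (intro mult_left_mono normalizer_window_le[OF f g])
             (use \<theta> \<eta> ab i j wm wn i1(3)[OF ij(1)] i1(3)[OF ij(3)] in auto)
        finally show ?thesis by (simp add: trunc_def)
      qed
      have "\<omega> \<notin> E i j" using k2 ij by blast
      then have "\<not> (\<exists>m\<in>{?G i..<?G (Suc i)}. \<exists>n\<in>{?G j..<?G (Suc j)}.
          (\<Sum>c\<in>window f m \<times> window g n. trunc (\<eta> * ?b i j) (Z c \<omega>)) > s * ?b i j)"
        using ij elim by (simp add: E_def)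
      then have "(\<Sum>c\<in>window f m \<times> window g n. trunc (\<eta> * ?b i j) (Z c \<omega>)) \<le> s * ?b i j"
        using i j by (meson atLeastLessThan_iff not_less)
      also have "\<dots> \<le> s * normalizer (2 * \<theta>) f g m n"
        by (intro mult_left_mono normalizer_mono[OF f g]) (use \<sigma> \<theta> i j i1(3)[OF ij(1)] i1(3)[OF ij(3)] in auto)
      finally show "(\<Sum>c\<in>window f m \<times> window g n. Z c \<omega>) \<le> s * normalizer (2 * \<theta>) f g m n"
        using tr by simp
    qed
  qed
qed

end

section \<open>Lower deviations\<close>

text \<open>
  Used to pass between the index set of the given field, pairs of positive integers, and
  sequences of entries.
\<close>

lemma (in prob_space) indep_vars_reindex:
  assumes h: "inj_on h J" and ind: "indep_vars (\<lambda>_. N) V (h ` J)"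
  shows "indep_vars (\<lambda>_. N) (\<lambda>j. V (h j)) J"
proof -
  define F where "F = (\<lambda>i. {V i -` A \<inter> space M |A. A \<in> sets N})"
  have F: "indep_sets F (h ` J)" and rv: "\<And>i. i \<in> h ` J \<Longrightarrow> random_variable N (V i)"
    using ind by (auto simp: indep_vars_def2 F_def)
  have "indep_sets (\<lambda>j. F (h j)) J"
    unfolding indep_sets_def
  proof (intro conjI ballI allI impI)
    show "F (h j) \<subseteq> events" if "j \<in> J" for j using F that by (auto simp: indep_sets_def)
    fix K A assume K: "K \<subseteq> J" "K \<noteq> {}" "finite K" and A: "A \<in> (\<Pi> j\<in>K. F (h j))"
    have inj: "inj_on h K" using h K(1) by (rule inj_on_subset)
    define A' where "A' = (\<lambda>i. A (the_inv_into K h i))"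
    have A': "A' (h j) = A j" if "j \<in> K" for j using that inj by (simp add: A'_def the_inv_into_f_f)
    have "prob (\<Inter>i\<in>h ` K. A' i) = (\<Prod>i\<in>h ` K. prob (A' i))"
      by (rule indep_setsD[OF F]) (use K A A' in auto)
    then show "prob (\<Inter>j\<in>K. A j) = (\<Prod>j\<in>K. prob (A j))"
      using A' by (simp add: prod.reindex[OF inj])
  qed
  then show ?thesis using rv by (auto simp: indep_vars_def2 F_def)
qed

text \<open>
  The probability that no event occurs from index \<open>k\<close> on is at most the product of the \<open>1
  - p i\<close>, hence at most \<open>exp\<close> of minus a divergent sum.
\<close>

lemma (in prob_space) borel_cantelli_independent_blocks:
  fixes V :: "'i \<Rightarrow> 'a \<Rightarrow> real" and F :: "nat \<Rightarrow> 'i set"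
  assumes ind: "indep_vars (\<lambda>_. borel) V I" and F: "\<And>i. F i \<subseteq> I" "disjoint_family F"
    and div: "\<not> summable (\<lambda>i. \<P>(\<omega> in M. (\<Sum>c\<in>F i. V c \<omega>) \<ge> x i))"
  shows "AE \<omega> in M. \<forall>k. \<exists>i\<ge>k. (\<Sum>c\<in>F i. V c \<omega>) \<ge> x i"
proof -
  define S where "S = (\<lambda>i \<omega>. \<Sum>c\<in>F i. V c \<omega>)"
  define p where "p = (\<lambda>i. \<P>(\<omega> in M. S i \<omega> \<ge> x i))"
  have "indep_vars (\<lambda>i. PiM (F i) (\<lambda>_. borel)) (\<lambda>i \<omega>. \<lambda>c\<in>F i. V c \<omega>) UNIV"
    by (rule indep_vars_restrict[OF ind]) (use F in auto)
  moreover have "(\<lambda>v. \<Sum>c\<in>F i. (\<lambda>c w. w c) c v) \<in> borel_measurable (PiM (F i) (\<lambda>_. borel :: real measure))" for i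
    by (rule borel_measurable_sum) (auto intro!: measurable_component_singleton)
  then have "(\<lambda>v. \<Sum>c\<in>F i. v c) \<in> borel_measurable (PiM (F i) (\<lambda>_. borel :: real measure))" for i
    by simp
  ultimately have "indep_vars (\<lambda>_. borel) (\<lambda>i \<omega>. \<Sum>c\<in>F i. (\<lambda>c\<in>F i. V c \<omega>) c) UNIV"
    by (rule indep_vars_compose2)
  then have indS: "indep_vars (\<lambda>_. borel) S UNIV" unfolding S_def by simp
  then have S_meas [measurable]: "S i \<in> borel_measurable M" for i by (simp add: indep_vars_def2)
  have p01: "0 \<le> p i" "p i \<le> 1" for i by (auto simp: p_def)
  have AEk: "AE \<omega> in M. \<exists>i\<ge>k. S i \<omega> \<ge> x i" for k
  proof -
    define N where "N = {\<omega>\<in>space M. \<forall>i\<ge>k. S i \<omega> < x i}"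
    have N_meas: "N \<in> events" unfolding N_def by measurable
    have bnd: "prob N \<le> exp (- (\<Sum>i\<in>{k..n}. p i))" if "k \<le> n" for n
    proof -
      have "prob N \<le> prob (\<Inter>i\<in>{k..n}. S i -` {..<x i} \<inter> space M)"
        using that by (intro finite_measure_mono) (auto simp: N_def)
      also have "\<dots> = (\<Prod>i\<in>{k..n}. prob (S i -` {..<x i} \<inter> space M))"
        by (rule indep_varsD[OF indS]) (use that in auto)
      also have "\<dots> = (\<Prod>i\<in>{k..n}. 1 - p i)"
      proof (rule prod.cong)
        fix i
        have "S i -` {..<x i} \<inter> space M = space M - {\<omega>\<in>space M. S i \<omega> \<ge> x i}" by auto
        then show "prob (S i -` {..<x i} \<inter> space M) = 1 - p i" by (simp add: prob_compl p_def)
      qed simp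
      also have "\<dots> \<le> (\<Prod>i\<in>{k..n}. exp (- p i))"
      proof (rule prod_mono)
        show "0 \<le> 1 - p i \<and> 1 - p i \<le> exp (- p i)" for i
          using p01[of i] exp_ge_add_one_self[of "- p i"] by simp
      qed
      also have "\<dots> = exp (- (\<Sum>i\<in>{k..n}. p i))" by (simp add: exp_sum sum_negf[symmetric])
      finally show ?thesis .
    qed
    have "prob N \<le> \<epsilon>" if "0 < \<epsilon>" for \<epsilon>
    proof (rule ccontr)
      assume neg: "\<not> prob N \<le> \<epsilon>"
      have "(\<Sum>i<n. p i) \<le> (\<Sum>i<k. p i) - ln \<epsilon>" for n
      proof -
        define n' where "n' = max n k"
        have "\<epsilon> < exp (- (\<Sum>i\<in>{k..n'}. p i))" using neg bnd[of n'] by (simp add: n'_def)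
        then have "ln \<epsilon> < - (\<Sum>i\<in>{k..n'}. p i)" using that by (metis exp_less_cancel_iff exp_ln)
        moreover have "(\<Sum>i<n. p i) \<le> (\<Sum>i\<in>{..<k} \<union> {k..n'}. p i)"
          using p01 by (intro sum_mono2) (auto simp: n'_def)
        moreover have "(\<Sum>i\<in>{..<k} \<union> {k..n'}. p i) = (\<Sum>i<k. p i) + (\<Sum>i\<in>{k..n'}. p i)"
          by (rule sum.union_disjoint) auto
        ultimately show ?thesis by linarith
      qed
      then have "summable p" using p01 by (intro summableI_nonneg_bounded)
      then show False using div by (simp add: p_def[abs_def] S_def)
    qed
    then have "prob N = 0" using measure_nonneg[of M N] field_le_epsilon[of "prob N" 0] by (simp add: antisym)
    then show ?thesis
      by (intro AE_I[of _ _ N]) (use N_meas in \<open>auto simp: N_def emeasure_eq_measure not_less\<close>)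
  qed
  then show ?thesis unfolding S_def by (simp add: AE_all_countable)
qed

text \<open>
  Only the mass of the interval \<open>{y<..y + 1}\<close> is kept, and \<open>sqrt (2 * pi) < 4\<close>.
\<close>

lemma std_normal_tail_ge:
  assumes "0 \<le> y"
  shows "exp (- (y + 1)\<^sup>2 / 2) / 4 < 1 - cdf std_normal_distribution y"
proof -
  interpret N: prob_space std_normal_distribution by (rule prob_space_normal_density) simp
  let ?c = "exp (- (y + 1)\<^sup>2 / 2) / sqrt (2 * pi)"
  have "sqrt (2 * pi) < sqrt 16" using pi_less_4 by (intro real_sqrt_less_mono) linarith
  also have "sqrt 16 = (4::real)" by (rule real_sqrt_unique) auto
  finally have lt: "exp (- (y + 1)\<^sup>2 / 2) / 4 < ?c" by (intro divide_strict_left_mono) (auto intro!: mult_pos_pos)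
  have "ennreal ?c = (\<integral>\<^sup>+x. ennreal ?c * indicator {y<..y+1} x \<partial>lborel)"
    by (subst nn_integral_cmult_indicator) auto
  also have "\<dots> \<le> (\<integral>\<^sup>+x. ennreal (std_normal_density x) * indicator {y<..y+1} x \<partial>lborel)"
  proof (intro nn_integral_mono)
    fix x :: real
    have "?c \<le> std_normal_density x" if "y < x" "x \<le> y + 1"
    proof -
      have "x\<^sup>2 \<le> (y + 1)\<^sup>2" using that assms by (intro power_mono) auto
      then show ?thesis unfolding std_normal_density_def by (simp add: divide_right_mono)
    qed
    then show "ennreal ?c * indicator {y<..y+1} x \<le> ennreal (std_normal_density x) * indicator {y<..y+1} x"
      by (auto simp: indicator_def intro!: ennreal_leI)
  qed
  also have "\<dots> = emeasure std_normal_distribution {y<..y+1}" by (subst emeasure_density) auto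
  also have "\<dots> = ennreal (N.prob {y<..y+1})" by (rule N.emeasure_eq_measure)
  finally have "?c \<le> N.prob {y<..y+1}" by simp
  also have "\<dots> \<le> N.prob (space std_normal_distribution - {..y})" by (intro N.finite_measure_mono) auto
  also have "\<dots> = 1 - cdf std_normal_distribution y" by (subst N.prob_compl) (auto simp: cdf_def)
  finally show ?thesis using lt by linarith
qed

context iid_family
begin

text \<open>
  The characteristic function of such a sum is a power of that of \<open>X\<close>. This transfers the
  central limit theorem from initial segments of a sequence to arbitrary finite index sets.
\<close>

lemma sum_law_card:
  assumes F: "F \<subseteq> I" and G: "G \<subseteq> I" and card: "card F = card G"
  shows "distr M borel (\<lambda>\<omega>. \<Sum>i\<in>F. Z i \<omega>) = distr M borel (\<lambda>\<omega>. \<Sum>i\<in>G. Z i \<omega>)"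
proof (rule Levy_uniqueness)
  have rd: "real_distribution (distr M borel (\<lambda>\<omega>. \<Sum>i\<in>F. Z i \<omega>))" if "F \<subseteq> I" for F
    by (rule real_distribution_distr, rule borel_measurable_sum) (use that in auto)
  show "real_distribution (distr M borel (\<lambda>\<omega>. \<Sum>i\<in>F. Z i \<omega>))" by (rule rd[OF F])
  show "real_distribution (distr M borel (\<lambda>\<omega>. \<Sum>i\<in>G. Z i \<omega>))" by (rule rd[OF G])
  have ch: "char (distr M borel (\<lambda>\<omega>. \<Sum>i\<in>F. Z i \<omega>)) t = char (distr M borel X) t ^ card F" if "F \<subseteq> I" for F t
    using that char_distr_sum[OF indep_vars_subset[OF indep that], of t] by (simp add: same_law subset_iff)
  show "char (distr M borel (\<lambda>\<omega>. \<Sum>i\<in>F. Z i \<omega>)) = char (distr M borel (\<lambda>\<omega>. \<Sum>i\<in>G. Z i \<omega>))"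
    by (rule ext) (simp only: ch[OF F] ch[OF G] card)
qed

lemma prob_sum_ge_card:
  assumes F: "F \<subseteq> I" and G: "G \<subseteq> I" and card: "card F = card G"
  shows "\<P>(\<omega> in M. (\<Sum>i\<in>F. Z i \<omega>) \<ge> x) = \<P>(\<omega> in M. (\<Sum>i\<in>G. Z i \<omega>) \<ge> x)"
proof -
  have "\<P>(\<omega> in M. (\<Sum>i\<in>F. Z i \<omega>) \<ge> x) = measure (distr M borel (\<lambda>\<omega>. \<Sum>i\<in>F. Z i \<omega>)) {x..}" if "F \<subseteq> I" for F
  proof (subst measure_distr)
    show "random_variable borel (\<lambda>\<omega>. \<Sum>i\<in>F. Z i \<omega>)" by (rule borel_measurable_sum) (use that in auto)
  qed (auto intro!: arg_cong[where f = prob])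
  then show ?thesis using sum_law_card[OF assms] F G by simp
qed

lemma central_limit_lower_bound:
  fixes h :: "nat \<Rightarrow> _"
  assumes h: "inj h" "range h \<subseteq> I" and mean: "expectation X = 0"
    and int: "integrable M (\<lambda>\<omega>. (X \<omega>)\<^sup>2)" and var: "expectation (\<lambda>\<omega>. (X \<omega>)\<^sup>2) = \<sigma>\<^sup>2" and \<sigma>: "0 < \<sigma>" and y: "0 \<le> y"
  obtains q1 where "1 \<le> q1" "\<And>F. finite F \<Longrightarrow> F \<subseteq> I \<Longrightarrow> q1 \<le> card F \<Longrightarrow>
     exp (- (y + 1)\<^sup>2 / 2) / 4 \<le> \<P>(\<omega> in M. (\<Sum>i\<in>F. Z i \<omega>) \<ge> y * \<sigma> * sqrt (card F))"
proof -
  have hI: "h n \<in> I" for n using h by auto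
  have ind: "indep_vars (\<lambda>_. borel) (\<lambda>n. Z (h n)) UNIV"
    by (rule indep_vars_reindex[OF h(1) indep_vars_subset[OF indep h(2)]])
  have mZ: "expectation (Z (h n)) = 0" for n
    using integral_Z[OF hI, of "\<lambda>x. x"] mean by simp
  have "weak_conv_m (\<lambda>n. distr M borel (\<lambda>x. (\<Sum>i<n. Z (h i) x) / sqrt (n * \<sigma>\<^sup>2))) std_normal_distribution"
  proof (rule central_limit_theorem_zero_mean[OF ind mZ \<sigma>])
    show "integrable M (\<lambda>x. (Z (h n) x)\<^sup>2)" for n
      using integrable_Z_iff[OF hI, of "\<lambda>x. x\<^sup>2"] int by simp
    show "variance (Z (h n)) = \<sigma>\<^sup>2" for n
      using integral_Z[OF hI, of "\<lambda>x. x\<^sup>2"] var by (simp add: mZ)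
    show "distr M borel (Z (h n)) = distr M borel X" for n by (rule same_law[OF hI])
  qed
  moreover have "isCont (cdf std_normal_distribution) y"
  proof -
    interpret N: real_distribution std_normal_distribution
      by (rule real_dist_normal_dist)
    have "emeasure std_normal_distribution {y} = 0"
      by (subst emeasure_density) (auto intro!: nn_integral_null_set simp: nn_integral_indicator_singleton')
    then show ?thesis by (simp add: N.isCont_cdf N.emeasure_eq_measure)
  qed
  ultimately have "(\<lambda>n. cdf (distr M borel (\<lambda>x. (\<Sum>i<n. Z (h i) x) / sqrt (n * \<sigma>\<^sup>2))) y) \<longlonglongrightarrow> cdf std_normal_distribution y"
    by (auto simp: weak_conv_m_def weak_conv_def)
  then have "(\<lambda>n. 1 - cdf (distr M borel (\<lambda>x. (\<Sum>i<n. Z (h i) x) / sqrt (n * \<sigma>\<^sup>2))) y) \<longlonglongrightarrow> 1 - cdf std_normal_distribution y"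
    by (intro tendsto_intros)
  then have "\<forall>\<^sub>F n in sequentially. exp (- (y + 1)\<^sup>2 / 2) / 4 < 1 - cdf (distr M borel (\<lambda>x. (\<Sum>i<n. Z (h i) x) / sqrt (n * \<sigma>\<^sup>2))) y"
    by (rule order_tendstoD) (rule std_normal_tail_ge[OF y])
  then obtain q0 where q0: "\<And>n. q0 \<le> n \<Longrightarrow> exp (- (y + 1)\<^sup>2 / 2) / 4 < 1 - cdf (distr M borel (\<lambda>x. (\<Sum>i<n. Z (h i) x) / sqrt (n * \<sigma>\<^sup>2))) y"
    by (auto simp: eventually_sequentially)
  show ?thesis
  proof (rule that[of "max q0 1"])
    fix F assume F: "finite F" "F \<subseteq> I" "max q0 1 \<le> card F"
    let ?n = "card F" and ?S = "\<lambda>\<omega>. \<Sum>i<card F. Z (h i) \<omega>"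
    have S_meas [measurable]: "?S \<in> borel_measurable M" using hI by (intro borel_measurable_sum) auto
    have "exp (- (y + 1)\<^sup>2 / 2) / 4 \<le> 1 - cdf (distr M borel (\<lambda>x. ?S x / sqrt (?n * \<sigma>\<^sup>2))) y"
      using q0[of ?n] F by simp
    also have "cdf (distr M borel (\<lambda>x. ?S x / sqrt (?n * \<sigma>\<^sup>2))) y = prob {\<omega>\<in>space M. ?S \<omega> / sqrt (?n * \<sigma>\<^sup>2) \<le> y}"
      unfolding cdf_def by (subst measure_distr) (auto intro!: arg_cong[where f = prob])
    also have "1 - prob {\<omega>\<in>space M. ?S \<omega> / sqrt (?n * \<sigma>\<^sup>2) \<le> y} = prob (space M - {\<omega>\<in>space M. ?S \<omega> / sqrt (?n * \<sigma>\<^sup>2) \<le> y})"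
      by (subst prob_compl) auto
    also have "\<dots> \<le> \<P>(\<omega> in M. ?S \<omega> \<ge> y * \<sigma> * sqrt ?n)"
    proof (rule finite_measure_mono)
      have "0 < sqrt (?n * \<sigma>\<^sup>2)" using F \<sigma> by auto
      moreover have "sqrt (?n * \<sigma>\<^sup>2) = sqrt ?n * \<sigma>" using \<sigma> by (simp add: real_sqrt_mult)
      ultimately show "space M - {\<omega>\<in>space M. ?S \<omega> / sqrt (?n * \<sigma>\<^sup>2) \<le> y} \<subseteq> {\<omega>\<in>space M. ?S \<omega> \<ge> y * \<sigma> * sqrt ?n}"
        by (auto simp: not_le pos_less_divide_eq mult_ac)
    qed measurable
    also have "\<dots> = \<P>(\<omega> in M. (\<Sum>i\<in>h ` {..<?n}. Z i \<omega>) \<ge> y * \<sigma> * sqrt ?n)"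
      using h(1) by (subst sum.reindex) (auto intro: inj_on_subset)
    also have "\<dots> = \<P>(\<omega> in M. (\<Sum>i\<in>F. Z i \<omega>) \<ge> y * \<sigma> * sqrt ?n)"
      by (rule prob_sum_ge_card) (use hI F h(1) in \<open>auto simp: card_image inj_on_subset\<close>)
    finally show "exp (- (y + 1)\<^sup>2 / 2) / 4 \<le> \<P>(\<omega> in M. (\<Sum>i\<in>F. Z i \<omega>) \<ge> y * \<sigma> * sqrt ?n)" .
  qed simp
qed

text \<open>
  If each of \<open>k\<close> disjoint blocks has a large sum, so has the whole. The last block absorbs
  the remainder, which is why the hypothesis on \<open>\<rho>\<close> covers all blocks with at least
  \<open>q\<close> elements.
\<close>

lemma prob_sum_blocks_ge:
  assumes \<rho>: "\<And>F. finite F \<Longrightarrow> F \<subseteq> I \<Longrightarrow> q \<le> card F \<Longrightarrow> \<rho> \<le> \<P>(\<omega> in M. (\<Sum>i\<in>F. Z i \<omega>) \<ge> y * sqrt (card F))"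
    and y: "0 \<le> y" and \<rho>0: "0 \<le> \<rho>" and F: "finite F" "F \<subseteq> I" "Suc k * q \<le> card F"
  shows "\<rho> ^ Suc k \<le> \<P>(\<omega> in M. (\<Sum>i\<in>F. Z i \<omega>) \<ge> Suc k * (y * sqrt q))"
  using F
proof (induction k arbitrary: F)
  case 0
  have sm: "(\<lambda>\<omega>. \<Sum>i\<in>F. Z i \<omega>) \<in> borel_measurable M" by (rule borel_measurable_sum) (use 0 in auto)
  have "\<rho> \<le> \<P>(\<omega> in M. (\<Sum>i\<in>F. Z i \<omega>) \<ge> y * sqrt (card F))" using \<rho> 0 by simp
  also have "\<dots> \<le> \<P>(\<omega> in M. (\<Sum>i\<in>F. Z i \<omega>) \<ge> Suc 0 * (y * sqrt q))"
  proof (rule finite_measure_mono)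
    have "y * sqrt q \<le> y * sqrt (card F)" using 0 y by (intro mult_left_mono) auto
    then show "{\<omega>\<in>space M. (\<Sum>i\<in>F. Z i \<omega>) \<ge> y * sqrt (card F)} \<subseteq> {\<omega>\<in>space M. (\<Sum>i\<in>F. Z i \<omega>) \<ge> Suc 0 * (y * sqrt q)}"
      by auto
    show "{\<omega>\<in>space M. (\<Sum>i\<in>F. Z i \<omega>) \<ge> Suc 0 * (y * sqrt q)} \<in> events" using sm by measurable
  qed
  finally show ?case by simp
next
  case (Suc k)
  obtain G where G: "G \<subseteq> F" "card G = q" "finite G"
    using obtain_subset_with_card_n[of q F] Suc.prems by auto
  let ?H = "F - G"
  have H: "finite ?H" "?H \<subseteq> I" "Suc k * q \<le> card ?H"
    using Suc.prems G by (auto simp: card_Diff_subset)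
  have meas: "(\<lambda>v. \<Sum>c\<in>A. v c) \<in> borel_measurable (PiM A (\<lambda>_. borel :: real measure))" for A :: "'b set"
  proof -
    have "(\<lambda>v. \<Sum>c\<in>A. (\<lambda>c w. w c) c v) \<in> borel_measurable (PiM A (\<lambda>_. borel :: real measure))"
      by (rule borel_measurable_sum) (auto intro!: measurable_component_singleton)
    then show ?thesis by simp
  qed
  have sm: "(\<lambda>\<omega>. \<Sum>i\<in>F. Z i \<omega>) \<in> borel_measurable M" by (rule borel_measurable_sum) (use Suc.prems in auto)
  have "\<rho> ^ Suc (Suc k) = \<rho> * \<rho> ^ Suc k" by simp
  also have "\<dots> \<le> \<P>(\<omega> in M. (\<Sum>i\<in>G. Z i \<omega>) \<ge> y * sqrt q) * \<P>(\<omega> in M. (\<Sum>i\<in>?H. Z i \<omega>) \<ge> Suc k * (y * sqrt q))"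
    using \<rho>[of G] Suc.IH[OF H] G Suc.prems \<rho>0 by (intro mult_mono) auto
  also have "\<dots> = \<P>(\<omega> in M. (\<Sum>i\<in>G. (\<lambda>i\<in>G. Z i \<omega>) i) \<ge> y * sqrt q) * \<P>(\<omega> in M. (\<Sum>i\<in>?H. (\<lambda>i\<in>?H. Z i \<omega>) i) \<ge> Suc k * (y * sqrt q))"
    by (simp only: restrict_apply if_True cong: sum.cong)
  also have "\<dots> = \<P>(\<omega> in M. (\<Sum>i\<in>G. (\<lambda>i\<in>G. Z i \<omega>) i) \<ge> y * sqrt q \<and> (\<Sum>i\<in>?H. (\<lambda>i\<in>?H. Z i \<omega>) i) \<ge> Suc k * (y * sqrt q))"
  proof (rule prob_disjoint_blocks[OF indep, symmetric])
    have pr: "Measurable.pred (PiM A (\<lambda>_. borel)) (\<lambda>v. x \<le> (\<Sum>c\<in>A. v c))" for A :: "'b set" and x :: real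
      unfolding Measurable.pred_def by (rule borel_measurable_le[OF _ meas]) simp
    show "Measurable.pred (PiM G (\<lambda>_. borel)) (\<lambda>v. y * sqrt q \<le> (\<Sum>c\<in>G. v c))"
      "Measurable.pred (PiM ?H (\<lambda>_. borel)) (\<lambda>v. Suc k * (y * sqrt q) \<le> (\<Sum>c\<in>?H. v c))" by (rule pr)+
  qed (use G Suc.prems in auto)
  also have "\<dots> \<le> \<P>(\<omega> in M. (\<Sum>i\<in>F. Z i \<omega>) \<ge> Suc (Suc k) * (y * sqrt q))"
  proof (rule finite_measure_mono)
    show "{\<omega>\<in>space M. (\<Sum>i\<in>G. (\<lambda>i\<in>G. Z i \<omega>) i) \<ge> y * sqrt q \<and> (\<Sum>i\<in>?H. (\<lambda>i\<in>?H. Z i \<omega>) i) \<ge> Suc k * (y * sqrt q)}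
       \<subseteq> {\<omega>\<in>space M. (\<Sum>i\<in>F. Z i \<omega>) \<ge> Suc (Suc k) * (y * sqrt q)}"
      using sum.subset_diff[OF G(1) Suc.prems(1), of "\<lambda>i. Z i \<omega>" for \<omega>] by (auto simp: algebra_simps)
    show "{\<omega>\<in>space M. (\<Sum>i\<in>F. Z i \<omega>) \<ge> Suc (Suc k) * (y * sqrt q)} \<in> events" using sm by measurable
  qed
  finally show ?case .
qed

end

context iid_family
begin

text \<open>
  Cutting \<open>F\<close> into about \<open>l / K\<close> blocks turns a deviation of order \<open>sqrt l\<close> into one
  of constant order \<open>y\<close>, about \<open>x * sqrt (2 * K)\<close>, for each block, and there the central
  limit theorem applies. The product of the block probabilities is about \<open>exp (- y\<^sup>2
  / 2 * (l / K)) = exp (- x\<^sup>2 * l)\<close>.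
\<close>

lemma moderate_deviation_lower:
  fixes h :: "nat \<Rightarrow> _"
  assumes h: "inj h" "range h \<subseteq> I" and mean: "expectation X = 0"
    and int: "integrable M (\<lambda>\<omega>. (X \<omega>)\<^sup>2)" and var: "expectation (\<lambda>\<omega>. (X \<omega>)\<^sup>2) = \<sigma>\<^sup>2" and \<sigma>: "0 < \<sigma>"
    and x: "0 < x" "x\<^sup>2 < \<gamma>"
  obtains l0 Q where "0 < l0" "0 < Q" "\<And>(l::real) F. l0 \<le> l \<Longrightarrow> finite F \<Longrightarrow> F \<subseteq> I \<Longrightarrow> Q * l \<le> card F \<Longrightarrow>
     exp (- \<gamma> * l) \<le> \<P>(\<omega> in M. (\<Sum>i\<in>F. Z i \<omega>) \<ge> x * \<sigma> * sqrt (2 * card F * l))"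
proof -
  \<comment> \<open>The gap between \<open>x\<^sup>2\<close> and \<open>\<gamma>\<close> is split: \<open>D\<close> enlarges the block level \<open>y\<close> to make up for
    rounding, measured by \<open>e\<close>, while \<open>x\<^sup>2 * D\<close> is still below \<open>\<gamma>\<close>.\<close>
  define D where "D = (1 + \<gamma> / x\<^sup>2) / 2"
  have x2: "0 < x\<^sup>2" using x by simp
  have "1 < \<gamma> / x\<^sup>2" using x x2 by (simp add: less_divide_eq)
  moreover have "x\<^sup>2 * D = (x\<^sup>2 + \<gamma>) / 2" using x2 by (simp add: D_def distrib_left)
  ultimately have D: "1 < D" "x\<^sup>2 * D < \<gamma>" using x by (auto simp: D_def)
  define e where "e = (1 - 1 / D) / 2"
  have e: "0 < e" "e < 1" "1 \<le> (1 - e) * (1 - e) * D"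
  proof -
    have "0 < 1 / D" "1 / D < 1" using D by auto
    then show "0 < e" unfolding e_def by simp
    have "2 * e = 1 - 1 / D" by (simp add: e_def)
    then show "e < 1" using \<open>0 < 1 / D\<close> by linarith
    have "1 - 2 * e = 1 / D" using \<open>2 * e = 1 - 1 / D\<close> by linarith
    then have "1 = (1 - 2 * e) * D" using D by simp
    also have "\<dots> \<le> ((1 - e) * (1 - e)) * D"
      using D by (intro mult_right_mono) (auto simp: algebra_simps)
    finally show "1 \<le> (1 - e) * (1 - e) * D" .
  qed
  have "((\<lambda>K. ((x * sqrt (2 * D * K) + 1)\<^sup>2 / 2 + ln 4) / K) \<longlongrightarrow> x\<^sup>2 * D) at_top"
  proof -
    have "((\<lambda>K. x\<^sup>2 * D + (x * sqrt (2 * D) / sqrt K + (1 / 2 + ln 4) / K)) \<longlongrightarrow> x\<^sup>2 * D + (0 + 0)) at_top"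
      by (intro tendsto_intros; real_asymp)
    moreover have "\<forall>\<^sub>F K in at_top. x\<^sup>2 * D + (x * sqrt (2 * D) / sqrt K + (1 / 2 + ln 4) / K) = ((x * sqrt (2 * D * K) + 1)\<^sup>2 / 2 + ln 4) / K"
      using eventually_gt_at_top[of 0]
    proof eventually_elim
      case (elim K)
      define w where "w = x * sqrt (2 * D * K)"
      have "w\<^sup>2 = x\<^sup>2 * (2 * D * K)" using D elim by (simp add: w_def power_mult_distrib)
      then have "((w + 1)\<^sup>2 / 2 + ln 4) / K = x\<^sup>2 * D + w / K + (1 / 2 + ln 4) / K"
        using elim by (simp add: power2_sum add_divide_distrib)
      moreover have "w / K = x * sqrt (2 * D) * (sqrt K / K)" by (simp add: w_def real_sqrt_mult)
      moreover have "sqrt K / K = 1 / sqrt K" using elim by (simp add: field_simps)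
      ultimately show ?case by (simp add: w_def)
    qed
    ultimately show ?thesis by (simp add: tendsto_cong)
  qed
  then have "\<forall>\<^sub>F K in at_top. ((x * sqrt (2 * D * K) + 1)\<^sup>2 / 2 + ln 4) / K < \<gamma>"
    by (rule order_tendstoD) (rule D)
  then have "\<forall>\<^sub>F K in at_top. ((x * sqrt (2 * D * K) + 1)\<^sup>2 / 2 + ln 4) / K < \<gamma> \<and> 1 \<le> K"
    using eventually_ge_at_top[of 1] by eventually_elim auto
  \<comment> \<open>The number \<open>K\<close> is the share of the exponent \<open>l\<close> carried by one block; it is so large that
    the error of the Gaussian tail bound is absorbed.\<close>
  then obtain K where K: "((x * sqrt (2 * D * K) + 1)\<^sup>2 / 2 + ln 4) / K < \<gamma>" "1 \<le> K"
    by (auto simp: eventually_at_top_linorder)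
  define y where "y = x * sqrt (2 * D * K)"
  have y: "0 \<le> y" "y\<^sup>2 = 2 * x\<^sup>2 * D * K" using x D K by (auto simp: y_def power_mult_distrib)
  have yK: "(y + 1)\<^sup>2 / 2 + ln 4 \<le> \<gamma> * K" using K unfolding y_def[symmetric] by (simp add: divide_less_eq)
  define \<rho> where "\<rho> = exp (- (y + 1)\<^sup>2 / 2) / 4"
  have \<rho>: "exp (- \<gamma> * K) \<le> \<rho>" "0 \<le> \<rho>"
  proof -
    have "\<rho> = exp (- ((y + 1)\<^sup>2 / 2 + ln 4))" unfolding \<rho>_def minus_add_distrib exp_add by (simp add: exp_minus)
    then show "exp (- \<gamma> * K) \<le> \<rho>" using yK by simp
  qed (simp add: \<rho>_def)
  obtain q1 where q1: "1 \<le> q1" "\<And>F. finite F \<Longrightarrow> F \<subseteq> I \<Longrightarrow> q1 \<le> card F \<Longrightarrow>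
     \<rho> \<le> \<P>(\<omega> in M. (\<Sum>i\<in>F. Z i \<omega>) \<ge> y * \<sigma> * sqrt (card F))"
    by (rule central_limit_lower_bound[OF h mean int var \<sigma> y(1), folded \<rho>_def]) (rule that, assumption+)
  define Q where "Q = max (real q1 / K) (1 / (e * K))"
  show ?thesis
  proof (rule that[of "K / e" Q])
    show "0 < K / e" "0 < Q" using K e by (auto simp: Q_def less_max_iff_disj)
    fix l F assume l: "K / e \<le> l" and F: "finite F" "F \<subseteq> I" "Q * l \<le> card F"
    define N where "N = card F"
    define k where "k = nat \<lfloor>l / K\<rfloor>"
    have lK: "K \<le> e * l" "0 < l" using l e K by (auto simp: field_simps intro: less_le_trans[of 0 "K / e"])
    have k0: "0 \<le> l / K" using lK K by simp
    have k: "real k \<le> l / K" "l / K < real k + 1" using k0 by (auto simp: k_def)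
    have kK: "real k * K \<le> l" "(1 - e) * l \<le> real k * K"
      using k lK K by (auto simp: field_simps)
    have k1: "1 \<le> k"
    proof -
      have "e * l \<le> 1 * l" using e lK by (intro mult_right_mono) auto
      then have "K \<le> l" using lK by linarith
      then have "1 \<le> l / K" using K by (simp add: le_divide_eq)
      then show ?thesis using k by linarith
    qed
    define q where "q = N div k"
    have QK: "q1 \<le> Q * K" "1 \<le> e * (Q * K)"
    proof -
      have "real q1 / K \<le> Q" "1 / (e * K) \<le> Q" by (auto simp: Q_def)
      then show "q1 \<le> Q * K" "1 \<le> e * (Q * K)" using K e by (auto simp: divide_le_eq mult_ac)
    qed
    have Qkl: "Q * K * real k \<le> real N"
    proof -
      have "Q * (real k * K) \<le> Q * l" using kK \<open>0 < Q\<close> by (intro mult_left_mono) auto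
      then show ?thesis using F(3) by (simp add: N_def mult_ac)
    qed
    have q: "q1 \<le> q"
    proof -
      have "real q1 * real k \<le> Q * K * real k" using QK by (intro mult_right_mono) auto
      also note Qkl
      finally have "q1 * k \<le> N" by (simp only: of_nat_le_iff flip: of_nat_mult)
      then show ?thesis using k1 by (simp add: q_def less_eq_div_iff_mult_less_eq)
    qed
    obtain k' where k': "k = Suc k'" using k1 by (cases k) auto
    have "\<rho> ^ Suc k' \<le> \<P>(\<omega> in M. (\<Sum>i\<in>F. Z i \<omega>) \<ge> Suc k' * (y * \<sigma> * sqrt q))"
    proof (rule prob_sum_blocks_ge)
      fix G assume "finite G" "G \<subseteq> I" "q \<le> card G"
      then show "\<rho> \<le> \<P>(\<omega> in M. (\<Sum>i\<in>G. Z i \<omega>) \<ge> y * \<sigma> * sqrt (card G))" using q1(2)[of G] q by simp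
    next
      show "Suc k' * q \<le> card F" unfolding k'[symmetric] q_def N_def[symmetric] by simp
    qed (use y \<sigma> \<rho> F in auto)
    then have *: "\<rho> ^ k \<le> \<P>(\<omega> in M. (\<Sum>i\<in>F. Z i \<omega>) \<ge> k * (y * \<sigma> * sqrt q))" by (simp only: k')
    have "exp (- \<gamma> * l) \<le> exp (- \<gamma> * K) ^ k"
    proof -
      have "0 < \<gamma>" using x x2 by linarith
      then have "\<gamma> * (real k * K) \<le> \<gamma> * l" using kK by (intro mult_left_mono) auto
      then show ?thesis by (simp add: mult_ac flip: exp_of_nat_mult)
    qed
    also have "\<dots> \<le> \<rho> ^ k" using \<rho> by (intro power_mono) auto
    also note *
    also have "\<P>(\<omega> in M. (\<Sum>i\<in>F. Z i \<omega>) \<ge> k * (y * \<sigma> * sqrt q))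
      \<le> \<P>(\<omega> in M. (\<Sum>i\<in>F. Z i \<omega>) \<ge> x * \<sigma> * sqrt (2 * card F * l))"
    proof (rule finite_measure_mono)
      have "real k \<le> e * real N"
      proof -
        have "1 * real k \<le> e * (Q * K) * real k" using QK by (intro mult_right_mono) auto
        also have "\<dots> = e * (Q * K * real k)" by simp
        also have "\<dots> \<le> e * real N" using Qkl e by (intro mult_left_mono) auto
        finally show ?thesis by simp
      qed
      moreover have "real N \<le> real k * real q + real k"
      proof -
        have "N = k * q + N mod k" by (simp add: q_def)
        also have "\<dots> \<le> k * q + k" using k1 by (simp add: less_imp_le)
        finally show ?thesis by (metis of_nat_add of_nat_le_iff of_nat_mult)
      qed
      ultimately have kq: "(1 - e) * real N \<le> real k * real q" by (simp add: algebra_simps)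
      have "real N * l * 1 \<le> real N * l * ((1 - e) * (1 - e) * D)" using e lK by (intro mult_left_mono) auto
      also have "\<dots> = D * (((1 - e) * real N) * ((1 - e) * l))" by simp
      also have "\<dots> \<le> D * ((real k * real q) * (real k * K))"
        by (rule mult_left_mono[OF mult_mono[OF kq kK(2)]]) (use D e lK in auto)
      finally have "2 * x\<^sup>2 * (real N * l) \<le> 2 * x\<^sup>2 * (D * ((real k * real q) * (real k * K)))"
        using x2 by (intro mult_left_mono) auto
      also have "\<dots> = (real k * y)\<^sup>2 * real q" unfolding power_mult_distrib y(2) by (simp add: power2_eq_square)
      finally have "sqrt (x\<^sup>2 * (2 * real N * l)) \<le> sqrt ((real k * y)\<^sup>2 * real q)" by (intro real_sqrt_le_mono) simp
      then have "x * sqrt (2 * real N * l) \<le> real k * y * sqrt q"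
        using x y by (simp add: real_sqrt_mult)
      then have "\<sigma> * (x * sqrt (2 * real N * l)) \<le> \<sigma> * (real k * y * sqrt q)" using \<sigma> by (intro mult_left_mono) auto
      then have "x * \<sigma> * sqrt (2 * card F * l) \<le> k * (y * \<sigma> * sqrt q)" by (simp add: N_def mult_ac)
      then show "{\<omega>\<in>space M. (\<Sum>i\<in>F. Z i \<omega>) \<ge> k * (y * \<sigma> * sqrt q)} \<subseteq> {\<omega>\<in>space M. (\<Sum>i\<in>F. Z i \<omega>) \<ge> x * \<sigma> * sqrt (2 * card F * l)}"
        by auto
      have "(\<lambda>\<omega>. \<Sum>i\<in>F. Z i \<omega>) \<in> borel_measurable M" by (rule borel_measurable_sum) (use F in auto)
      then show "{\<omega>\<in>space M. (\<Sum>i\<in>F. Z i \<omega>) \<ge> x * \<sigma> * sqrt (2 * card F * l)} \<in> events" by measurable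
    qed
    finally show "exp (- \<gamma> * l) \<le> \<P>(\<omega> in M. (\<Sum>i\<in>F. Z i \<omega>) \<ge> x * \<sigma> * sqrt (2 * card F * l))" .
  qed
qed

end

section \<open>The almost sure lower bound\<close>

lemma card_window_ge:
  assumes "window_scale f" "16 \<le> m" shows "real m / f m \<le> card (window f m)"
proof -
  have "0 \<le> real m / f m" using window_scaleD(1)[OF assms] by simp
  from window_end_bounds[of m f, OF this] window_end_ge[of m f, OF this] show ?thesis by (simp add: window_def of_nat_diff)
qed

context iid_array
begin

text \<open>
  The column position \<open>n\<close> stays fixed. Along disjoint row windows the sums are
  independent, and since \<open>ln (ln n)\<close> is negligible against \<open>ln (ln m)\<close>, the normalizer
  is the one of a one-dimensional problem. The window at \<open>r i\<close> is exceptionally large with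
  probability at least \<open>ln (r i) powr (- \<theta>)\<close>, so that the growth condition on \<open>r\<close>
  yields a harmonic series.
\<close>

lemma window_sum_lower_bound:
  assumes mean: "expectation X = 0"
    and int: "integrable M (\<lambda>\<omega>. (X \<omega>)\<^sup>2)" and var: "expectation (\<lambda>\<omega>. (X \<omega>)\<^sup>2) = \<sigma>\<^sup>2" and \<sigma>: "0 < \<sigma>"
    and f: "window_scale f" and g: "window_scale g" and \<theta>: "0 < \<theta>" and x: "0 < x" "x < 1" and n: "16 \<le> n"
    and gap: "\<And>i. i0 \<le> i \<Longrightarrow> 16 \<le> r i \<and> window_end f (r i) < r (Suc i)"
    and growth: "\<And>i. i0 \<le> i \<Longrightarrow> ln (real (r i)) \<le> C * real i powr (1 / \<theta>)"
  shows "AE \<omega> in M. \<forall>k. \<exists>m\<ge>k. (\<Sum>c\<in>window f m \<times> window g n. Z c \<omega>) \<ge> x\<^sup>2 * \<sigma> * normalizer (2 * \<theta>) f g m n"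
proof -
  \<comment> \<open>The shift by \<open>Suc i0\<close> skips the initial part and keeps \<open>real (i + Suc i0)\<close> positive.\<close>
  define K where "K = (\<lambda>i. r (i + Suc i0))"
  define F where "F = (\<lambda>i. window f (K i) \<times> window g n)"
  define u where "u = (\<lambda>m::nat. \<theta> * ln (ln (real m)))"
  have K16: "16 \<le> K i" for i using gap[of "i + Suc i0"] by (simp add: K_def)
  have wK: "K i \<le> window_end f (K i)" for i
    using window_scaleD(1)[OF f K16[of i]] by (intro window_end_ge) simp
  have K_gap: "window_end f (K i) < K (Suc i)" for i using gap[of "i + Suc i0"] by (simp add: K_def)
  have K_mono: "strict_mono K" by (rule strict_monoI_Suc) (use wK K_gap le_less_trans in blast)
  have Fsub: "F i \<subseteq> {1..} \<times> {1..}" for i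
    unfolding F_def by (intro Sigma_mono window_subset) (use K16[of i] n in auto)
  have Ffin: "finite (F i)" for i by (simp add: F_def)
  have disj: "disjoint_family F"
  proof -
    have "window f (K i) \<inter> window f (K j) = {}" if "i < j" for i j
    proof -
      have "K (Suc i) \<le> K j" using that strict_mono_mono[OF K_mono] by (simp add: mono_def Suc_leI)
      with K_gap[of i] have "window_end f (K i) < K j" by simp
      then show ?thesis by (auto simp: window_def)
    qed
    then have "window f (K i) \<inter> window f (K j) = {}" if "i \<noteq> j" for i j
      using that by (metis inf_commute linorder_neqE_nat)
    then show ?thesis unfolding disjoint_family_on_def F_def by blast
  qed
  have cardF: "real (K i) / f (K i) * (real n / g n) \<le> card (F i)" for i
    unfolding F_def card_cartesian_product of_nat_mult
    using window_scaleD(1)[OF g n] by (intro mult_mono card_window_ge f g K16 n) auto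
  have x1: "x\<^sup>2 < 1" using x by (simp add: power_less_one_iff)
  have "inj (\<lambda>k. (Suc k, 1::nat))" "range (\<lambda>k. (Suc k, 1::nat)) \<subseteq> {1..} \<times> {1..}" by (auto simp: inj_def)
  then obtain l0 Q where lQ: "0 < l0" "0 < Q" "\<And>(l::real) F. l0 \<le> l \<Longrightarrow> finite F \<Longrightarrow> F \<subseteq> {1..} \<times> {1..} \<Longrightarrow> Q * l \<le> card F \<Longrightarrow>
     exp (- 1 * l) \<le> \<P>(\<omega> in M. (\<Sum>i\<in>F. Z i \<omega>) \<ge> x * \<sigma> * sqrt (2 * card F * l))"
    by (rule moderate_deviation_lower[OF _ _ mean int var \<sigma> x(1) x1]) (rule that, assumption+)
  have K_lim: "filterlim K at_top sequentially" by (rule filterlim_subseq[OF K_mono])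
  have ng: "1 \<le> real n / g n"
  proof -
    have "g n \<le> ln (real n)" "1 \<le> g n" using window_scaleD[OF g n] by auto
    then show ?thesis using ln_le_minus_one[of "real n"] n by simp
  qed
  have "filterlim (\<lambda>m. u m) at_top sequentially" unfolding u_def using \<theta> by real_asymp
  then have "\<forall>\<^sub>F m in sequentially. l0 \<le> u m" by (simp add: filterlim_at_top)
  moreover have "\<forall>\<^sub>F m in sequentially. Q * u m \<le> real m / ln (real m)"
    unfolding u_def using \<theta> lQ(2) by real_asymp
  moreover have "\<forall>\<^sub>F m in sequentially. x\<^sup>2 * (ln (ln (real m)) + ln (ln (real n))) \<le> ln (ln (real m))"
  proof -
    have "filterlim (\<lambda>m::nat. (1 - x\<^sup>2) * ln (ln (real m))) at_top sequentially" using x1 by real_asymp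
    then have "\<forall>\<^sub>F m in sequentially. x\<^sup>2 * ln (ln (real n)) \<le> (1 - x\<^sup>2) * ln (ln (real m))" by (simp add: filterlim_at_top)
    then show ?thesis by eventually_elim (simp add: algebra_simps)
  qed
  ultimately have "\<forall>\<^sub>F m in sequentially. l0 \<le> u m \<and> Q * u m \<le> real m / ln (real m) \<and>
      x\<^sup>2 * (ln (ln (real m)) + ln (ln (real n))) \<le> ln (ln (real m))"
    by eventually_elim auto
  then obtain m0 where m0: "\<And>m. m0 \<le> m \<Longrightarrow> l0 \<le> u m" "\<And>m. m0 \<le> m \<Longrightarrow> Q * u m \<le> real m / ln (real m)"
     "\<And>m. m0 \<le> m \<Longrightarrow> x\<^sup>2 * (ln (ln (real m)) + ln (ln (real n))) \<le> ln (ln (real m))"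
    unfolding eventually_sequentially by blast
  have Ki: "i \<le> K i" for i by (rule strict_mono_imp_increasing[OF K_mono])
  define t where "t = (\<lambda>i. x * \<sigma> * sqrt (2 * card (F i) * u (K i)))"
  have "\<not> summable (\<lambda>i. \<P>(\<omega> in M. (\<Sum>c\<in>F i. Z c \<omega>) \<ge> t i))"
  proof
    assume sm: "summable (\<lambda>i. \<P>(\<omega> in M. (\<Sum>c\<in>F i. Z c \<omega>) \<ge> t i))"
    have "0 < C"
    proof (rule ccontr)
      assume "\<not> 0 < C"
      then have "C * real (Suc i0) powr (1 / \<theta>) \<le> 0" by (simp add: mult_nonpos_nonneg)
      moreover have "2 < ln (real (r (Suc i0)))" by (rule ln_gt_2) (use gap[of "Suc i0"] in simp)
      ultimately show False using growth[of "Suc i0"] by simp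
    qed
    have "C powr (- \<theta>) * real (i + Suc i0) powr (- 1) \<le> \<P>(\<omega> in M. (\<Sum>c\<in>F i. Z c \<omega>) \<ge> t i)" if "m0 \<le> i" for i
    proof -
      have mi: "m0 \<le> K i" using that Ki[of i] by simp
      let ?v = "real (i + Suc i0)"
      have l2: "2 < ln (real (K i))" by (rule ln_gt_2[OF K16])
      have "C powr (- \<theta>) * ?v powr (- 1) = (C * ?v powr (1 / \<theta>)) powr (- \<theta>)"
        using \<theta> \<open>0 < C\<close> by (simp add: powr_mult powr_powr)
      also have "\<dots> \<le> ln (real (K i)) powr (- \<theta>)"
        using \<theta> l2 growth[of "i + Suc i0"] by (intro powr_mono2') (auto simp: K_def)
      also have "\<dots> = exp (- 1 * u (K i))" using l2 by (simp add: powr_def u_def)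
      also have "\<dots> \<le> \<P>(\<omega> in M. (\<Sum>c\<in>F i. Z c \<omega>) \<ge> t i)"
        unfolding t_def
      proof (rule lQ(3)[OF m0(1)[OF mi] Ffin Fsub])
        have "Q * u (K i) \<le> real (K i) / ln (real (K i)) * 1" using m0(2)[OF mi] by simp
        also have "\<dots> \<le> real (K i) / f (K i) * (real n / g n)"
          using window_scaleD[OF f K16[of i]] ng by (intro mult_mono divide_left_mono) auto
        also have "\<dots> \<le> card (F i)" by (rule cardF)
        finally show "Q * u (K i) \<le> card (F i)" .
      qed
      finally show ?thesis .
    qed
    then have "\<forall>\<^sub>F i in sequentially. norm (C powr (- \<theta>) * real (i + Suc i0) powr (- 1)) \<le> \<P>(\<omega> in M. (\<Sum>c\<in>F i. Z c \<omega>) \<ge> t i)"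
      by (auto simp: eventually_sequentially intro!: exI[of _ m0])
    then have "summable (\<lambda>i. C powr (- \<theta>) * real (i + Suc i0) powr (- 1))"
      using sm by (rule summable_comparison_test_ev)
    then have "summable (\<lambda>i. real (i + Suc i0) powr (- 1))"
      by (rule summable_mult_D) (use \<open>0 < C\<close> in simp)
    then have "summable (\<lambda>i. real i powr (- 1))" by (rule summable_iff_shift[THEN iffD1])
    then show False using summable_real_powr_iff[of "- 1"] by (simp only: less_irrefl)
  qed
  then have "AE \<omega> in M. \<forall>k. \<exists>i\<ge>k. (\<Sum>c\<in>F i. Z c \<omega>) \<ge> t i"
    by (rule borel_cantelli_independent_blocks[OF indep Fsub disj])
  then show ?thesis
  proof eventually_elim
    case (elim \<omega>)
    show ?case
    proof
      fix k
      from elim obtain i where i: "max k m0 \<le> i" "(\<Sum>c\<in>F i. Z c \<omega>) \<ge> t i" by blast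
      have mi: "m0 \<le> K i" "k \<le> K i" using i Ki[of i] by auto
      let ?A = "real (K i) / f (K i) * (real n / g n)" and ?L = "ln (ln (real (K i))) + ln (ln (real n))"
      have "0 \<le> real (K i) / f (K i)" using window_scaleD(1)[OF f K16[of i]] by simp
      then have A: "0 \<le> ?A" using ng by (intro mult_nonneg_nonneg) auto
      have "0 < ln (ln (real (K i)))" "0 < ln (ln (real n))"
        using ln_ln_pos[OF K16[of i]] ln_ln_pos[OF n] .
      have "x * normalizer (2 * \<theta>) f g (K i) n = sqrt (x\<^sup>2 * (2 * \<theta> * ?A * ?L))"
        unfolding normalizer_area using x by (subst real_sqrt_mult[of "x\<^sup>2"]) simp
      also have "x\<^sup>2 * (2 * \<theta> * ?A * ?L) = 2 * \<theta> * (?A * (x\<^sup>2 * ?L))" by simp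
      also have "sqrt \<dots> \<le> sqrt (2 * \<theta> * (card (F i) * ln (ln (real (K i)))))"
        using \<theta> cardF[of i] A m0(3)[OF mi(1)] \<open>0 < ln (ln (real (K i)))\<close>  \<open>0 < ln (ln (real n))\<close>
        by (intro real_sqrt_le_mono mult_left_mono mult_mono) auto
      also have "\<dots> = sqrt (2 * card (F i) * u (K i))" by (simp add: u_def mult_ac)
      finally have "x * \<sigma> * (x * normalizer (2 * \<theta>) f g (K i) n) \<le> t i"
        unfolding t_def using x \<sigma> by (intro mult_left_mono) auto
      then have "x\<^sup>2 * \<sigma> * normalizer (2 * \<theta>) f g (K i) n \<le> (\<Sum>c\<in>F i. Z c \<omega>)"
        using i by (simp add: power2_eq_square mult_ac)
      then show "\<exists>m\<ge>k. (\<Sum>c\<in>window f m \<times> window g n. Z c \<omega>) \<ge> x\<^sup>2 * \<sigma> * normalizer (2 * \<theta>) f g m n"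
        using mi unfolding F_def by blast
    qed
  qed
qed

end

section \<open>The scales log and loglog\<close>

text \<open>
  The bound \<open>exp (exp 1) \<le> 16\<close>, from \<open>exp 1 < 2.72\<close> and \<open>exp 2.72 = exp 3 / exp
  0.28 \<le> 2.72 ^ 3 / 1.28 < 16\<close>.
\<close>

lemma ln_ln_16: "1 \<le> ln (ln (16::real))"
proof -
  have e: "exp (1::real) < 272 / 100" by (rule e_less_272)
  have "exp (272 / 100 :: real) * exp (28 / 100) = exp 1 ^ 3"
    by (simp add: exp_of_nat_mult[symmetric] flip: exp_add)
  also have "\<dots> \<le> (272 / 100) ^ 3" using e by (intro power_mono) auto
  also have "\<dots> \<le> 16 * (1 + 28 / 100 :: real)" by (simp add: power3_eq_cube)
  also have "\<dots> \<le> 16 * exp (28 / 100)" using exp_ge_add_one_self[of "28 / 100 :: real"] by (intro mult_left_mono) auto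
  finally have "exp (272 / 100 :: real) \<le> 16" by simp
  then have "272 / 100 \<le> ln (16::real)" by (subst ln_ge_iff) auto
  with e have "exp 1 \<le> ln (16::real)" by linarith
  then show ?thesis using ln_16_gt_2 by (subst ln_ge_iff) auto
qed

lemma exp_1_le_real: "exp 1 \<le> real m" if "16 \<le> m"
  using e_less_272 that by simp

lemma ln_over_self_antimono:
  assumes "16 \<le> m" "m \<le> n" shows "ln (real n) / real n \<le> ln (real m) / real m"
  using ln_x_over_x_mono[of "real m" "real n"] exp_1_le_real assms by simp

lemma ln_window_scale: "window_scale (\<lambda>m. ln (real m))"
  unfolding window_scale_def
proof (intro conjI allI impI)
  fix m n :: nat assume m: "16 \<le> m"
  show "1 \<le> ln (real m)" using ln_gt_2[OF m] by simp
  assume n: "m \<le> n"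
  have pos: "0 < ln (real m)" "0 < ln (real n)" using ln_gt_2[of m] ln_gt_2[of n] m n by auto
  show "ln (real m) \<le> ln (real n)" using m n by simp
  show "real m / ln (real m) \<le> real n / ln (real n)"
    using ln_over_self_antimono[OF m n] pos m n by (simp add: field_simps)
qed simp

lemma ln_ln_window_scale: "window_scale (\<lambda>m. ln (ln (real m)))"
  unfolding window_scale_def
proof (intro conjI allI impI)
  fix m n :: nat assume m: "16 \<le> m"
  have lm: "ln 16 \<le> ln (real m)" using m by simp
  have "ln (ln 16) \<le> ln (ln (real m))" using lm ln_16_gt_2 by (subst ln_le_cancel_iff) auto
  then show one: "1 \<le> ln (ln (real m))" using ln_ln_16 by simp
  show "ln (ln (real m)) \<le> ln (real m)" using ln_le_minus_one[of "ln (real m)"] lm ln_16_gt_2 by simp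
  assume n: "m \<le> n"
  let ?u = "ln (real m)" and ?v = "ln (real n)"
  have uv: "2 < ?u" "?u \<le> ?v" using ln_gt_2[OF m] m n by auto
  show le: "ln ?u \<le> ln ?v" using uv by simp
  have "exp 1 \<le> ?u" using one uv by (simp add: ln_ge_iff)
  then have 1: "ln ?v / ?v \<le> ln ?u / ?u" using ln_x_over_x_mono[of ?u ?v] uv by simp
  have 2: "?v / real n \<le> ?u / real m" by (rule ln_over_self_antimono[OF m n])
  have "(ln ?v / ?v) * (?v / real n) \<le> (ln ?u / ?u) * (?u / real m)"
    using 1 2 uv one le by (intro mult_mono) auto
  then have "ln ?v / real n \<le> ln ?u / real m" using uv by simp
  moreover have "0 < ln ?u" "0 < ln ?v" using one le by linarith+
  ultimately show "real m / ln ?u \<le> real n / ln ?v" using m n by (simp add: field_simps)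
qed

lemma ln_grid_fine:
  assumes "0 < \<alpha>" "\<alpha> < 1 / 2"
  shows "(\<lambda>i. ln (real (grid \<alpha> i)) * real i powr (\<alpha> - 1)) \<longlonglongrightarrow> 0"
proof (rule tendsto_sandwich[where f = "\<lambda>_. 0" and h = "\<lambda>i. real i powr (2 * \<alpha> - 1)"])
  show "(\<lambda>i. real i powr (2 * \<alpha> - 1)) \<longlonglongrightarrow> 0"
    using tendsto_neg_powr[of "2 * \<alpha> - 1" real sequentially] assms filterlim_real_sequentially by simp
  show "\<forall>\<^sub>F i in sequentially. 0 \<le> ln (real (grid \<alpha> i)) * real i powr (\<alpha> - 1)"
    using grid_bounds(3)[of \<alpha>] by (intro always_eventually allI mult_nonneg_nonneg) auto
  show "\<forall>\<^sub>F i in sequentially. ln (real (grid \<alpha> i)) * real i powr (\<alpha> - 1) \<le> real i powr (2 * \<alpha> - 1)"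
  proof (intro always_eventually allI)
    fix i
    have "ln (real (grid \<alpha> i)) * real i powr (\<alpha> - 1) \<le> real i powr \<alpha> * real i powr (\<alpha> - 1)"
      by (intro mult_right_mono ln_grid_le) auto
    also have "\<dots> = real i powr (2 * \<alpha> - 1)" by (simp flip: powr_add)
    finally show "ln (real (grid \<alpha> i)) * real i powr (\<alpha> - 1) \<le> real i powr (2 * \<alpha> - 1)" .
  qed
qed simp

lemma ln_ln_grid_fine:
  assumes "0 < \<alpha>" "\<alpha> < 1"
  shows "(\<lambda>i. ln (ln (real (grid \<alpha> i))) * real i powr (\<alpha> - 1)) \<longlonglongrightarrow> 0"
proof (rule tendsto_sandwich[where f = "\<lambda>_. 0" and h = "\<lambda>i. \<alpha> * (ln (real i) * real i powr (\<alpha> - 1))"])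
  have "((\<lambda>x::real. \<alpha> * (ln x * x powr (\<alpha> - 1))) \<longlongrightarrow> \<alpha> * 0) at_top"
  proof (rule tendsto_mult_left)
    have "((\<lambda>x::real. ln x / x powr (1 - \<alpha>)) \<longlongrightarrow> 0) at_top" using assms by real_asymp
    moreover have "x powr (\<alpha> - 1) = 1 / x powr (1 - \<alpha>)" for x :: real using powr_minus_divide[of x "1 - \<alpha>"] by simp
    ultimately show "((\<lambda>x::real. ln x * x powr (\<alpha> - 1)) \<longlongrightarrow> 0) at_top" by simp
  qed
  then show "(\<lambda>i. \<alpha> * (ln (real i) * real i powr (\<alpha> - 1))) \<longlonglongrightarrow> 0"
    using filterlim_compose[OF _ filterlim_real_sequentially] by fastforce
  have ev: "\<forall>\<^sub>F i in sequentially. 16 \<le> grid \<alpha> i" using filterlim_grid[OF assms(1)] by (simp add: filterlim_at_top)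
  then show "\<forall>\<^sub>F i in sequentially. 0 \<le> ln (ln (real (grid \<alpha> i))) * real i powr (\<alpha> - 1)"
  proof eventually_elim
    case (elim i)
    then show ?case using ln_ln_pos[OF elim] by (intro mult_nonneg_nonneg) auto
  qed
  show "\<forall>\<^sub>F i in sequentially. ln (ln (real (grid \<alpha> i))) * real i powr (\<alpha> - 1) \<le> \<alpha> * (ln (real i) * real i powr (\<alpha> - 1))"
    using ev eventually_gt_at_top[of "0::nat"]
  proof eventually_elim
    case (elim i)
    have "0 < ln (real (grid \<alpha> i))" using ln_gt_2 elim by fastforce
    then have "ln (ln (real (grid \<alpha> i))) \<le> ln (real i powr \<alpha>)" using ln_grid_le[of \<alpha> i] by (intro ln_mono) auto
    also have "\<dots> = \<alpha> * ln (real i)" using elim by (simp add: ln_powr)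
    finally have "ln (ln (real (grid \<alpha> i))) * real i powr (\<alpha> - 1) \<le> (\<alpha> * ln (real i)) * real i powr (\<alpha> - 1)"
      by (intro mult_right_mono) auto
    then show ?case by (simp add: mult.assoc)
  qed
qed simp

lemma nat_floor_exp_bounds:
  assumes "0 \<le> x"
  shows "1 \<le> nat \<lfloor>exp x\<rfloor>" "real (nat \<lfloor>exp x\<rfloor>) \<le> exp x" "exp x < real (nat \<lfloor>exp x\<rfloor>) + 1" "ln (real (nat \<lfloor>exp x\<rfloor>)) \<le> x"
proof -
  have "1 \<le> exp x" using assms by simp
  then show b: "1 \<le> nat \<lfloor>exp x\<rfloor>" "real (nat \<lfloor>exp x\<rfloor>) \<le> exp x" "exp x < real (nat \<lfloor>exp x\<rfloor>) + 1" by linarith+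
  have "ln (real (nat \<lfloor>exp x\<rfloor>)) \<le> ln (exp x)"
    by (rule ln_mono[OF b(2)]) (use b(1) in linarith)
  then show "ln (real (nat \<lfloor>exp x\<rfloor>)) \<le> x" by simp
qed

text \<open>
  At position \<open>exp (2 * sqrt i)\<close> the relative distance to the next point is about \<open>1 /
  sqrt i\<close>, twice the relative length \<open>1 / (2 * sqrt i)\<close> of a window.
\<close>

lemma ln_windows_disjoint_along_grid:
  "\<exists>i0. \<forall>i\<ge>i0. 16 \<le> nat \<lfloor>exp (2 * sqrt (real i))\<rfloor> \<and>
     window_end (\<lambda>m. ln (real m)) (nat \<lfloor>exp (2 * sqrt (real i))\<rfloor>) < nat \<lfloor>exp (2 * sqrt (real (Suc i)))\<rfloor>"
proof -
  have "\<forall>\<^sub>F i::nat in sequentially. exp (2 * sqrt (real i)) + exp (2 * sqrt (real i)) / (2 * sqrt (real i)) + 1 \<le> exp (2 * sqrt (real i + 1))"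
    by real_asymp
  moreover have "\<forall>\<^sub>F i::nat in sequentially. 17 \<le> exp (2 * sqrt (real i))" by real_asymp
  ultimately have "\<forall>\<^sub>F i::nat in sequentially. exp (2 * sqrt (real i)) + exp (2 * sqrt (real i)) / (2 * sqrt (real i)) + 1 \<le> exp (2 * sqrt (real i + 1)) \<and>
     17 \<le> exp (2 * sqrt (real i))" by eventually_elim auto
  then obtain i0 where i0: "\<And>i. i0 \<le> i \<Longrightarrow> exp (2 * sqrt (real i)) + exp (2 * sqrt (real i)) / (2 * sqrt (real i)) + 1 \<le> exp (2 * sqrt (real i + 1))"
    "\<And>i. i0 \<le> i \<Longrightarrow> 17 \<le> exp (2 * sqrt (real i))" by (auto simp: eventually_sequentially)
  show ?thesis
  proof (intro exI[of _ i0] allI impI)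
    fix i assume i: "i0 \<le> i"
    let ?x = "2 * sqrt (real i)"
    define m where "m = nat \<lfloor>exp ?x\<rfloor>"
    define m' where "m' = nat \<lfloor>exp (2 * sqrt (real (Suc i)))\<rfloor>"
    have b: "1 \<le> m" "real m \<le> exp ?x" "exp ?x < real m + 1" unfolding m_def by (rule nat_floor_exp_bounds; simp)+
    have b': "exp (2 * sqrt (real (Suc i))) < real m' + 1" unfolding m'_def by (rule nat_floor_exp_bounds) simp
    have m16: "16 \<le> m" using b(3) i0(2)[OF i] by linarith
    have lm: "2 < ln (real m)" by (rule ln_gt_2[OF m16])
    have xm: "ln (real m) \<le> ?x" unfolding m_def by (rule nat_floor_exp_bounds) simp
    have "ln (exp ?x) / exp ?x \<le> ln (real m) / real m"
      by (rule ln_x_over_x_mono) (use exp_1_le_real[OF m16] b in auto)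
    then have "?x / exp ?x \<le> ln (real m) / real m" by (simp only: ln_exp)
    moreover have "0 < ?x" using lm xm by linarith
    then have "0 < ?x / exp ?x" by (rule divide_pos_pos) simp
    ultimately have "inverse (ln (real m) / real m) \<le> inverse (?x / exp ?x)" by (intro le_imp_inverse_le) auto
    then have "real m / ln (real m) \<le> exp ?x / ?x" by (simp only: inverse_divide)
    moreover have "real (window_end (\<lambda>m. ln (real m)) m) \<le> real m + real m / ln (real m)"
      using window_end_bounds(1)[of m "\<lambda>m. ln (real m)"] lm by simp
    moreover have "exp (2 * sqrt (real (Suc i))) = exp (2 * sqrt (real i + 1))" by (simp add: add.commute)
    ultimately have "real (window_end (\<lambda>m. ln (real m)) m) < real m'"
      using i0(1)[OF i] b b' by linarith
    then have "window_end (\<lambda>m. ln (real m)) m < m'" by simp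
    with m16 show "16 \<le> nat \<lfloor>exp (2 * sqrt (real i))\<rfloor> \<and>
     window_end (\<lambda>m. ln (real m)) (nat \<lfloor>exp (2 * sqrt (real i))\<rfloor>) < nat \<lfloor>exp (2 * sqrt (real (Suc i)))\<rfloor>"
      unfolding m_def m'_def by blast
  qed
qed

lemma ln_ln_windows_disjoint_along_grid:
  "\<exists>i0. \<forall>i\<ge>i0. 16 \<le> nat \<lfloor>exp (real i)\<rfloor> \<and>
     window_end (\<lambda>m. ln (ln (real m))) (nat \<lfloor>exp (real i)\<rfloor>) < nat \<lfloor>exp (real (Suc i))\<rfloor>"
proof -
  have "\<forall>\<^sub>F i::nat in sequentially. 17 \<le> exp (real i)" by real_asymp
  then obtain i0 where i0: "\<And>i. i0 \<le> i \<Longrightarrow> 17 \<le> exp (real i)"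
    by (auto simp: eventually_sequentially)
  have step: "2 * exp (real i) + 1 \<le> exp (real i + 1)" if "i0 \<le> i" for i
  proof -
    have "5 / 2 \<le> exp (1::real)" using exp_lower_Taylor_quadratic[of 1] by simp
    then have "exp (real i) * (5 / 2) \<le> exp (real i) * exp 1" by (intro mult_left_mono) auto
    also have "exp (real i) * exp 1 = exp (real i + 1)" by (simp only: exp_add)
    finally show ?thesis using i0[OF that] by linarith
  qed
  show ?thesis
  proof (intro exI[of _ i0] allI impI)
    fix i assume i: "i0 \<le> i"
    define m where "m = nat \<lfloor>exp (real i)\<rfloor>"
    define m' where "m' = nat \<lfloor>exp (real (Suc i))\<rfloor>"
    have b: "1 \<le> m" "real m \<le> exp (real i)" "exp (real i) < real m + 1" unfolding m_def by (rule nat_floor_exp_bounds; simp)+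
    have b': "exp (real (Suc i)) < real m' + 1" unfolding m'_def by (rule nat_floor_exp_bounds) simp
    have m16: "16 \<le> m" using b(3) i0[OF i] by linarith
    have f1: "1 \<le> ln (ln (real m))" by (rule window_scaleD(1)[OF ln_ln_window_scale m16])
    then have "real m / ln (ln (real m)) \<le> real m" using mult_left_mono[of 1 "ln (ln (real m))" "real m"] by (simp add: divide_le_eq)
    moreover have "real (window_end (\<lambda>m. ln (ln (real m))) m) \<le> real m + real m / ln (ln (real m))"
      using window_end_bounds(1)[of m "\<lambda>m. ln (ln (real m))"] f1 by simp
    moreover have "exp (real (Suc i)) = exp (real i + 1)" by (simp add: add.commute)
    ultimately have "real (window_end (\<lambda>m. ln (ln (real m))) m) < real m'"
      using step[OF i] b b' by linarith
    then have "window_end (\<lambda>m. ln (ln (real m))) m < m'" by simp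
    with m16 show "16 \<le> nat \<lfloor>exp (real i)\<rfloor> \<and>
     window_end (\<lambda>m. ln (ln (real m))) (nat \<lfloor>exp (real i)\<rfloor>) < nat \<lfloor>exp (real (Suc i))\<rfloor>"
      unfolding m_def m'_def by blast
  qed
qed

section \<open>Moments and lattice points below a level of the normalizer\<close>

text \<open>
  The factor that distinguishes the square of the normalizer from a multiple of \<open>m * n\<close>.
\<close>

definition log_ratio :: "(nat \<Rightarrow> real) \<Rightarrow> (nat \<Rightarrow> real) \<Rightarrow> nat \<Rightarrow> nat \<Rightarrow> real" where
  "log_ratio f g m n = (ln (ln (real m)) + ln (ln (real n))) / (f m * g n)"

text \<open>
  Up to constants, \<open>1 / \<psi> x\<close> is the size of the logarithmic factor \<open>log_ratio\<close> at
  the pairs that dominate the lattice points with normalizer below \<open>x\<close>: it is a lower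
  bound for \<open>log_ratio\<close> as soon as \<open>m * n\<close> is at most polynomial in \<open>x\<close>, and an upper
  bound when, in addition, both indices are at least a power of \<open>x\<close>. Then there are about
  \<open>x\<^sup>2 * \<psi> x\<close> times \<open>ln x\<close> such lattice points, the last factor coming from
  the hyperbola \<open>m * n = const\<close>.
\<close>

definition moment_rate :: "(nat \<Rightarrow> real) \<Rightarrow> (nat \<Rightarrow> real) \<Rightarrow> (real \<Rightarrow> real) \<Rightarrow> bool" where
  "moment_rate f g \<psi> \<longleftrightarrow> \<psi> \<in> borel_measurable borel \<and> (\<forall>x. 1 \<le> \<psi> x) \<and>
     (\<exists>C>0. \<forall>x\<ge>0. \<psi> x \<le> C * max 1 x) \<and>
     (\<forall>K\<ge>1. \<exists>c>0. \<forall>x\<ge>1. \<forall>m\<ge>16. \<forall>n\<ge>16. real m * real n \<le> K * x ^ 4 \<longrightarrow> c \<le> \<psi> x * log_ratio f g m n) \<and>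
     (\<exists>C>0. \<exists>x0. \<forall>x\<ge>x0. \<forall>m n. sqrt x \<le> real m \<longrightarrow> real m \<le> x ^ 4 \<longrightarrow> sqrt x \<le> real n \<longrightarrow> real n \<le> x ^ 4 \<longrightarrow>
        \<psi> x * log_ratio f g m n \<le> C)"

lemma normalizer_log_ratio: "normalizer c f g m n = sqrt (c * (real m * real n) * log_ratio f g m n)"
  by (simp add: normalizer_def log_ratio_def mult_ac)

lemma normalizer_scale: "0 \<le> \<eta> \<Longrightarrow> \<eta> * normalizer c f g m n = normalizer (\<eta>\<^sup>2 * c) f g m n"
  unfolding normalizer_log_ratio by (simp add: mult.assoc real_sqrt_mult)

lemma ln_le_two_sqrt: "0 < x \<Longrightarrow> ln x \<le> 2 * sqrt x" for x :: real
  using ln_le_minus_one[of "sqrt x"] by (simp add: ln_sqrt)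

lemma normalizer_sq_ge:
  assumes f: "window_scale f" "16 \<le> m" and g: "window_scale g" "16 \<le> n" and c: "0 < c"
  shows "c / 4 * sqrt (real m * real n) \<le> c * (real m * real n) * log_ratio f g m n"
proof -
  have L: "1 \<le> ln (ln (real m)) + ln (ln (real n))"
    using window_scaleD(1)[OF ln_ln_window_scale f(2)] window_scaleD(1)[OF ln_ln_window_scale g(2)] by linarith
  have fg: "1 \<le> f m" "1 \<le> g n" using window_scaleD(1)[OF f] window_scaleD(1)[OF g] by auto
  have "f m \<le> 2 * sqrt (real m)" "g n \<le> 2 * sqrt (real n)"
    using window_scaleD(2)[OF f] window_scaleD(2)[OF g] ln_le_two_sqrt[of "real m"] ln_le_two_sqrt[of "real n"] f(2) g(2) by auto
  then have "f m * g n \<le> (2 * sqrt (real m)) * (2 * sqrt (real n))" using fg by (intro mult_mono) auto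
  then have fg4: "f m * g n \<le> 4 * sqrt (real m * real n)" by (simp add: real_sqrt_mult)
  have fgp: "0 < f m * g n" using fg by (intro mult_pos_pos) auto
  define s where "s = sqrt (real m * real n)"
  have s: "0 < s" "s * s = real m * real n" using f g by (auto simp: s_def)
  have "1 / (4 * s) \<le> log_ratio f g m n"
    unfolding log_ratio_def using L fg4[folded s_def] fgp s(1) by (intro frac_le) auto
  then have "c * (s * s) * (1 / (4 * s)) \<le> c * (s * s) * log_ratio f g m n"
    using c s by (intro mult_left_mono) auto
  moreover have "c * (s * s) * (1 / (4 * s)) = c / 4 * s" using s(1) by (simp add: field_simps)
  ultimately have "c / 4 * s \<le> c * (s * s) * log_ratio f g m n" by linarith
  then show ?thesis unfolding s(2) by (simp only: s_def)
qed

lemma sum_inverse_le: "1 \<le> N \<Longrightarrow> (\<Sum>m=1..N. 1 / real m) \<le> 1 + ln (real N)"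
proof (induction N rule: dec_induct)
  case (step N)
  have "ln (real N / real (Suc N)) \<le> real N / real (Suc N) - 1" using step by (intro ln_le_minus_one) auto
  also have "\<dots> = - 1 / real (Suc N)" by (simp add: field_simps)
  finally have "1 / real (Suc N) \<le> ln (real (Suc N)) - ln (real N)" using step by (simp add: ln_div)
  then show ?case using step by simp
qed simp

lemma sum_inverse_ge: "1 \<le> A \<Longrightarrow> A \<le> Suc B \<Longrightarrow> ln (real (Suc B)) - ln (real A) \<le> (\<Sum>m=A..B. 1 / real m)"
proof (induction B)
  case 0
  then show ?case by (cases "A = 1") auto
next
  case (Suc B)
  show ?case
  proof (cases "A = Suc (Suc B)")
    case False
    then have A: "A \<le> Suc B" using Suc by simp
    have "ln (1 + 1 / real (Suc B)) \<le> 1 / real (Suc B)" by (rule ln_add_one_self_le_self) simp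
    moreover have "1 + 1 / real (Suc B) = real (Suc (Suc B)) / real (Suc B)" by (simp add: field_simps)
    ultimately have "ln (real (Suc (Suc B))) - ln (real (Suc B)) \<le> 1 / real (Suc B)" by (simp add: ln_div)
    then show ?thesis using Suc.IH Suc.prems A by simp
  qed simp
qed

text \<open>
  The divisor sum, estimated row by row.
\<close>

lemma card_lattice_points_below_hyperbola:
  assumes F: "finite F" "F \<subseteq> {1..} \<times> {1..}" and T: "1 \<le> T"
    and FT: "\<And>m n. (m, n) \<in> F \<Longrightarrow> real m * real n \<le> T"
  shows "real (card F) \<le> T * (1 + ln T)"
proof -
  define N where "N = nat \<lfloor>T\<rfloor>"
  have N: "1 \<le> N" "real N \<le> T" using T by (auto simp: N_def le_nat_iff)
  have "F \<subseteq> (SIGMA m:{1..N}. {1..nat \<lfloor>T / real m\<rfloor>})"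
  proof
    fix p assume "p \<in> F"
    then obtain m n where p: "p = (m, n)" "1 \<le> m" "1 \<le> n" "real m * real n \<le> T" using F FT by (cases p) auto
    have "real m * 1 \<le> real m * real n" using p by (intro mult_left_mono) auto
    then have "real m \<le> T" using p by linarith
    then have "m \<le> N" by (simp add: N_def le_nat_floor)
    moreover have "real n \<le> T / real m" using p by (simp add: le_divide_eq mult.commute)
    then have "n \<le> nat \<lfloor>T / real m\<rfloor>" by (rule le_nat_floor)
    ultimately show "p \<in> (SIGMA m:{1..N}. {1..nat \<lfloor>T / real m\<rfloor>})" using p by auto
  qed
  then have "card F \<le> card (SIGMA m:{1..N}. {1..nat \<lfloor>T / real m\<rfloor>})" by (intro card_mono) auto
  also have "\<dots> = (\<Sum>m=1..N. nat \<lfloor>T / real m\<rfloor>)" by (simp add: card_SigmaI)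
  finally have "real (card F) \<le> real (\<Sum>m=1..N. nat \<lfloor>T / real m\<rfloor>)" by (simp only: of_nat_le_iff)
  also have "\<dots> = (\<Sum>m=1..N. real (nat \<lfloor>T / real m\<rfloor>))" by simp
  also have "\<dots> \<le> (\<Sum>m=1..N. T * (1 / real m))"
    using T by (intro sum_mono) (simp add: of_nat_floor)
  also have "\<dots> = T * (\<Sum>m=1..N. 1 / real m)" by (simp add: sum_distrib_left)
  also have "\<dots> \<le> T * (1 + ln (real N))" using T by (intro mult_left_mono sum_inverse_le N) auto
  also have "\<dots> \<le> T * (1 + ln T)" using T N by (intro mult_left_mono add_left_mono ln_mono) auto
  finally show ?thesis .
qed

text \<open>
  A bootstrap. Since \<open>log_ratio\<close> is at least of order \<open>1 / sqrt (m * n)\<close>, a normalizer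
  below \<open>x\<close> forces \<open>m * n\<close> to be at most of order \<open>x ^ 4\<close>; in this range \<open>log_ratio\<close>
  is at least of order \<open>1 / \<psi> x\<close>, which improves the bound to \<open>x\<^sup>2 * \<psi>
  x\<close>. It remains to count lattice points below a hyperbola.
\<close>

lemma card_normalizer_less_upper:
  assumes f: "window_scale f" and g: "window_scale g" and \<psi>: "moment_rate f g \<psi>" and c: "0 < c"
  obtains B where "\<And>x F. 0 \<le> x \<Longrightarrow> finite F \<Longrightarrow> F \<subseteq> {16..} \<times> {16..} \<Longrightarrow>
     real (card {(m, n) \<in> F. normalizer c f g m n < x}) \<le> B * (1 + x\<^sup>2 * (log_plus x * \<psi> x))"
proof -
  obtain C0 where C0: "0 < C0" "\<And>x. 0 \<le> x \<Longrightarrow> \<psi> x \<le> C0 * max 1 x" using \<psi> by (auto simp: moment_rate_def)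
  have \<psi>1: "1 \<le> \<psi> x" for x using \<psi> by (auto simp: moment_rate_def)
  define K where "K = max 1 (16 / c\<^sup>2)"
  obtain c1 where c1: "0 < c1" "\<And>x m n. 1 \<le> x \<Longrightarrow> 16 \<le> m \<Longrightarrow> 16 \<le> n \<Longrightarrow> real m * real n \<le> K * x ^ 4 \<Longrightarrow> c1 \<le> \<psi> x * log_ratio f g m n"
    using \<psi> unfolding moment_rate_def by (metis K_def max.cobounded1)
  define C1 where "C1 = max 1 (1 / (c1 * c))"
  define C2 where "C2 = 1 + (\<bar>ln (C1 * C0)\<bar> + 3)"
  have C1: "1 \<le> C1" "1 / (c1 * c) \<le> C1" by (auto simp: C1_def)
  have main: "real (card {(m, n) \<in> F. normalizer c f g m n < x}) \<le> C1 * C2 * (x\<^sup>2 * (log_plus x * \<psi> x))"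
    if x: "1 \<le> x" and F: "finite F" "F \<subseteq> {16..} \<times> {16..}" for x F
  proof -
    define T where "T = C1 * (x\<^sup>2 * \<psi> x)"
    have x2: "1 \<le> x\<^sup>2" using x by (simp add: one_le_power)
    have "1 * 1 \<le> x\<^sup>2 * \<psi> x" using x2 \<psi>1[of x] by (intro mult_mono) auto
    then have "1 * 1 \<le> C1 * (x\<^sup>2 * \<psi> x)" using C1 by (intro mult_mono) auto
    then have T1: "1 \<le> T" by (simp add: T_def)
    have "real (card {(m, n) \<in> F. normalizer c f g m n < x}) \<le> T * (1 + ln T)"
    proof (rule card_lattice_points_below_hyperbola[OF _ _ T1])
      fix m n assume "(m, n) \<in> {(m, n) \<in> F. normalizer c f g m n < x}"
      then have mn: "16 \<le> m" "16 \<le> n" "normalizer c f g m n < x" using F by auto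
      let ?b = "c * (real m * real n) * log_ratio f g m n"
      have "?b < x\<^sup>2"
      proof (rule ccontr)
        assume "\<not> ?b < x\<^sup>2"
        then have "x \<le> sqrt ?b" using x by (intro real_le_rsqrt) auto
        then show False using mn(3) by (simp add: normalizer_log_ratio)
      qed
      moreover have "c / 4 * sqrt (real m * real n) \<le> ?b" by (rule normalizer_sq_ge[OF f mn(1) g mn(2) c])
      ultimately have "c / 4 * sqrt (real m * real n) \<le> x\<^sup>2" by linarith
      then have "sqrt (real m * real n) \<le> 4 / c * x\<^sup>2" using c by (simp add: field_simps)
      then have "(sqrt (real m * real n))\<^sup>2 \<le> (4 / c * x\<^sup>2)\<^sup>2" by (intro power_mono) auto
      then have "real m * real n \<le> 16 / c\<^sup>2 * x ^ 4" by (simp add: power_mult_distrib power_divide)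
      also have "\<dots> \<le> K * x ^ 4" using x by (intro mult_right_mono) (auto simp: K_def)
      finally have "c1 \<le> \<psi> x * log_ratio f g m n" using c1(2) x mn by blast
      then have "c * (real m * real n) * c1 \<le> c * (real m * real n) * (\<psi> x * log_ratio f g m n)"
        using c by (intro mult_left_mono) auto
      also have "\<dots> = ?b * \<psi> x" by simp
      also have "\<dots> \<le> x\<^sup>2 * \<psi> x" using \<open>?b < x\<^sup>2\<close> \<psi>1[of x] by (intro mult_right_mono) auto
      finally have "real m * real n \<le> 1 / (c1 * c) * (x\<^sup>2 * \<psi> x)" using c c1 by (simp add: field_simps)
      also have "\<dots> \<le> T" unfolding T_def using C1 \<psi>1[of x] by (intro mult_right_mono) auto
      finally show "real m * real n \<le> T" .
    next
      show "finite {(m, n) \<in> F. normalizer c f g m n < x}" by (rule finite_subset[OF _ F(1)]) auto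
      show "{(m, n) \<in> F. normalizer c f g m n < x} \<subseteq> {1..} \<times> {1..}" using F(2) by auto
    qed
    also have "\<dots> \<le> T * (C2 * log_plus x)"
    proof (intro mult_left_mono)
      have "T \<le> C1 * (x\<^sup>2 * (C0 * x))" unfolding T_def using C1 C0(2)[of x] x by (intro mult_left_mono) auto
      also have "\<dots> = (C1 * C0) * x ^ 3" by (simp add: power2_eq_square power3_eq_cube)
      finally have "ln T \<le> ln ((C1 * C0) * x ^ 3)" using T1 by (intro ln_mono) auto
      also have "\<dots> = ln (C1 * C0) + 3 * ln x" using C1 C0 x by (simp add: ln_mult ln_realpow)
      also have "\<dots> \<le> \<bar>ln (C1 * C0)\<bar> * log_plus x + 3 * log_plus x"
      proof (intro add_mono)
        have "\<bar>ln (C1 * C0)\<bar> * 1 \<le> \<bar>ln (C1 * C0)\<bar> * log_plus x" using log_plus_ge_1 by (intro mult_left_mono) auto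
        then show "ln (C1 * C0) \<le> \<bar>ln (C1 * C0)\<bar> * log_plus x" by linarith
      qed (simp add: log_plus_def)
      finally show "1 + ln T \<le> C2 * log_plus x" using log_plus_ge_1[of x] by (simp add: C2_def algebra_simps)
    qed (use T1 in simp)
    finally show ?thesis by (simp add: T_def mult_ac)
  qed
  define B where "B = C1 * C2 * (log_plus 1 * \<psi> 1 + 1)"
  have C2: "0 \<le> C1 * C2" using C1 by (auto simp: C2_def)
  have lp1: "1 \<le> log_plus 1 * \<psi> 1" using mult_mono[of 1 "log_plus 1" 1 "\<psi> 1"] log_plus_ge_1[of 1] \<psi>1[of 1] by simp
  have \<phi>0: "0 \<le> x\<^sup>2 * (log_plus x * \<psi> x)" for x
    using log_plus_pos[of x] \<psi>1[of x] by (intro mult_nonneg_nonneg) auto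
  show ?thesis
  proof (rule that[of B])
    fix x :: real and F :: "(nat \<times> nat) set"
    assume x: "0 \<le> x" and F: "finite F" "F \<subseteq> {16..} \<times> {16..}"
    show "real (card {(m, n) \<in> F. normalizer c f g m n < x}) \<le> B * (1 + x\<^sup>2 * (log_plus x * \<psi> x))"
    proof (cases "1 \<le> x")
      case True
      have "real (card {(m, n) \<in> F. normalizer c f g m n < x}) \<le> C1 * C2 * (x\<^sup>2 * (log_plus x * \<psi> x))"
        by (rule main[OF True F])
      also have "\<dots> \<le> B * (x\<^sup>2 * (log_plus x * \<psi> x))"
        unfolding B_def using C2 lp1 \<phi>0[of x] mult_left_mono[of 1 "log_plus 1 * \<psi> 1 + 1" "C1 * C2"] by (intro mult_right_mono) auto
      also have "\<dots> \<le> B * (1 + x\<^sup>2 * (log_plus x * \<psi> x))"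
        unfolding B_def using C2 lp1 by (intro mult_left_mono) auto
      finally show ?thesis .
    next
      case False
      have "card {(m, n) \<in> F. normalizer c f g m n < x} \<le> card {(m, n) \<in> F. normalizer c f g m n < 1}"
        using F False by (intro card_mono finite_subset[OF _ F(1)]) auto
      then have "real (card {(m, n) \<in> F. normalizer c f g m n < x}) \<le> real (card {(m, n) \<in> F. normalizer c f g m n < 1})" by simp
      also have "\<dots> \<le> C1 * C2 * (1\<^sup>2 * (log_plus 1 * \<psi> 1))" by (rule main[OF _ F]) simp
      also have "\<dots> \<le> C1 * C2 * (log_plus 1 * \<psi> 1 + 1)" using C2 by (intro mult_left_mono) auto
      also have "\<dots> = B * 1" by (simp add: B_def)
      also have "\<dots> \<le> B * (1 + x\<^sup>2 * (log_plus x * \<psi> x))"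
        using \<phi>0[of x] C2 lp1 by (intro mult_left_mono) (auto simp: B_def)
      finally show ?thesis .
    qed
  qed
qed

lemma (in prob_space) sum_prob_exceeds_eq:
  fixes X :: "'a \<Rightarrow> real"
  assumes [measurable]: "X \<in> borel_measurable M" and F: "finite F"
  shows "(\<Sum>(m, n)\<in>F. \<P>(\<omega> in M. b m n < \<bar>X \<omega>\<bar>)) = expectation (\<lambda>\<omega>. real (card {(m, n) \<in> F. b m n < \<bar>X \<omega>\<bar>}))"
    and "integrable M (\<lambda>\<omega>. real (card {(m, n) \<in> F. b m n < \<bar>X \<omega>\<bar>}))"
proof -
  have eq: "real (card {(m, n) \<in> F. b m n < \<bar>X \<omega>\<bar>}) = (\<Sum>(m, n)\<in>F. indicator {\<omega>\<in>space M. b m n < \<bar>X \<omega>\<bar>} \<omega>)"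
    if "\<omega> \<in> space M" for \<omega>
  proof -
    have "(\<Sum>(m, n)\<in>F. indicator {\<omega>\<in>space M. b m n < \<bar>X \<omega>\<bar>} \<omega> :: real) = (\<Sum>p\<in>F. if b (fst p) (snd p) < \<bar>X \<omega>\<bar> then 1 else 0)"
      using that by (intro sum.cong) (auto simp: indicator_def)
    also have "\<dots> = real (card {p \<in> F. b (fst p) (snd p) < \<bar>X \<omega>\<bar>})"
      using F by (simp add: sum.If_cases Int_def)
    finally show ?thesis by (simp add: case_prod_unfold)
  qed
  have int: "integrable M (\<lambda>\<omega>. \<Sum>(m, n)\<in>F. indicator {\<omega>\<in>space M. b m n < \<bar>X \<omega>\<bar>} \<omega> :: real)"
    unfolding case_prod_unfold by (intro Bochner_Integration.integrable_sum integrable_real_indicator) (auto simp: emeasure_eq_measure)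
  then show "integrable M (\<lambda>\<omega>. real (card {(m, n) \<in> F. b m n < \<bar>X \<omega>\<bar>}))"
    by (subst Bochner_Integration.integrable_cong[OF refl eq])
  have "expectation (\<lambda>\<omega>. real (card {(m, n) \<in> F. b m n < \<bar>X \<omega>\<bar>}))
     = expectation (\<lambda>\<omega>. \<Sum>(m, n)\<in>F. indicator {\<omega>\<in>space M. b m n < \<bar>X \<omega>\<bar>} \<omega>)"
    by (rule Bochner_Integration.integral_cong[OF refl eq])
  also have "\<dots> = (\<Sum>(m, n)\<in>F. \<P>(\<omega> in M. b m n < \<bar>X \<omega>\<bar>))"
    unfolding case_prod_unfold
    by (subst Bochner_Integration.integral_sum) (auto simp: emeasure_eq_measure)
  finally show "(\<Sum>(m, n)\<in>F. \<P>(\<omega> in M. b m n < \<bar>X \<omega>\<bar>)) = expectation (\<lambda>\<omega>. real (card {(m, n) \<in> F. b m n < \<bar>X \<omega>\<bar>}))" by simp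
qed

text \<open>
  Summing the tail probabilities over \<open>F\<close> is the same as taking the expectation of the
  number of pairs in \<open>F\<close> whose normalizer is below \<open>\<bar>X\<bar>\<close>.
\<close>

lemma (in prob_space) sum_prob_exceeds_bounded:
  fixes X :: "'a \<Rightarrow> real"
  assumes f: "window_scale f" and g: "window_scale g" and \<psi>: "moment_rate f g \<psi>" and c: "0 < c"
    and [measurable]: "X \<in> borel_measurable M"
    and int: "integrable M (\<lambda>\<omega>. (X \<omega>)\<^sup>2 * (log_plus \<bar>X \<omega>\<bar> * \<psi> \<bar>X \<omega>\<bar>))"
  obtains B where "\<And>F. finite F \<Longrightarrow> F \<subseteq> {16..} \<times> {16..} \<Longrightarrow>
    (\<Sum>(m, n)\<in>F. \<P>(\<omega> in M. normalizer c f g m n < \<bar>X \<omega>\<bar>)) \<le> B"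
proof -
  obtain B where B: "\<And>x F. 0 \<le> x \<Longrightarrow> finite F \<Longrightarrow> F \<subseteq> {16..} \<times> {16..} \<Longrightarrow>
     real (card {(m, n) \<in> F. normalizer c f g m n < x}) \<le> B * (1 + x\<^sup>2 * (log_plus x * \<psi> x))"
    by (rule card_normalizer_less_upper[OF f g \<psi> c]) (rule that, assumption)
  show ?thesis
  proof (rule that)
    fix F :: "(nat \<times> nat) set" assume F: "finite F" "F \<subseteq> {16..} \<times> {16..}"
    have "(\<Sum>(m, n)\<in>F. \<P>(\<omega> in M. normalizer c f g m n < \<bar>X \<omega>\<bar>)) =
      expectation (\<lambda>\<omega>. real (card {(m, n) \<in> F. normalizer c f g m n < \<bar>X \<omega>\<bar>}))"
      by (rule sum_prob_exceeds_eq) (use F in auto)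
    also have "\<dots> \<le> expectation (\<lambda>\<omega>. B * (1 + (X \<omega>)\<^sup>2 * (log_plus \<bar>X \<omega>\<bar> * \<psi> \<bar>X \<omega>\<bar>)))"
    proof (rule integral_mono)
      show "integrable M (\<lambda>\<omega>. B * (1 + (X \<omega>)\<^sup>2 * (log_plus \<bar>X \<omega>\<bar> * \<psi> \<bar>X \<omega>\<bar>)))"
        by (intro integrable_mult_right Bochner_Integration.integrable_add int integrable_const)
      show "real (card {(m, n) \<in> F. normalizer c f g m n < \<bar>X \<omega>\<bar>}) \<le> B * (1 + (X \<omega>)\<^sup>2 * (log_plus \<bar>X \<omega>\<bar> * \<psi> \<bar>X \<omega>\<bar>))" for \<omega>
        using B[of "\<bar>X \<omega>\<bar>" F] F by simp
    qed (rule sum_prob_exceeds_eq, use F in auto)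
    finally show "(\<Sum>(m, n)\<in>F. \<P>(\<omega> in M. normalizer c f g m n < \<bar>X \<omega>\<bar>)) \<le> expectation (\<lambda>\<omega>. B * (1 + (X \<omega>)\<^sup>2 * (log_plus \<bar>X \<omega>\<bar> * \<psi> \<bar>X \<omega>\<bar>)))" .
  qed
qed

text \<open>
  Only rows \<open>m\<close> between \<open>sqrt x\<close> and \<open>x\<close> are counted. They already contribute a fixed
  proportion of the logarithm, and all logarithms of the indices are comparable with \<open>ln
  x\<close> there.
\<close>

lemma card_normalizer_less_lower:
  assumes \<psi>: "moment_rate f g \<psi>" and c: "0 < c"
  obtains c1 x0 where "0 < c1" "1 \<le> x0"
    "\<And>x. x0 \<le> x \<Longrightarrow> \<exists>K. c1 * (x\<^sup>2 * (log_plus x * \<psi> x)) \<le> real (card {(m, n) \<in> {k..K} \<times> {k..K}. normalizer c f g m n < x})"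
proof -
  obtain C0 where C0: "0 < C0" "\<And>x. 0 \<le> x \<Longrightarrow> \<psi> x \<le> C0 * max 1 x" using \<psi> by (auto simp: moment_rate_def)
  have \<psi>1: "1 \<le> \<psi> x" for x using \<psi> by (auto simp: moment_rate_def)
  obtain C x1 where C: "0 < C" "\<And>x m n. x1 \<le> x \<Longrightarrow> sqrt x \<le> real m \<Longrightarrow> real m \<le> x ^ 4 \<Longrightarrow> sqrt x \<le> real n \<Longrightarrow> real n \<le> x ^ 4 \<Longrightarrow>
        \<psi> x * log_ratio f g m n \<le> C" using \<psi> unfolding moment_rate_def by blast
  \<comment> \<open>The factor 2 makes the inequality for the normalizer strict.\<close>
  define D where "D = 2 * c * C"
  have D: "0 < D" using c C by (simp add: D_def)
  have "\<forall>\<^sub>F x in at_top. C0 / D \<le> (x::real)" by (rule eventually_ge_at_top)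
  moreover have "\<forall>\<^sub>F x in at_top. 2 * (sqrt x + 1) \<le> x / D" using D by real_asymp
  moreover have "\<forall>\<^sub>F x::real in at_top. ln x / 4 \<le> ln (x / (sqrt x + 1))" by real_asymp
  moreover have "\<forall>\<^sub>F x in at_top. real k \<le> sqrt x" by real_asymp
  moreover have "\<forall>\<^sub>F x in at_top. x1 \<le> x \<and> exp 1 \<le> x" by (intro eventually_conj eventually_ge_at_top)
  moreover have "\<forall>\<^sub>F x::real in at_top. sqrt x + 1 \<le> x" by real_asymp
  ultimately have "\<forall>\<^sub>F x in at_top. C0 / D \<le> x \<and> 2 * (sqrt x + 1) \<le> x / D \<and> ln x / 4 \<le> ln (x / (sqrt x + 1)) \<and>
     real k \<le> sqrt x \<and> (x1 \<le> x \<and> exp 1 \<le> x) \<and> sqrt x + 1 \<le> x" by eventually_elim auto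
  then obtain x2 where x2: "\<And>x. x2 \<le> x \<Longrightarrow> C0 / D \<le> x \<and> 2 * (sqrt x + 1) \<le> x / D \<and> ln x / 4 \<le> ln (x / (sqrt x + 1)) \<and>
     real k \<le> sqrt x \<and> (x1 \<le> x \<and> exp 1 \<le> x) \<and> sqrt x + 1 \<le> x" by (auto simp: eventually_at_top_linorder)
  show ?thesis
  proof (rule that[of "1 / (8 * D)" "max 1 x2"])
    show "0 < 1 / (8 * D)" using D by simp
    fix x :: real assume xx: "max 1 x2 \<le> x"
    note X = x2[of x]
    have x: "1 \<le> x" "C0 / D \<le> x" "2 * (sqrt x + 1) \<le> x / D" "ln x / 4 \<le> ln (x / (sqrt x + 1))" "real k \<le> sqrt x" "x1 \<le> x" "exp 1 \<le> x" "sqrt x + 1 \<le> x"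
      using X xx by auto
    define T where "T = x\<^sup>2 * \<psi> x / D"
    define a where "a = nat \<lceil>sqrt x\<rceil>"
    define b where "b = nat \<lfloor>x\<rfloor>"
    have sx: "1 \<le> sqrt x" using x by simp
    have a: "sqrt x \<le> real a" "real a < sqrt x + 1"
      unfolding a_def using sx by linarith+
    then have a1: "1 \<le> a" using sx by linarith
    have b: "real b \<le> x" "x < real b + 1" using x by (auto simp: b_def)
    have x4: "x \<le> x ^ 4" using power_increasing[of 1 4 x] x by simp
    have T4: "T \<le> x ^ 4"
    proof -
      have "T \<le> x\<^sup>2 * (C0 * x) / D" unfolding T_def using C0(2)[of x] x D by (intro divide_right_mono mult_left_mono) auto
      also have "\<dots> = (C0 / D) * x ^ 3" by (simp add: power2_eq_square power3_eq_cube)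
      also have "\<dots> \<le> x * x ^ 3" using x by (intro mult_right_mono) auto
      finally show ?thesis by (simp add: power_numeral_reduce)
    qed
    have T0: "0 \<le> T" unfolding T_def using D \<psi>1[of x] by (intro divide_nonneg_pos mult_nonneg_nonneg) auto
    have Tm: "2 * (sqrt x + 1) \<le> T / real m" if m: "a \<le> m" "m \<le> b" for m
    proof -
      have mx: "0 < real m" "real m \<le> x" using m a1 b by auto
      have "x / D * real m \<le> x / D * x" using mx x D by (intro mult_left_mono) auto
      also have "\<dots> = x\<^sup>2 * 1 / D" by (simp add: power2_eq_square)
      also have "\<dots> \<le> T" unfolding T_def using \<psi>1[of x] D by (intro divide_right_mono mult_left_mono) auto
      finally have "x / D \<le> T / real m" using mx by (simp only: pos_le_divide_eq)
      then show ?thesis using x by linarith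
    qed
    define S where "S = (SIGMA m:{a..b}. {a..nat \<lfloor>T / real m\<rfloor>})"
    define K where "K = nat \<lfloor>x ^ 4\<rfloor>"
    have S_sub: "S \<subseteq> {(m, n) \<in> {k..K} \<times> {k..K}. normalizer c f g m n < x}"
    proof
      fix p assume "p \<in> S"
      then obtain m n where p: "p = (m, n)" "a \<le> m" "m \<le> b" "a \<le> n" "n \<le> nat \<lfloor>T / real m\<rfloor>" by (auto simp: S_def)
      have mx: "1 \<le> real m" "sqrt x \<le> real m" "real m \<le> x ^ 4" using p a a1 b x4 by auto
      have nT: "real n \<le> T / real m"
      proof -
        have "real n \<le> real (nat \<lfloor>T / real m\<rfloor>)" using p(5) by simp
        also have "\<dots> \<le> T / real m" using T0 by (intro of_nat_floor) simp
        finally show ?thesis .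
      qed
      then have mn: "real m * real n \<le> T" using mx by (simp add: pos_le_divide_eq mult.commute)
      have "real n \<le> T"
      proof -
        have "1 * real n \<le> real m * real n" using mx by (intro mult_right_mono) auto
        then show ?thesis using mn by linarith
      qed
      then have nx: "sqrt x \<le> real n" "real n \<le> x ^ 4" using p a T4 by auto
      have "\<psi> x * log_ratio f g m n \<le> C" by (rule C(2)) (use x mx nx in auto)
      have "c * (real m * real n) * log_ratio f g m n < x\<^sup>2"
      proof (cases "0 < log_ratio f g m n")
        case True
        have "c * (real m * real n) * log_ratio f g m n \<le> c * T * log_ratio f g m n"
          using True c mn by (intro mult_right_mono mult_left_mono) auto
        also have "\<dots> = x\<^sup>2 * (\<psi> x * log_ratio f g m n) * (c / D)" by (simp add: T_def)
        also have "\<dots> \<le> x\<^sup>2 * C * (c / D)"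
          using \<open>\<psi> x * log_ratio f g m n \<le> C\<close> c D by (intro mult_right_mono mult_left_mono) auto
        also have "\<dots> = x\<^sup>2 / 2" using c C by (simp add: D_def)
        also have "\<dots> < x\<^sup>2" using x by simp
        finally show ?thesis .
      next
        case False
        then have "c * (real m * real n) * log_ratio f g m n \<le> 0" using c by (intro mult_nonneg_nonpos) auto
        also have "0 < x\<^sup>2" using x by simp
        finally show ?thesis .
      qed
      then have "normalizer c f g m n < x" unfolding normalizer_log_ratio
        using x by (intro real_less_lsqrt) auto
      moreover have "k \<le> m" "k \<le> n" using x mx nx by linarith+
      moreover have "m \<le> K" "n \<le> K" unfolding K_def using mx nx by (auto intro: le_nat_floor)
      ultimately show "p \<in> {(m, n) \<in> {k..K} \<times> {k..K}. normalizer c f g m n < x}" using p by auto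
    qed
    have fin: "finite {(m, n) \<in> {k..K} \<times> {k..K}. normalizer c f g m n < x}"
      by (rule finite_subset[of _ "{k..K} \<times> {k..K}"]) auto
    have "1 / (8 * D) * (x\<^sup>2 * (log_plus x * \<psi> x)) \<le> real (card S)"
    proof -
      have "log_plus x = ln x" using x by (simp add: log_plus_def ln_ge_iff)
      then have "1 / (8 * D) * (x\<^sup>2 * (log_plus x * \<psi> x)) = T / 2 * (ln x / 4)" by (simp add: T_def)
      also have "\<dots> \<le> T / 2 * (ln (real (Suc b)) - ln (real a))"
      proof (intro mult_left_mono)
        have "ln x / 4 \<le> ln (x / (sqrt x + 1))" by (rule x)
        also have "\<dots> \<le> ln (real (Suc b) / real a)"
        proof (intro ln_mono frac_le)
          show "0 < x / (sqrt x + 1)" using x sx by (intro divide_pos_pos) auto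
        qed (use a a1 b x in auto)
        also have "\<dots> = ln (real (Suc b)) - ln (real a)" using a1 by (simp add: ln_div)
        finally show "ln x / 4 \<le> ln (real (Suc b)) - ln (real a)" .
      qed (use T0 in simp)
      also have "\<dots> \<le> T / 2 * (\<Sum>m=a..b. 1 / real m)"
      proof (intro mult_left_mono sum_inverse_ge)
        have "real a < real (Suc b)" using a b x by simp
        then show "a \<le> Suc b" by simp
      qed (use a1 T0 in auto)
      also have "\<dots> = (\<Sum>m=a..b. T / real m / 2)" by (simp add: sum_distrib_left mult.commute)
      also have "\<dots> \<le> (\<Sum>m=a..b. real (card {a..nat \<lfloor>T / real m\<rfloor>}))"
      proof (rule sum_mono)
        fix m assume "m \<in> {a..b}"
        then have "2 * (sqrt x + 1) \<le> T / real m" by (intro Tm) auto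
        moreover define R where "R = T / real m"
        ultimately have t: "2 * sqrt x + 2 \<le> R" by simp
        define N where "N = nat \<lfloor>R\<rfloor>"
        have "R < real N + 1" unfolding N_def by linarith
        moreover have "real N + 1 - real a \<le> real (card {a..N})" by simp
        ultimately have "R / 2 \<le> real (card {a..N})" using t a by linarith
        then show "T / real m / 2 \<le> real (card {a..nat \<lfloor>T / real m\<rfloor>})" by (simp only: N_def R_def)
      qed
      also have "\<dots> = real (card S)"
      proof -
        have "card S = (\<Sum>m=a..b. card {a..nat \<lfloor>T / real m\<rfloor>})" unfolding S_def by (rule card_SigmaI) auto
        then show ?thesis by (simp only: of_nat_sum)
      qed
      finally show ?thesis .
    qed
    also have "\<dots> \<le> real (card {(m, n) \<in> {k..K} \<times> {k..K}. normalizer c f g m n < x})"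
      using card_mono[OF fin S_sub] by simp
    finally show "\<exists>K. 1 / (8 * D) * (x\<^sup>2 * (log_plus x * \<psi> x)) \<le> real (card {(m, n) \<in> {k..K} \<times> {k..K}. normalizer c f g m n < x})" by blast
  qed simp
qed

text \<open>
  The converse of the previous bound: the numbers of pairs in growing boxes increase, so
  their expectations, bounded by \<open>B\<close>, pass to the supremum by monotone convergence, and
  the supremum dominates a multiple of the moment function where \<open>\<bar>X\<bar>\<close> is large.
\<close>

lemma (in prob_space) integrable_of_sum_prob_exceeds:
  fixes X :: "'a \<Rightarrow> real"
  assumes \<psi>: "moment_rate f g \<psi>" and c: "0 < c"
    and X [measurable]: "X \<in> borel_measurable M"
    and B: "\<And>F. finite F \<Longrightarrow> F \<subseteq> {k..} \<times> {k..} \<Longrightarrow>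
      (\<Sum>(m, n)\<in>F. \<P>(\<omega> in M. normalizer c f g m n < \<bar>X \<omega>\<bar>)) \<le> B"
  shows "integrable M (\<lambda>\<omega>. (X \<omega>)\<^sup>2 * (log_plus \<bar>X \<omega>\<bar> * \<psi> \<bar>X \<omega>\<bar>))"
proof -
  obtain C0 where C0: "0 < C0" "\<And>x. 0 \<le> x \<Longrightarrow> \<psi> x \<le> C0 * max 1 x" using \<psi> by (auto simp: moment_rate_def)
  have \<psi>1: "1 \<le> \<psi> x" for x using \<psi> by (auto simp: moment_rate_def)
  have [measurable]: "\<psi> \<in> borel_measurable borel" using \<psi> by (auto simp: moment_rate_def)
  obtain c1 x0 where c1: "0 < c1" "1 \<le> x0"
    "\<And>x. x0 \<le> x \<Longrightarrow> \<exists>K. c1 * (x\<^sup>2 * (log_plus x * \<psi> x)) \<le> real (card {(m, n) \<in> {k..K} \<times> {k..K}. normalizer c f g m n < x})"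
    by (rule card_normalizer_less_lower[OF \<psi> c, of k]) (rule that, assumption+)
  define \<phi> where "\<phi> = (\<lambda>x::real. x\<^sup>2 * (log_plus x * \<psi> x))"
  define N where "N = (\<lambda>K \<omega>. real (card {(m, n) \<in> {k..K} \<times> {k..K}. normalizer c f g m n < \<bar>X \<omega>\<bar>}))"
  have N_int: "integrable M (N K)" "expectation (N K) \<le> B" for K
  proof -
    have fin: "finite ({k..K} \<times> {k..K})" by simp
    show "integrable M (N K)" unfolding N_def by (rule sum_prob_exceeds_eq(2)[OF X fin])
    show "expectation (N K) \<le> B" unfolding N_def sum_prob_exceeds_eq(1)[OF X fin, symmetric]
      by (rule B) auto
  qed
  have [measurable]: "N K \<in> borel_measurable M" for K using N_int(1) by (rule borel_measurable_integrable)
  have N_mono: "N K \<omega> \<le> N K' \<omega>" if "K \<le> K'" for K K' \<omega>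
  proof -
    have "finite {(m, n) \<in> {k..K'} \<times> {k..K'}. normalizer c f g m n < \<bar>X \<omega>\<bar>}"
      by (rule finite_subset[of _ "{k..K'} \<times> {k..K'}"]) auto
    then show ?thesis unfolding N_def using that by (intro of_nat_mono card_mono) auto
  qed
  have \<phi>0: "0 \<le> \<phi> x" for x unfolding \<phi>_def
    using log_plus_pos[of x] \<psi>1[of x] by (intro mult_nonneg_nonneg) auto
  define D where "D = x0\<^sup>2 * (x0 * (C0 * x0))"
  have D: "\<phi> x \<le> D" if "0 \<le> x" "x \<le> x0" for x
  proof -
    have "log_plus x \<le> x0"
    proof (cases "x = 0")
      case False
      then have "ln x \<le> x" using that ln_le_minus_one[of x] by simp
      then show ?thesis using that c1(2) by (simp add: log_plus_def)
    qed (use c1 in \<open>simp add: log_plus_def\<close>)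
    moreover have "max 1 x \<le> x0" using that c1(2) by simp
    then have "C0 * max 1 x \<le> C0 * x0" using C0(1) by (intro mult_left_mono) auto
    then have "\<psi> x \<le> C0 * x0" using C0(2)[OF that(1)] by linarith
    ultimately show ?thesis unfolding \<phi>_def D_def
      using that log_plus_pos[of x] \<psi>1[of x] c1 C0 by (intro mult_mono power_mono mult_nonneg_nonneg) auto
  qed
  have D0: "0 \<le> D" using D[of 0] \<phi>0[of 0] c1 by simp
  have pt: "ennreal (c1 * \<phi> \<bar>X \<omega>\<bar>) \<le> ennreal (c1 * D) + (SUP K. ennreal (N K \<omega>))" for \<omega>
  proof (cases "x0 \<le> \<bar>X \<omega>\<bar>")
    case True
    then obtain K where "c1 * \<phi> \<bar>X \<omega>\<bar> \<le> N K \<omega>" using c1(3) unfolding \<phi>_def N_def by blast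
    then have "ennreal (c1 * \<phi> \<bar>X \<omega>\<bar>) \<le> ennreal (N K \<omega>)" by (rule ennreal_leI)
    also have "\<dots> \<le> (SUP K. ennreal (N K \<omega>))" by (rule SUP_upper) simp
    finally show ?thesis by (simp add: add_increasing)
  next
    case False
    then have "c1 * \<phi> \<bar>X \<omega>\<bar> \<le> c1 * D" using D[of "\<bar>X \<omega>\<bar>"] c1 by (intro mult_left_mono) auto
    then have "ennreal (c1 * \<phi> \<bar>X \<omega>\<bar>) \<le> ennreal (c1 * D)" by (rule ennreal_leI)
    then show ?thesis by (simp add: add_increasing2)
  qed
  have "(\<integral>\<^sup>+\<omega>. ennreal (c1 * \<phi> \<bar>X \<omega>\<bar>) \<partial>M) \<le> (\<integral>\<^sup>+\<omega>. ennreal (c1 * D) + (SUP K. ennreal (N K \<omega>)) \<partial>M)"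
    by (intro nn_integral_mono pt)
  also have "\<dots> = ennreal (c1 * D) + (\<integral>\<^sup>+\<omega>. (SUP K. ennreal (N K \<omega>)) \<partial>M)"
    by (subst nn_integral_add) (auto simp: emeasure_space_1)
  finally have le: "(\<integral>\<^sup>+\<omega>. ennreal (c1 * \<phi> \<bar>X \<omega>\<bar>) \<partial>M) \<le> ennreal (c1 * D) + (\<integral>\<^sup>+\<omega>. (SUP K. ennreal (N K \<omega>)) \<partial>M)" .
  have "(\<integral>\<^sup>+\<omega>. (SUP K. ennreal (N K \<omega>)) \<partial>M) = (SUP K. \<integral>\<^sup>+\<omega>. ennreal (N K \<omega>) \<partial>M)"
    by (rule nn_integral_monotone_convergence_SUP) (auto simp: incseq_def le_fun_def intro!: ennreal_leI N_mono)
  also have "\<dots> \<le> ennreal B"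
  proof (rule SUP_least)
    fix K
    have "(\<integral>\<^sup>+\<omega>. ennreal (N K \<omega>) \<partial>M) = ennreal (expectation (N K))"
      by (rule nn_integral_eq_integral[OF N_int(1)]) (simp add: N_def)
    then show "(\<integral>\<^sup>+\<omega>. ennreal (N K \<omega>) \<partial>M) \<le> ennreal B" using N_int(2) by (simp add: ennreal_leI)
  qed
  finally have "ennreal (c1 * D) + (\<integral>\<^sup>+\<omega>. (SUP K. ennreal (N K \<omega>)) \<partial>M) \<le> ennreal (c1 * D) + ennreal B"
    by (rule add_left_mono)
  also have "\<dots> < \<infinity>" by simp
  finally have fin: "(\<integral>\<^sup>+\<omega>. ennreal (c1 * \<phi> \<bar>X \<omega>\<bar>) \<partial>M) < \<infinity>" using le by (rule le_less_trans[rotated])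
  have "integrable M (\<lambda>\<omega>. c1 * \<phi> \<bar>X \<omega>\<bar>)"
  proof (rule integrableI_nonneg)
    show "(\<lambda>\<omega>. c1 * \<phi> \<bar>X \<omega>\<bar>) \<in> borel_measurable M" unfolding \<phi>_def by measurable
    show "AE \<omega> in M. 0 \<le> c1 * \<phi> \<bar>X \<omega>\<bar>" using \<phi>0 c1 by (intro AE_I2 mult_nonneg_nonneg) auto
  qed (rule fin)
  then have "integrable M (\<lambda>\<omega>. \<phi> \<bar>X \<omega>\<bar>)" using c1 by simp
  then show ?thesis by (simp add: \<phi>_def)
qed

section \<open>Necessity of the moment condition\<close>

context iid_family
begin

lemma second_moment_centered_sum:
  assumes int: "integrable M (\<lambda>\<omega>. (X \<omega>)\<^sup>2)" and F: "finite F" "F \<subseteq> I"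
  shows "integrable M (\<lambda>\<omega>. (\<Sum>i\<in>F. Z i \<omega> - expectation X)\<^sup>2)"
    and "expectation (\<lambda>\<omega>. (\<Sum>i\<in>F. Z i \<omega> - expectation X)\<^sup>2) = card F * expectation (\<lambda>\<omega>. (X \<omega> - expectation X)\<^sup>2)"
proof -
  let ?\<mu> = "expectation X" and ?v = "expectation (\<lambda>\<omega>. (X \<omega> - expectation X)\<^sup>2)"
  define V where "V = (\<lambda>i \<omega>. Z i \<omega> - ?\<mu>)"
  have intX: "integrable M X" by (rule square_integrable_imp_integrable[OF X_measurable int])
  have intX2: "integrable M (\<lambda>\<omega>. (X \<omega> - ?\<mu>)\<^sup>2)"
    unfolding power2_diff by (intro Bochner_Integration.integrable_add Bochner_Integration.integrable_diff int integrable_const)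
      (use intX in \<open>simp add: mult.assoc\<close>)
  have V: "integrable M (V i)" "integrable M (\<lambda>\<omega>. (V i \<omega>)\<^sup>2)" "expectation (V i) = 0" "expectation (\<lambda>\<omega>. (V i \<omega>)\<^sup>2) = ?v" if "i \<in> I" for i
    using that intX intX2 integrable_Z_iff[of i "\<lambda>x. x - ?\<mu>"] integrable_Z_iff[of i "\<lambda>x. (x - ?\<mu>)\<^sup>2"]
      integral_Z[of i "\<lambda>x. x - ?\<mu>"] integral_Z[of i "\<lambda>x. (x - ?\<mu>)\<^sup>2"]
    by (auto simp: V_def prob_space)
  have ind: "indep_vars (\<lambda>_. borel) V I" unfolding V_def by (rule indep_vars_compose2[OF indep]) auto
  have "integrable M (\<lambda>\<omega>. (\<Sum>i\<in>F. V i \<omega>)\<^sup>2) \<and> expectation (\<lambda>\<omega>. (\<Sum>i\<in>F. V i \<omega>)\<^sup>2) = card F * ?v"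
    using F
  proof (induction F rule: finite_induct)
    case (insert i F)
    let ?S = "\<lambda>\<omega>. \<Sum>i\<in>F. V i \<omega>"
    have i: "i \<in> I" "F \<subseteq> I" using insert by auto
    have iv: "indep_var borel (V i) borel ?S"
      by (rule indep_vars_sum) (use insert indep_vars_subset[OF ind] in auto)
    have S: "integrable M ?S" "expectation ?S = 0"
      using V i by (auto simp: Bochner_Integration.integral_sum subset_iff)
    have IH: "integrable M (\<lambda>\<omega>. (?S \<omega>)\<^sup>2)" "expectation (\<lambda>\<omega>. (?S \<omega>)\<^sup>2) = card F * ?v" using insert by auto
    have P: "integrable M (\<lambda>\<omega>. V i \<omega> * ?S \<omega>)" "expectation (\<lambda>\<omega>. V i \<omega> * ?S \<omega>) = 0"
      using indep_var_integrable[OF iv V(1)[OF i(1)] S(1)] indep_var_lebesgue_integral[OF iv V(1)[OF i(1)] S(1)] S V[OF i(1)] by auto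
    have eq: "(\<Sum>i\<in>insert i F. V i \<omega>)\<^sup>2 = (V i \<omega>)\<^sup>2 + (?S \<omega>)\<^sup>2 + 2 * (V i \<omega> * ?S \<omega>)" for \<omega>
      using insert by (simp add: power2_sum mult.assoc)
    show ?case unfolding eq using V[OF i(1)] IH P insert by (simp add: algebra_simps)
  qed simp
  then show "integrable M (\<lambda>\<omega>. (\<Sum>i\<in>F. Z i \<omega> - expectation X)\<^sup>2)"
    "expectation (\<lambda>\<omega>. (\<Sum>i\<in>F. Z i \<omega> - expectation X)\<^sup>2) = card F * expectation (\<lambda>\<omega>. (X \<omega> - expectation X)\<^sup>2)"
    by (auto simp: V_def)
qed

lemma prob_sum_far_from_mean:
  assumes int: "integrable M (\<lambda>\<omega>. (X \<omega>)\<^sup>2)" and F: "finite F" "F \<subseteq> I" and a: "0 < a"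
  shows "\<P>(\<omega> in M. \<bar>(\<Sum>i\<in>F. Z i \<omega>) - card F * expectation X\<bar> \<ge> a)
     \<le> card F * expectation (\<lambda>\<omega>. (X \<omega> - expectation X)\<^sup>2) / a\<^sup>2"
proof -
  let ?S = "\<lambda>\<omega>. \<Sum>i\<in>F. Z i \<omega> - expectation X"
  have S: "?S \<omega> = (\<Sum>i\<in>F. Z i \<omega>) - card F * expectation X" for \<omega> by (simp add: sum_subtractf)
  have "\<P>(\<omega> in M. \<bar>(\<Sum>i\<in>F. Z i \<omega>) - card F * expectation X\<bar> \<ge> a) = prob {\<omega>\<in>space M. a\<^sup>2 \<le> (?S \<omega>)\<^sup>2}"
  proof (intro arg_cong[where f = prob] Collect_cong conj_cong refl)
    show "(a \<le> \<bar>(\<Sum>i\<in>F. Z i \<omega>) - card F * expectation X\<bar>) = (a\<^sup>2 \<le> (?S \<omega>)\<^sup>2)" for \<omega>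
      unfolding S using a abs_le_square_iff[of a "(\<Sum>i\<in>F. Z i \<omega>) - card F * expectation X"] by simp
  qed
  also have "\<dots> \<le> expectation (\<lambda>\<omega>. (?S \<omega>)\<^sup>2) / a\<^sup>2"
    by (rule integral_Markov_inequality_measure[where A = "{}"])
       (use second_moment_centered_sum(1)[OF int F] a in auto)
  finally show ?thesis unfolding second_moment_centered_sum(2)[OF int F] .
qed

lemma ex_small_tail:
  assumes "0 < \<epsilon>" obtains t where "0 < t" "\<P>(\<omega> in M. t < \<bar>X \<omega>\<bar>) < \<epsilon>"
proof -
  define A where "A = (\<lambda>n::nat. {\<omega>\<in>space M. real n < \<bar>X \<omega>\<bar>})"
  have "(\<lambda>n. prob (A n)) \<longlonglongrightarrow> prob (\<Inter>n. A n)"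
    by (rule finite_Lim_measure_decseq) (auto simp: A_def decseq_def)
  moreover have "(\<Inter>n. A n) = {}"
  proof -
    have "\<exists>n. \<not> real n < \<bar>X \<omega>\<bar>" for \<omega> using real_arch_simple[of "\<bar>X \<omega>\<bar>"] by (simp add: not_less)
    then show ?thesis unfolding A_def by blast
  qed
  ultimately have "(\<lambda>n. prob (A n)) \<longlonglongrightarrow> 0" by simp
  then have "\<forall>\<^sub>F n in sequentially. prob (A n) < \<epsilon>" by (rule order_tendstoD) (rule assms)
  then obtain N where N: "\<And>n. N \<le> n \<Longrightarrow> prob (A n) < \<epsilon>" by (auto simp: eventually_sequentially)
  show ?thesis by (rule that[of "real (Suc N)"]) (use N[of "Suc N"] in \<open>auto simp: A_def\<close>)
qed

end

lemma normalizer_large: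
  assumes f: "window_scale f" and g: "window_scale g" and c: "0 < c"
  shows "\<exists>k. \<forall>m\<ge>k. \<forall>n\<ge>k. t \<le> normalizer c f g m n"
proof -
  have "\<forall>\<^sub>F k::nat in sequentially. t\<^sup>2 \<le> c / 4 * real k" using c by real_asymp
  then obtain k0 where k0: "\<And>k. k0 \<le> k \<Longrightarrow> t\<^sup>2 \<le> c / 4 * real k" by (auto simp: eventually_sequentially)
  show ?thesis
  proof (intro exI[of _ "max 16 k0"] allI impI)
    fix m n assume mn: "max 16 k0 \<le> m" "max 16 k0 \<le> n"
    let ?k = "max 16 k0"
    have "real ?k * real ?k \<le> real m * real n" using mn by (intro mult_mono) auto
    then have "real ?k \<le> sqrt (real m * real n)" by (intro real_le_rsqrt) (simp add: power2_eq_square)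
    then have "c / 4 * real ?k \<le> c / 4 * sqrt (real m * real n)" using c by (intro mult_left_mono) auto
    also have "\<dots> \<le> c * (real m * real n) * log_ratio f g m n" by (rule normalizer_sq_ge) (use f g c mn in auto)
    finally have "t\<^sup>2 \<le> c * (real m * real n) * log_ratio f g m n" using k0[of ?k] by linarith
    then have "\<bar>t\<bar> \<le> normalizer c f g m n" unfolding normalizer_log_ratio by (intro real_le_rsqrt) simp
    then show "t \<le> normalizer c f g m n" by linarith
  qed
qed

context iid_array
begin

lemma window_sum_measurable: "1 \<le> m \<Longrightarrow> 1 \<le> n \<Longrightarrow> (\<lambda>\<omega>. \<Sum>c\<in>window f m \<times> window g n - J. Z c \<omega>) \<in> borel_measurable M"
  by (rule borel_measurable_sum) (auto simp: window_def)

text \<open>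
  The event of a finite limsup is covered by countably many events of uniform boundedness.
\<close>

lemma bounded_window_sums_of_finite_limsup:
  assumes f: "window_scale f" and g: "window_scale g" and c: "0 < c"
    and pos: "\<P>(\<omega> in M. limsup2 (\<lambda>m n. \<bar>\<Sum>p\<in>window f m \<times> window g n. Z p \<omega>\<bar> / normalizer c f g m n) < \<infinity>) > 0"
  obtains k :: nat and C :: real where "16 \<le> k" "0 < C"
    "0 < \<P>(\<omega> in M. \<forall>m\<ge>k. \<forall>n\<ge>k. \<bar>\<Sum>p\<in>window f m \<times> window g n. Z p \<omega>\<bar> \<le> C * normalizer c f g m n)"
proof -
  \<comment> \<open>A single index \<open>N\<close> serves as bound and as starting point.\<close>
  define T where "T = (\<lambda>m n \<omega>. \<bar>\<Sum>p\<in>window f m \<times> window g n. Z p \<omega>\<bar>)"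
  define A where "A = (\<lambda>N. {\<omega>\<in>space M. \<forall>m\<ge>max 16 N. \<forall>n\<ge>max 16 N. T m n \<omega> \<le> real (Suc N) * normalizer c f g m n})"
  have A_meas: "A N \<in> events" for N
  proof -
    have one: "{\<omega>\<in>space M. max 16 N \<le> m \<longrightarrow> max 16 N \<le> n \<longrightarrow> T m n \<omega> \<le> real (Suc N) * normalizer c f g m n} \<in> events" for m n
    proof (cases "max 16 N \<le> m \<and> max 16 N \<le> n")
      case True
      then have [measurable]: "(\<lambda>\<omega>. \<Sum>p\<in>window f m \<times> window g n. Z p \<omega>) \<in> borel_measurable M"
        using window_sum_measurable[of m n f g "{}"] by simp
      have "{\<omega>\<in>space M. T m n \<omega> \<le> real (Suc N) * normalizer c f g m n} \<in> events" unfolding T_def by measurable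
      then show ?thesis using True by (simp only: simp_thms)
    next
      case False
      then have "{\<omega>\<in>space M. max 16 N \<le> m \<longrightarrow> max 16 N \<le> n \<longrightarrow> T m n \<omega> \<le> real (Suc N) * normalizer c f g m n} = space M"
        by blast
      then show ?thesis by simp
    qed
    have "A N = {\<omega>\<in>space M. \<forall>m n. max 16 N \<le> m \<longrightarrow> max 16 N \<le> n \<longrightarrow> T m n \<omega> \<le> real (Suc N) * normalizer c f g m n}"
      unfolding A_def by blast
    also have "\<dots> \<in> events" by (intro sets.sets_Collect_countable_All one)
    finally show ?thesis .
  qed
  have sub: "{\<omega>\<in>space M. limsup2 (\<lambda>m n. T m n \<omega> / normalizer c f g m n) < \<infinity>} \<subseteq> (\<Union>N. A N)"
  proof safe
    fix \<omega> assume w: "\<omega> \<in> space M" "limsup2 (\<lambda>m n. T m n \<omega> / normalizer c f g m n) < \<infinity>"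
    then obtain k where k: "(SUP (m, n)\<in>{k..} \<times> {k..}. ereal (T m n \<omega> / normalizer c f g m n)) < \<infinity>"
      unfolding limsup2_eq_INF_SUP INF_less_iff by blast
    then have "(SUP (m, n)\<in>{k..} \<times> {k..}. ereal (T m n \<omega> / normalizer c f g m n)) \<noteq> \<infinity>" by simp
    then obtain C :: nat where C: "(SUP (m, n)\<in>{k..} \<times> {k..}. ereal (T m n \<omega> / normalizer c f g m n)) < ereal (real C)"
      unfolding less_PInf_Ex_of_nat by blast
    define N where "N = max k C"
    have "T m n \<omega> \<le> real (Suc N) * normalizer c f g m n" if mn: "max 16 N \<le> m" "max 16 N \<le> n" for m n
    proof -
      have "ereal (T m n \<omega> / normalizer c f g m n) \<le> (SUP (m, n)\<in>{k..} \<times> {k..}. ereal (T m n \<omega> / normalizer c f g m n))"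
        by (rule SUP_upper2[of "(m, n)"]) (use mn in \<open>auto simp: N_def\<close>)
      from le_less_trans[OF this C] have "T m n \<omega> / normalizer c f g m n \<le> real C" by simp
      moreover have "0 < normalizer c f g m n" by (rule normalizer_pos[OF f g c]) (use mn in auto)
      ultimately have "T m n \<omega> \<le> real C * normalizer c f g m n" by (simp add: divide_le_eq)
      also have "\<dots> \<le> real (Suc N) * normalizer c f g m n"
        using \<open>0 < normalizer c f g m n\<close> by (intro mult_right_mono) (auto simp: N_def)
      finally show ?thesis .
    qed
    then show "\<omega> \<in> (\<Union>N. A N)" using w by (auto simp: A_def)
  qed
  have "\<exists>N. 0 < prob (A N)"
  proof (rule ccontr)
    assume "\<nexists>N. 0 < prob (A N)"
    then have "prob (A N) = 0" for N using measure_nonneg[of M "A N"] by (meson antisym not_less)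
    then have "A N \<in> null_sets M" for N using A_meas by (auto simp: emeasure_eq_measure intro!: null_setsI)
    then have "(\<Union>N. A N) \<in> null_sets M" by (intro null_sets_UN)
    then have "prob (\<Union>N. A N) = 0" by (simp add: measure_eq_0_null_sets)
    moreover have "prob {\<omega>\<in>space M. limsup2 (\<lambda>m n. T m n \<omega> / normalizer c f g m n) < \<infinity>} \<le> prob (\<Union>N. A N)"
      by (rule finite_measure_mono[OF sub]) (use A_meas in auto)
    ultimately show False using pos by (simp add: T_def)
  qed
  then obtain N where "0 < prob (A N)" by blast
  then show ?thesis by (intro that[of "max 16 N" "real (Suc N)"]) (auto simp: A_def T_def)
qed

text \<open>
  A large entry at \<open>j\<close> makes the window sum at \<open>j\<close> large unless the rest of the window
  compensates it. The rest of the window at \<open>j\<close> only involves entries that come after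
  \<open>j\<close> lexicographically, so decompose according to the last pair \<open>j\<close> of \<open>F\<close> with a
  large entry (\<open>G\<close>) and a moderate rest (\<open>H\<close>): these events are disjoint, and the
  condition \<open>Q\<close> at \<open>j\<close> and at all later pairs is independent of the entry at \<open>j\<close>. On
  the event of bounded window sums \<open>Q\<close> holds whenever the entry at \<open>j\<close> is moderate:
  there \<open>H\<close> follows by the triangle inequality, and \<open>G\<close> together with \<open>H\<close> is
  impossible at every pair. Hence \<open>Q\<close> has probability at least \<open>a / 2\<close>.
\<close>

lemma sum_prob_large_entries_bounded:
  assumes f: "window_scale f" and g: "window_scale g" and c: "0 < c" and k: "16 \<le> k" and C: "0 < C"
    and A: "a = \<P>(\<omega> in M. \<forall>m\<ge>k. \<forall>n\<ge>k. \<bar>\<Sum>p\<in>window f m \<times> window g n. Z p \<omega>\<bar> \<le> C * normalizer c f g m n)" "0 < a"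
    and small: "\<And>m n. k' \<le> m \<Longrightarrow> k' \<le> n \<Longrightarrow> \<P>(\<omega> in M. normalizer c f g m n < \<bar>X \<omega>\<bar>) \<le> a / 2" and kk': "k \<le> k'"
    and F: "finite F" "F \<subseteq> {k'..} \<times> {k'..}"
  shows "(\<Sum>(m, n)\<in>F. \<P>(\<omega> in M. (2 * C + 1) * normalizer c f g m n < \<bar>X \<omega>\<bar>)) \<le> 2 / a"
proof -
  define W where "W = (\<lambda>j. window f (fst j) \<times> window g (snd j))"
  define b where "b = (\<lambda>j. normalizer c f g (fst j) (snd j))"
  define later where "later = (\<lambda>j::nat\<times>nat. {i \<in> {1..} \<times> {1..}. fst j < fst i \<or> fst i = fst j \<and> snd j < snd i})"
  define G where "G = (\<lambda>j v. (2 * C + 1) * b j < \<bar>v j :: real\<bar>)"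
  define H where "H = (\<lambda>j v. \<bar>\<Sum>p\<in>W j - {j}. v p\<bar> \<le> (C + 1) * b j)"
  define Q where "Q = (\<lambda>j v. H j v \<and> (\<forall>i\<in>F \<inter> later j. \<not> (G i v \<and> H i v)))"
  let ?I = "{1..} \<times> {1..} :: (nat \<times> nat) set"
  let ?v = "\<lambda>\<omega> p. Z p \<omega>"
  have F1: "16 \<le> fst j" "16 \<le> snd j" "k \<le> fst j" "k \<le> snd j" "k' \<le> fst j" "k' \<le> snd j" "j \<in> ?I" if "j \<in> F" for j
    using that F k kk' by force+
  have bpos: "0 < b j" if "j \<in> F" for j unfolding b_def by (rule normalizer_pos[OF f g c]) (use F1[OF that] in auto)
  have W_ge: "fst j \<le> fst p" "snd j \<le> snd p" if "p \<in> W j" for p j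
    using that by (auto simp: W_def window_def)
  have W_later: "W j - {j} \<subseteq> later j" if "j \<in> F" for j
  proof
    fix p assume p: "p \<in> W j - {j}"
    then have "fst p \<noteq> fst j \<or> snd p \<noteq> snd j" by (auto simp: prod_eq_iff)
    then show "p \<in> later j" using W_ge[of p j] p F1(1,2)[OF that] by (auto simp: later_def mem_Times_iff)
  qed
  have W_later': "W i - {i} \<subseteq> later j" if "i \<in> F" "i \<in> later j" for i j
  proof
    fix p assume "p \<in> W i - {i}"
    then show "p \<in> later j" using W_ge[of p i] that(2) F1(1,2)[OF that(1)] by (auto simp: later_def mem_Times_iff)
  qed
  have jW: "j \<in> W j" "finite (W j)" if "j \<in> F" for j
  proof -
    have "fst j \<le> window_end f (fst j)" "snd j \<le> window_end g (snd j)"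
      using window_scaleD(1)[OF f F1(1)[OF that]] window_scaleD(1)[OF g F1(2)[OF that]] by (intro window_end_ge; simp)+
    then show "j \<in> W j" by (cases j) (auto simp: W_def window_def)
  qed (simp add: W_def)
  have sum_meas: "(\<lambda>v. \<Sum>c\<in>A. v c) \<in> borel_measurable (PiM B (\<lambda>_. borel :: real measure))" if "A \<subseteq> B" for A B :: "(nat \<times> nat) set"
  proof -
    have "(\<lambda>v. \<Sum>c\<in>A. (\<lambda>c w. w c) c v) \<in> borel_measurable (PiM B (\<lambda>_. borel :: real measure))"
      by (rule borel_measurable_sum) (use that in \<open>auto intro!: measurable_component_singleton\<close>)
    then show ?thesis by simp
  qed
  have G_meas: "Measurable.pred (PiM B (\<lambda>_. borel)) (G j)" if "j \<in> B" for j B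
  proof -
    have [measurable]: "(\<lambda>v. v j :: real) \<in> borel_measurable (PiM B (\<lambda>_. borel))" using that by (rule measurable_component_singleton)
    show ?thesis unfolding G_def by measurable
  qed
  have H_meas: "Measurable.pred (PiM B (\<lambda>_. borel)) (H j)" if "W j - {j} \<subseteq> B" for j B
  proof -
    have [measurable]: "(\<lambda>v. \<Sum>p\<in>W j - {j}. v p :: real) \<in> borel_measurable (PiM B (\<lambda>_. borel))" using that by (rule sum_meas)
    show ?thesis unfolding H_def by measurable
  qed
  have Q_meas: "Measurable.pred (PiM (later j) (\<lambda>_. borel)) (Q j)" if "j \<in> F" for j
  proof -
    have [measurable]: "Measurable.pred (PiM (later j) (\<lambda>_. borel)) (G i)" "Measurable.pred (PiM (later j) (\<lambda>_. borel)) (H i)" if "i \<in> F \<inter> later j" for i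
      using that G_meas[of i "later j"] H_meas[OF W_later', of i j] by blast+
    have [measurable]: "Measurable.pred (PiM (later j) (\<lambda>_. borel)) (H j)" by (intro H_meas W_later that)
    have [simp]: "finite (F \<inter> later j)" using F by simp
    have "Measurable.pred (PiM (later j) (\<lambda>_. borel)) (\<lambda>v. \<forall>i\<in>F \<inter> later j. \<not> (G i v \<and> H i v))"
      by (rule pred_intros_finite) (auto intro!: pred_intros_logic)
    then show ?thesis unfolding Q_def by measurable
  qed
  have restr_H: "H i (\<lambda>p\<in>B. Z p \<omega>) = H i (?v \<omega>)" if "W i - {i} \<subseteq> B" for i B \<omega>
  proof -
    have "(\<Sum>p\<in>W i - {i}. (\<lambda>p\<in>B. Z p \<omega>) p) = (\<Sum>p\<in>W i - {i}. Z p \<omega>)" by (rule sum.cong) (use that in auto)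
    then show ?thesis by (simp add: H_def)
  qed
  have restr_Q: "Q j (\<lambda>p\<in>later j. Z p \<omega>) = Q j (?v \<omega>)" if "j \<in> F" for j \<omega>
    unfolding Q_def using restr_H[OF W_later[OF that]] restr_H[OF W_later'] by (auto simp: G_def)
  have restr_G: "G j (\<lambda>p\<in>{j}. Z p \<omega>) = G j (?v \<omega>)" for j \<omega> by (simp add: G_def)
  define E where "E = (\<lambda>j. {\<omega>\<in>space M. G j (?v \<omega>) \<and> Q j (?v \<omega>)})"
  have rv: "(\<lambda>\<omega>. \<lambda>p\<in>B. Z p \<omega>) \<in> measurable M (PiM B (\<lambda>_. borel))" if "B \<subseteq> ?I" for B
    by (rule measurable_restrict) (use that in auto)
  have later_I: "later j \<subseteq> ?I" for j by (auto simp: later_def)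
  have pQ [measurable]: "Measurable.pred M (\<lambda>\<omega>. Q j (?v \<omega>))" if "j \<in> F" for j
    using measurable_compose[OF rv[OF later_I] Q_meas[OF that]] by (simp add: restr_Q[OF that])
  have pG [measurable]: "Measurable.pred M (\<lambda>\<omega>. G j (?v \<omega>))" if "j \<in> F" for j
    using measurable_compose[OF rv G_meas[of j "{j}"]] F1[OF that] by (simp add: restr_G)
  have E_prob: "prob (E j) = \<P>(\<omega> in M. G j (?v \<omega>)) * \<P>(\<omega> in M. Q j (?v \<omega>))" if "j \<in> F" for j
  proof -
    have "\<P>(\<omega> in M. G j (\<lambda>p\<in>{j}. Z p \<omega>) \<and> Q j (\<lambda>p\<in>later j. Z p \<omega>)) = \<P>(\<omega> in M. G j (\<lambda>p\<in>{j}. Z p \<omega>)) * \<P>(\<omega> in M. Q j (\<lambda>p\<in>later j. Z p \<omega>))"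
      by (rule prob_disjoint_blocks[OF indep _ _ later_I G_meas Q_meas[OF that]]) (use F1[OF that] in \<open>auto simp: later_def\<close>)
    then show ?thesis unfolding E_def restr_Q[OF that] restr_G .
  qed
  have Q_prob: "a / 2 \<le> \<P>(\<omega> in M. Q j (?v \<omega>))" if j: "j \<in> F" for j
  proof -
    let ?A = "{\<omega>\<in>space M. \<forall>m\<ge>k. \<forall>n\<ge>k. \<bar>\<Sum>p\<in>window f m \<times> window g n. Z p \<omega>\<bar> \<le> C * normalizer c f g m n}"
    have split: "(\<Sum>p\<in>W i. Z p \<omega>) = Z i \<omega> + (\<Sum>p\<in>W i - {i}. Z p \<omega>)" if "i \<in> F" for i \<omega>
      using jW[OF that] by (simp add: sum.remove)
    have "?A \<subseteq> {\<omega>\<in>space M. Q j (?v \<omega>)} \<union> {\<omega>\<in>space M. b j < \<bar>Z j \<omega>\<bar>}"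
    proof (intro subsetI)
      fix \<omega> assume w: "\<omega> \<in> ?A"
      have T: "\<bar>Z i \<omega> + (\<Sum>p\<in>W i - {i}. Z p \<omega>)\<bar> \<le> C * b i" if "i \<in> F" for i
        using w F1[OF that] unfolding split[OF that, symmetric] by (auto simp: W_def b_def)
      show "\<omega> \<in> {\<omega>\<in>space M. Q j (?v \<omega>)} \<union> {\<omega>\<in>space M. b j < \<bar>Z j \<omega>\<bar>}"
      proof (cases "b j < \<bar>Z j \<omega>\<bar>")
        case False
        then have "\<bar>\<Sum>p\<in>W j - {j}. Z p \<omega>\<bar> \<le> C * b j + b j" using T[OF j] by linarith
        then have "H j (?v \<omega>)" by (simp add: H_def distrib_right)
        moreover have "\<not> (G i (?v \<omega>) \<and> H i (?v \<omega>))" if "i \<in> F" for i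
        proof
          assume GH: "G i (?v \<omega>) \<and> H i (?v \<omega>)"
          have "\<bar>Z i \<omega>\<bar> \<le> \<bar>Z i \<omega> + (\<Sum>p\<in>W i - {i}. Z p \<omega>)\<bar> + \<bar>\<Sum>p\<in>W i - {i}. Z p \<omega>\<bar>" by linarith
          also have "\<dots> \<le> C * b i + (C + 1) * b i" using T[OF that] GH by (intro add_mono) (auto simp: H_def)
          also have "\<dots> = (2 * C + 1) * b i" by (simp add: algebra_simps)
          finally show False using GH by (simp add: G_def)
        qed
        ultimately show ?thesis using w by (auto simp: Q_def)
      qed (use w in auto)
    qed
    then have "prob ?A \<le> prob ({\<omega>\<in>space M. Q j (?v \<omega>)} \<union> {\<omega>\<in>space M. b j < \<bar>Z j \<omega>\<bar>})"
      by (rule finite_measure_mono) (use pQ[OF j] F1(7)[OF j] in measurable)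
    also have "\<dots> \<le> \<P>(\<omega> in M. Q j (?v \<omega>)) + \<P>(\<omega> in M. b j < \<bar>Z j \<omega>\<bar>)"
      by (rule measure_Un_le) (use pQ[OF j] F1(7)[OF j] in measurable)
    also have "\<P>(\<omega> in M. b j < \<bar>Z j \<omega>\<bar>) = \<P>(\<omega> in M. b j < \<bar>X \<omega>\<bar>)"
      by (rule prob_Z[OF F1(7)[OF j]]) measurable
    also have "\<dots> \<le> a / 2" unfolding b_def by (rule small) (use F1[OF j] in auto)
    finally show ?thesis using A by simp
  qed
  have "disjoint_family_on E F"
    unfolding disjoint_family_on_def
  proof (intro ballI impI)
    fix i j assume ij: "i \<in> F" "j \<in> F" "i \<noteq> j"
    have "i \<in> later j \<or> j \<in> later i" using ij F1(7) unfolding later_def by (cases i; cases j) force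
    then show "E i \<inter> E j = {}" using ij by (auto simp: E_def Q_def)
  qed
  then have "(\<Sum>j\<in>F. prob (E j)) = prob (\<Union>j\<in>F. E j)"
    using F(1) by (intro finite_measure_finite_Union[symmetric]) (auto simp: E_def)
  then have E1: "(\<Sum>j\<in>F. prob (E j)) \<le> 1" by simp
  have "(\<Sum>j\<in>F. \<P>(\<omega> in M. (2 * C + 1) * b j < \<bar>X \<omega>\<bar>)) * (a / 2) = (\<Sum>j\<in>F. \<P>(\<omega> in M. G j (?v \<omega>)) * (a / 2))"
    unfolding sum_distrib_right G_def
    by (intro sum.cong refl arg_cong2[where f = "(*)"] prob_Z[symmetric] F1) auto
  also have "\<dots> \<le> (\<Sum>j\<in>F. prob (E j))"
  proof (rule sum_mono)
    fix j assume j: "j \<in> F"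
    show "\<P>(\<omega> in M. G j (?v \<omega>)) * (a / 2) \<le> prob (E j)"
      unfolding E_prob[OF j] by (rule mult_left_mono[OF Q_prob[OF j]]) simp
  qed
  finally have "(\<Sum>j\<in>F. \<P>(\<omega> in M. (2 * C + 1) * b j < \<bar>X \<omega>\<bar>)) * (a / 2) \<le> 1" using E1 by linarith
  then have "(\<Sum>j\<in>F. \<P>(\<omega> in M. (2 * C + 1) * b j < \<bar>X \<omega>\<bar>)) \<le> 2 / a" using A(2) by (simp add: field_simps)
  then show ?thesis by (simp add: b_def case_prod_unfold)
qed

text \<open>
  Boundedness with positive probability bounds the sum of the tail probabilities, hence the
  moment. A nonzero mean would make the window sums of the order of the area, which is much
  larger than the normalizer, with probability tending to 1 by Chebyshev's inequality.
\<close>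

theorem moment_of_finite_limsup:
  assumes f: "window_scale f" and g: "window_scale g" and c: "0 < c" and \<psi>: "moment_rate f g \<psi>"
    and pos: "\<P>(\<omega> in M. limsup2 (\<lambda>m n. \<bar>\<Sum>p\<in>window f m \<times> window g n. Z p \<omega>\<bar> / normalizer c f g m n) < \<infinity>) > 0"
  shows "integrable M (\<lambda>\<omega>. (X \<omega>)\<^sup>2 * (log_plus \<bar>X \<omega>\<bar> * \<psi> \<bar>X \<omega>\<bar>))" and "expectation X = 0"
proof -
  obtain k C where k: "16 \<le> k" and C: "0 < C"
    and A: "0 < \<P>(\<omega> in M. \<forall>m\<ge>k. \<forall>n\<ge>k. \<bar>\<Sum>p\<in>window f m \<times> window g n. Z p \<omega>\<bar> \<le> C * normalizer c f g m n)"
    by (rule bounded_window_sums_of_finite_limsup[OF f g c pos]) (rule that, assumption+)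
  define E where "E = {\<omega>\<in>space M. \<forall>m\<ge>k. \<forall>n\<ge>k. \<bar>\<Sum>p\<in>window f m \<times> window g n. Z p \<omega>\<bar> \<le> C * normalizer c f g m n}"
  define a where "a = prob E"
  have a: "0 < a" using A by (simp add: a_def E_def)
  obtain t where t: "\<P>(\<omega> in M. t < \<bar>X \<omega>\<bar>) < a / 2" using ex_small_tail[of "a / 2"] a by auto
  obtain k1 where k1: "\<And>m n. k1 \<le> m \<Longrightarrow> k1 \<le> n \<Longrightarrow> t \<le> normalizer c f g m n" using normalizer_large[OF f g c] by blast
  have small: "\<P>(\<omega> in M. normalizer c f g m n < \<bar>X \<omega>\<bar>) \<le> a / 2" if "max k k1 \<le> m" "max k k1 \<le> n" for m n
  proof -
    have "\<P>(\<omega> in M. normalizer c f g m n < \<bar>X \<omega>\<bar>) \<le> \<P>(\<omega> in M. t < \<bar>X \<omega>\<bar>)"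
      using k1[of m n] that by (intro finite_measure_mono) auto
    then show ?thesis using t by simp
  qed
  have bnd: "(\<Sum>(m, n)\<in>F. \<P>(\<omega> in M. normalizer ((2 * C + 1)\<^sup>2 * c) f g m n < \<bar>X \<omega>\<bar>)) \<le> 2 / a"
    if F: "finite F" "F \<subseteq> {max k k1..} \<times> {max k k1..}" for F
    using sum_prob_large_entries_bounded[OF f g c k C a_def[unfolded E_def] a small _ F] C
    by (simp add: normalizer_scale)
  have "0 < (2 * C + 1)\<^sup>2 * c" using C c by (intro mult_pos_pos zero_less_power) auto
  from integrable_of_sum_prob_exceeds[OF \<psi> this X_measurable bnd]
  show int: "integrable M (\<lambda>\<omega>. (X \<omega>)\<^sup>2 * (log_plus \<bar>X \<omega>\<bar> * \<psi> \<bar>X \<omega>\<bar>))" .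
  have \<psi>1: "1 \<le> \<psi> x" for x using \<psi> by (auto simp: moment_rate_def)
  have int2: "integrable M (\<lambda>\<omega>. (X \<omega>)\<^sup>2)"
  proof (rule Bochner_Integration.integrable_bound[OF int])
    show "AE \<omega> in M. norm ((X \<omega>)\<^sup>2) \<le> norm ((X \<omega>)\<^sup>2 * (log_plus \<bar>X \<omega>\<bar> * \<psi> \<bar>X \<omega>\<bar>))"
    proof (intro AE_I2)
      fix \<omega>
      have "1 * 1 \<le> log_plus \<bar>X \<omega>\<bar> * \<psi> \<bar>X \<omega>\<bar>" using log_plus_ge_1[of "\<bar>X \<omega>\<bar>"] \<psi>1[of "\<bar>X \<omega>\<bar>"] by (intro mult_mono) auto
      then have "(X \<omega>)\<^sup>2 * 1 \<le> (X \<omega>)\<^sup>2 * (log_plus \<bar>X \<omega>\<bar> * \<psi> \<bar>X \<omega>\<bar>)" by (intro mult_left_mono) auto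
      then show "norm ((X \<omega>)\<^sup>2) \<le> norm ((X \<omega>)\<^sup>2 * (log_plus \<bar>X \<omega>\<bar> * \<psi> \<bar>X \<omega>\<bar>))" by simp
    qed
  qed simp
  let ?\<mu> = "expectation X" and ?v = "expectation (\<lambda>\<omega>. (X \<omega> - expectation X)\<^sup>2)"
  show "expectation X = 0"
  proof (rule ccontr)
    assume \<mu>: "?\<mu> \<noteq> 0"
    have v: "0 \<le> ?v" by simp
    \<comment> \<open>The first condition makes the bound \<open>C * normalizer\<close> at most half of the modulus of the mean
      of the window sum, the second one makes Chebyshev's bound at most \<open>a / 2\<close>.\<close>
    have "\<forall>\<^sub>F n in sequentially. 8 * c * C\<^sup>2 / ?\<mu>\<^sup>2 * ln (ln (real n)) \<le> (real n / ln (real n))\<^sup>2"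
    proof -
      have "filterlim (\<lambda>n::nat. (real n / ln (real n))\<^sup>2 / ln (ln (real n))) at_top sequentially" by real_asymp
      then have "\<forall>\<^sub>F n in sequentially. 8 * c * C\<^sup>2 / ?\<mu>\<^sup>2 \<le> (real n / ln (real n))\<^sup>2 / ln (ln (real n))"
        unfolding filterlim_at_top by blast
      then show ?thesis using eventually_ge_at_top[of 16]
        by eventually_elim (use ln_ln_pos in \<open>simp only: pos_le_divide_eq\<close>)
    qed
    moreover have "\<forall>\<^sub>F n in sequentially. 8 * ?v / (a * ?\<mu>\<^sup>2) \<le> (real n / ln (real n))\<^sup>2"
    proof -
      have "filterlim (\<lambda>n::nat. (real n / ln (real n))\<^sup>2) at_top sequentially" by real_asymp
      then show ?thesis unfolding filterlim_at_top by blast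
    qed
    moreover have "\<forall>\<^sub>F n in sequentially. k \<le> n" by (rule eventually_ge_at_top)
    ultimately have "\<forall>\<^sub>F n in sequentially. 8 * c * C\<^sup>2 / ?\<mu>\<^sup>2 * ln (ln (real n)) \<le> (real n / ln (real n))\<^sup>2 \<and>
       8 * ?v / (a * ?\<mu>\<^sup>2) \<le> (real n / ln (real n))\<^sup>2 \<and> k \<le> n" by eventually_elim auto
    then obtain n where n: "8 * c * C\<^sup>2 / ?\<mu>\<^sup>2 * ln (ln (real n)) \<le> (real n / ln (real n))\<^sup>2"
       "8 * ?v / (a * ?\<mu>\<^sup>2) \<le> (real n / ln (real n))\<^sup>2" "k \<le> n" by (auto simp: eventually_sequentially)
    have n16: "16 \<le> n" using n k by simp
    define W where "W = window f n \<times> window g n"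
    define N where "N = real (card W)"
    define B where "B = real n / f n * (real n / g n)"
    have fn: "1 \<le> f n" "f n \<le> ln (real n)" "1 \<le> g n" "g n \<le> ln (real n)" using window_scaleD[OF f n16] window_scaleD[OF g n16] by auto
    have Bn: "(real n / ln (real n))\<^sup>2 \<le> B"
      unfolding B_def power2_eq_square using fn by (intro mult_mono divide_left_mono) auto
    have BN: "B \<le> N" unfolding B_def N_def W_def card_cartesian_product of_nat_mult
      using fn by (intro mult_mono card_window_ge f g n16) auto
    have B0: "0 < B" unfolding B_def using fn n16 by (intro mult_pos_pos divide_pos_pos) auto
    have WI: "finite W" "W \<subseteq> {1..} \<times> {1..}" using n16 window_subset[of n f] window_subset[of n g] by (auto simp: W_def)
    have \<mu>2: "0 < ?\<mu>\<^sup>2" using \<mu> by simp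
    have D_le: "C * normalizer c f g n n \<le> N * \<bar>?\<mu>\<bar> / 2"
    proof -
      have "8 * c * C\<^sup>2 * ln (ln (real n)) \<le> B * ?\<mu>\<^sup>2"
      proof -
        have "8 * c * C\<^sup>2 / ?\<mu>\<^sup>2 * ln (ln (real n)) \<le> B" using n(1) Bn by linarith
        then have "(8 * c * C\<^sup>2 / ?\<mu>\<^sup>2 * ln (ln (real n))) * ?\<mu>\<^sup>2 \<le> B * ?\<mu>\<^sup>2" using \<mu>2 by (intro mult_right_mono) auto
        then show ?thesis using \<mu> by simp
      qed
      then have "B * (8 * c * C\<^sup>2 * ln (ln (real n))) \<le> B * (B * ?\<mu>\<^sup>2)" using B0 by (intro mult_left_mono) auto
      then have "C\<^sup>2 * (c * B * (2 * ln (ln (real n)))) \<le> (B * \<bar>?\<mu>\<bar> / 2)\<^sup>2"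
        by (simp add: power_mult_distrib power_divide power2_eq_square[of B] mult_ac)
      moreover have "(C * normalizer c f g n n)\<^sup>2 = C\<^sup>2 * (c * B * (2 * ln (ln (real n))))"
      proof -
        have "normalizer c f g n n = sqrt (c * B * (2 * ln (ln (real n))))"
          using normalizer_area[of "c / 2" f g n n] by (simp add: B_def)
        moreover have "0 \<le> c * B * (2 * ln (ln (real n)))" using c B0 ln_ln_pos[OF n16] by (intro mult_nonneg_nonneg) auto
        ultimately show ?thesis by (simp add: power_mult_distrib)
      qed
      ultimately have "(C * normalizer c f g n n)\<^sup>2 \<le> (B * \<bar>?\<mu>\<bar> / 2)\<^sup>2" by simp
      then have "C * normalizer c f g n n \<le> B * \<bar>?\<mu>\<bar> / 2" by (rule power2_le_imp_le) (use B0 in simp)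
      also have "\<dots> \<le> N * \<bar>?\<mu>\<bar> / 2" using BN by (intro divide_right_mono mult_right_mono) auto
      finally show ?thesis .
    qed
    have N0: "0 < N" using B0 BN by linarith
    have "a \<le> \<P>(\<omega> in M. \<bar>(\<Sum>p\<in>W. Z p \<omega>) - card W * ?\<mu>\<bar> \<ge> N * \<bar>?\<mu>\<bar> / 2)"
      unfolding a_def
    proof (rule finite_measure_mono)
      show "E \<subseteq> {\<omega>\<in>space M. \<bar>(\<Sum>p\<in>W. Z p \<omega>) - card W * ?\<mu>\<bar> \<ge> N * \<bar>?\<mu>\<bar> / 2}"
      proof safe
        fix \<omega> assume "\<omega> \<in> E"
        then have "\<bar>\<Sum>p\<in>W. Z p \<omega>\<bar> \<le> C * normalizer c f g n n" using n(3) by (simp add: E_def W_def)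
        then have "\<bar>\<Sum>p\<in>W. Z p \<omega>\<bar> \<le> N * \<bar>?\<mu>\<bar> / 2" using D_le by (rule order_trans)
        moreover have "\<bar>N * ?\<mu>\<bar> = N * \<bar>?\<mu>\<bar>" using N0 by (simp add: abs_mult)
        ultimately show "N * \<bar>?\<mu>\<bar> / 2 \<le> \<bar>(\<Sum>p\<in>W. Z p \<omega>) - card W * ?\<mu>\<bar>" unfolding N_def by linarith
      qed (simp add: E_def)
      have "(\<lambda>\<omega>. \<Sum>p\<in>W. Z p \<omega>) \<in> borel_measurable M" by (rule borel_measurable_sum) (use WI in auto)
      then show "{\<omega>\<in>space M. \<bar>(\<Sum>p\<in>W. Z p \<omega>) - card W * ?\<mu>\<bar> \<ge> N * \<bar>?\<mu>\<bar> / 2} \<in> events" by measurable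
    qed
    also have "\<dots> \<le> card W * ?v / (N * \<bar>?\<mu>\<bar> / 2)\<^sup>2"
      by (rule prob_sum_far_from_mean[OF int2 WI]) (use N0 \<mu> in simp)
    also have "\<dots> = 4 * ?v / (N * ?\<mu>\<^sup>2)"
      unfolding N_def[symmetric] using N0 \<mu>2 by (simp add: power_mult_distrib power_divide power2_eq_square[of N])
    finally have "a * (N * ?\<mu>\<^sup>2) \<le> 4 * ?v" using N0 \<mu>2 by (simp add: le_divide_eq)
    moreover have "8 * ?v / (a * ?\<mu>\<^sup>2) \<le> N" using n(2) Bn BN by linarith
    then have "8 * ?v \<le> a * (N * ?\<mu>\<^sup>2)" using a \<mu>2 by (simp add: divide_le_eq mult_ac)
    moreover have "0 < a * (N * ?\<mu>\<^sup>2)" using a N0 \<mu>2 by simp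
    ultimately show False using v by linarith
  qed
qed

end

section \<open>The moment functions of the three cases\<close>

lemma log_plus_le_max: "0 \<le> x \<Longrightarrow> log_plus x \<le> max 1 x"
  using ln_le_minus_one[of x] by (cases "x = 0") (auto simp: log_plus_def)

lemma log_plus_sq_le: "0 \<le> x \<Longrightarrow> (log_plus x)\<^sup>2 \<le> 4 * max 1 x"
proof (cases "1 \<le> ln x")
  case True
  assume "0 \<le> x"
  then have x: "0 < x" using True by (cases "x = 0") auto
  have "(ln x)\<^sup>2 \<le> (2 * sqrt x)\<^sup>2"
  proof (rule power_mono)
    show "0 \<le> ln x" using True by linarith
  qed (rule ln_le_two_sqrt[OF x])
  also have "\<dots> = 4 * x" using x by (simp add: power_mult_distrib)
  finally show ?thesis using True by (simp add: log_plus_def)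
qed (simp add: log_plus_def)

lemma log_plus_log_plus_le: "log_plus (log_plus x) \<le> log_plus x"
proof -
  have "log_plus (log_plus x) \<le> max 1 (log_plus x)" using log_plus_pos[of x] by (intro log_plus_le_max) simp
  then show ?thesis using log_plus_ge_1[of x] by simp
qed

lemma ln_index_le_log_plus:
  assumes K: "1 \<le> K" and x: "1 \<le> x" and mn: "16 \<le> m" "16 \<le> n" "real m * real n \<le> K * x ^ 4"
  shows "ln (real m) \<le> (ln K + 4) * log_plus x" "ln (real n) \<le> (ln K + 4) * log_plus x"
proof -
  have *: "ln (real m) \<le> (ln K + 4) * log_plus x" if "16 \<le> m" "16 \<le> n" "real m * real n \<le> K * x ^ 4" for m n :: nat
  proof -
    have "real m * 1 \<le> real m * real n" using that by (intro mult_left_mono) auto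
    then have "real m \<le> K * x ^ 4" using that by linarith
    then have "ln (real m) \<le> ln (K * x ^ 4)" using that by (intro ln_mono) auto
    also have "\<dots> = ln K + 4 * ln x" using K x by (simp add: ln_mult ln_realpow)
    also have "\<dots> \<le> ln K * log_plus x + 4 * log_plus x"
    proof (intro add_mono)
      have "ln K * 1 \<le> ln K * log_plus x" using K log_plus_ge_1[of x] by (intro mult_left_mono) auto
      then show "ln K \<le> ln K * log_plus x" by simp
    qed (simp add: log_plus_def)
    finally show ?thesis by (simp add: algebra_simps)
  qed
  show "ln (real m) \<le> (ln K + 4) * log_plus x" by (rule *[OF mn])
  show "ln (real n) \<le> (ln K + 4) * log_plus x" by (rule *[OF mn(2,1)]) (use mn(3) in \<open>simp add: mult.commute\<close>)
qed

text \<open>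
  For indices between \<open>sqrt x\<close> and \<open>x ^ 4\<close> the logarithms and iterated logarithms agree
  with those of \<open>x\<close> up to constant factors.
\<close>

lemma ln_index_in_range:
  assumes x: "exp 16 \<le> x" and m: "sqrt x \<le> real m" "real m \<le> x ^ 4"
  shows "ln x / 2 \<le> ln (real m)" "ln (real m) \<le> 4 * ln x"
    "ln (ln x) / 2 \<le> ln (ln (real m))" "ln (ln (real m)) \<le> 2 * ln (ln x)"
    "16 \<le> ln x" "1 \<le> ln (ln x)" "log_plus x = ln x" "log_plus (log_plus x) = ln (ln x)"
proof -
  have x0: "0 < x" by (rule less_le_trans[OF _ x]) simp
  show l: "16 \<le> ln x" using x x0 by (simp add: ln_ge_iff)
  have "exp 1 \<le> ln x" using l e_less_272 by linarith
  then show ll: "1 \<le> ln (ln x)" using l by (simp add: ln_ge_iff)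
  show lx: "log_plus x = ln x" using l by (simp add: log_plus_def)
  show "log_plus (log_plus x) = ln (ln x)" unfolding lx using ll by (simp add: log_plus_def)
  have m0: "0 < real m" by (rule less_le_trans[OF _ m(1)]) (use x0 in simp)
  have "ln (sqrt x) \<le> ln (real m)" using m x0 by (intro ln_mono) auto
  then show a: "ln x / 2 \<le> ln (real m)" using x0 by (simp add: ln_sqrt)
  have "ln (real m) \<le> ln (x ^ 4)" using m m0 by (intro ln_mono)
  then show b: "ln (real m) \<le> 4 * ln x" using x0 by (simp add: ln_realpow)
  have "4 \<le> sqrt (ln x)" using l by (intro real_le_rsqrt) simp
  then have "sqrt (ln x) * 2 \<le> sqrt (ln x) * sqrt (ln x)" using l by (intro mult_left_mono) auto
  then have "sqrt (ln x) \<le> ln x / 2" using l by simp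
  then have "sqrt (ln x) \<le> ln (real m)" using a by linarith
  then have "ln (sqrt (ln x)) \<le> ln (ln (real m))" using l by (intro ln_mono) auto
  then show "ln (ln x) / 2 \<le> ln (ln (real m))" using l by (simp add: ln_sqrt)
  have "4 * ln x \<le> ln x * ln x" using l by (intro mult_right_mono) auto
  then have "ln (ln (real m)) \<le> ln (ln x * ln x)" using a b l by (intro ln_mono) linarith+
  then show "ln (ln (real m)) \<le> 2 * ln (ln x)" using l by (simp add: ln_mult)
qed

text \<open>
  Here \<open>log_ratio\<close> is \<open>ln p / p\<close> with \<open>p = ln m * ln n\<close>, a decreasing function of
  \<open>p\<close>, and \<open>p\<close> is at most of order \<open>(ln x)\<^sup>2\<close>.
\<close>

lemma moment_rate_ln_ln: "moment_rate (\<lambda>m. ln (real m)) (\<lambda>n. ln (real n)) (\<lambda>x. (log_plus x)\<^sup>2 / log_plus (log_plus x))"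
  unfolding moment_rate_def
proof (intro conjI allI impI)
  show "(\<lambda>x. (log_plus x)\<^sup>2 / log_plus (log_plus x)) \<in> borel_measurable borel" by measurable
  show "1 \<le> (log_plus x)\<^sup>2 / log_plus (log_plus x)" for x
  proof -
    have "log_plus (log_plus x) * 1 \<le> log_plus x * log_plus x"
      using log_plus_log_plus_le[of x] log_plus_ge_1[of x] by (intro mult_mono) auto
    then show ?thesis using log_plus_pos[of "log_plus x"] by (simp add: le_divide_eq power2_eq_square)
  qed
  show "\<exists>C>0. \<forall>x\<ge>0. (log_plus x)\<^sup>2 / log_plus (log_plus x) \<le> C * max 1 x"
  proof (intro exI[of _ 4] conjI allI impI)
    fix x :: real assume "0 \<le> x"
    have "(log_plus x)\<^sup>2 / log_plus (log_plus x) \<le> (log_plus x)\<^sup>2 / 1"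
      using log_plus_ge_1 by (intro divide_left_mono) (auto simp: log_plus_pos)
    then show "(log_plus x)\<^sup>2 / log_plus (log_plus x) \<le> 4 * max 1 x" using log_plus_sq_le[OF \<open>0 \<le> x\<close>] by simp
  qed simp
  fix K :: real assume K: "1 \<le> K"
  let ?K = "ln K + 4"
  have K4: "4 \<le> ?K" using K by simp
  show "\<exists>c>0. \<forall>x\<ge>1. \<forall>m\<ge>16. \<forall>n\<ge>16. real m * real n \<le> K * x ^ 4 \<longrightarrow>
     c \<le> (log_plus x)\<^sup>2 / log_plus (log_plus x) * log_ratio (\<lambda>m. ln (real m)) (\<lambda>n. ln (real n)) m n"
  proof (intro exI[of _ "1 / ?K\<^sup>2"] conjI allI impI)
    show "0 < 1 / ?K\<^sup>2" using K4 by (intro divide_pos_pos zero_less_power) auto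
    fix x :: real and m n :: nat
    assume a: "1 \<le> x" "16 \<le> m" "16 \<le> n" "real m * real n \<le> K * x ^ 4"
    define l where "l = log_plus x"
    have l: "1 \<le> l" by (simp add: l_def log_plus_ge_1)
    let ?u = "ln (real m)" and ?v = "ln (real n)"
    define p where "p = ?u * ?v"
    define q where "q = (?K * l)\<^sup>2"
    have uv: "2 < ?u" "2 < ?v" "?u \<le> ?K * l" "?v \<le> ?K * l"
      using ln_gt_2 ln_index_le_log_plus[OF K a] a by (auto simp: l_def)
    have "2 * 2 \<le> p" unfolding p_def using uv by (intro mult_mono) auto
    then have p: "exp 1 \<le> p" using e_less_272 by simp
    have pq: "p \<le> q" unfolding p_def q_def power2_eq_square using uv by (intro mult_mono) auto
    have q0: "0 < q" using p pq exp_gt_zero[of 1] by linarith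
    have "ln q = 2 * ln ?K + 2 * ln l" unfolding q_def using l K4 by (simp add: ln_mult ln_realpow)
    moreover have "1 \<le> ln ?K" using K4 e_less_272 by (subst ln_ge_iff) auto
    moreover have "0 \<le> ln l" using l by simp
    ultimately have lq: "log_plus l \<le> ln q" by (simp add: log_plus_def)
    have "log_plus l / q \<le> ln q / q" using lq q0 by (intro divide_right_mono) auto
    also have "\<dots> \<le> ln p / p" by (rule ln_x_over_x_mono[OF p pq])
    also have "ln p / p = log_ratio (\<lambda>m. ln (real m)) (\<lambda>n. ln (real n)) m n"
      using uv by (simp add: log_ratio_def p_def ln_mult)
    finally have "l\<^sup>2 / log_plus l * (log_plus l / q) \<le> l\<^sup>2 / log_plus l * log_ratio (\<lambda>m. ln (real m)) (\<lambda>n. ln (real n)) m n"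
      using log_plus_pos[of l] by (intro mult_left_mono) auto
    moreover have "l\<^sup>2 / log_plus l * (log_plus l / q) = 1 / ?K\<^sup>2"
      using log_plus_pos[of l] l unfolding q_def power_mult_distrib by simp
    ultimately show "1 / ?K\<^sup>2 \<le> (log_plus x)\<^sup>2 / log_plus (log_plus x) * log_ratio (\<lambda>m. ln (real m)) (\<lambda>n. ln (real n)) m n"
      by (simp only: l_def)
  qed
next
  show "\<exists>C>0. \<exists>x0. \<forall>x\<ge>x0. \<forall>m n. sqrt x \<le> real m \<longrightarrow> real m \<le> x ^ 4 \<longrightarrow> sqrt x \<le> real n \<longrightarrow> real n \<le> x ^ 4 \<longrightarrow>
     (log_plus x)\<^sup>2 / log_plus (log_plus x) * log_ratio (\<lambda>m. ln (real m)) (\<lambda>n. ln (real n)) m n \<le> C"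
  proof (rule exI[of _ 16], rule conjI, simp, rule exI[of _ "exp 16"], intro allI impI)
    fix x :: real and m n :: nat
    assume x: "exp 16 \<le> x" and m: "sqrt x \<le> real m" "real m \<le> x ^ 4" and n: "sqrt x \<le> real n" "real n \<le> x ^ 4"
    note M = ln_index_in_range[OF x m] and N = ln_index_in_range[OF x n]
    have "log_ratio (\<lambda>m. ln (real m)) (\<lambda>n. ln (real n)) m n \<le> (2 * ln (ln x) + 2 * ln (ln x)) / (ln x / 2 * (ln x / 2))"
      unfolding log_ratio_def by (intro frac_le add_mono mult_mono) (use M N in linarith | use M in simp)+
    then have "(ln x)\<^sup>2 / ln (ln x) * log_ratio (\<lambda>m. ln (real m)) (\<lambda>n. ln (real n)) m n
       \<le> (ln x)\<^sup>2 / ln (ln x) * ((2 * ln (ln x) + 2 * ln (ln x)) / (ln x / 2 * (ln x / 2)))"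
      using M by (intro mult_left_mono) auto
    also have "\<dots> = 16" using M(5,6) by (simp add: power2_eq_square)
    finally show "(log_plus x)\<^sup>2 / log_plus (log_plus x) * log_ratio (\<lambda>m. ln (real m)) (\<lambda>n. ln (real n)) m n \<le> 16"
      by (simp only: M(7) M(8)[unfolded M(7)])
  qed
qed

text \<open>
  Here \<open>log_ratio\<close> is \<open>1 / ln (ln m) + 1 / ln (ln n)\<close>.
\<close>

lemma moment_rate_lnln_lnln: "moment_rate (\<lambda>m. ln (ln (real m))) (\<lambda>n. ln (ln (real n))) (\<lambda>x. log_plus (log_plus x))"
  unfolding moment_rate_def
proof (intro conjI allI impI)
  show "(\<lambda>x. log_plus (log_plus x)) \<in> borel_measurable borel" by measurable
  show "1 \<le> log_plus (log_plus x)" for x by (rule log_plus_ge_1)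
  show "\<exists>C>0. \<forall>x\<ge>0. log_plus (log_plus x) \<le> C * max 1 x"
    using order_trans[OF log_plus_log_plus_le log_plus_le_max] by (intro exI[of _ 1]) simp
  fix K :: real assume K: "1 \<le> K"
  let ?K = "ln K + 4"
  have K4: "4 \<le> ?K" using K by simp
  show "\<exists>c>0. \<forall>x\<ge>1. \<forall>m\<ge>16. \<forall>n\<ge>16. real m * real n \<le> K * x ^ 4 \<longrightarrow>
     c \<le> log_plus (log_plus x) * log_ratio (\<lambda>m. ln (ln (real m))) (\<lambda>n. ln (ln (real n))) m n"
  proof (intro exI[of _ "1 / (ln ?K + 1)"] conjI allI impI)
    have lK: "0 < ln ?K" using K4 by (intro ln_gt_zero) simp
    then show "0 < 1 / (ln ?K + 1)" by simp
    fix x :: real and m n :: nat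
    assume a: "1 \<le> x" "16 \<le> m" "16 \<le> n" "real m * real n \<le> K * x ^ 4"
    define l where "l = log_plus x"
    have l: "1 \<le> l" by (simp add: l_def log_plus_ge_1)
    let ?A = "ln (ln (real m))" and ?B = "ln (ln (real n))"
    have AB: "0 < ?A" "0 < ?B" using ln_ln_pos a by auto
    have "2 < ln (real m)" "ln (real m) \<le> ?K * l"
      using ln_gt_2 ln_index_le_log_plus[OF K a] a by (auto simp: l_def)
    then have "?A \<le> ln (?K * l)" by (intro ln_mono) auto
    also have "\<dots> = ln ?K + ln l" using K4 l by (simp add: ln_mult)
    also have "\<dots> \<le> ln ?K * log_plus l + 1 * log_plus l"
    proof (intro add_mono)
      have "ln ?K * 1 \<le> ln ?K * log_plus l" using lK log_plus_ge_1[of l] by (intro mult_left_mono) auto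
      then show "ln ?K \<le> ln ?K * log_plus l" by simp
    qed (simp add: log_plus_def)
    finally have A: "?A \<le> (ln ?K + 1) * log_plus l" by (simp add: distrib_right)
    have "1 / ((ln ?K + 1) * log_plus l) \<le> 1 / ?A" using A AB by (intro divide_left_mono) (auto intro!: mult_pos_pos add_pos_pos lK log_plus_pos)
    also have "1 / ?A \<le> (?A + ?B) / (?A * ?B)" using AB by (simp add: field_simps)
    finally have "log_plus l * (1 / ((ln ?K + 1) * log_plus l)) \<le> log_plus l * log_ratio (\<lambda>m. ln (ln (real m))) (\<lambda>n. ln (ln (real n))) m n"
      unfolding log_ratio_def using log_plus_pos[of l] by (intro mult_left_mono) auto
    moreover have "log_plus l * (1 / ((ln ?K + 1) * log_plus l)) = 1 / (ln ?K + 1)" using log_plus_pos[of l] by simp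
    ultimately show "1 / (ln ?K + 1) \<le> log_plus (log_plus x) * log_ratio (\<lambda>m. ln (ln (real m))) (\<lambda>n. ln (ln (real n))) m n"
      by (simp only: l_def)
  qed
next
  show "\<exists>C>0. \<exists>x0. \<forall>x\<ge>x0. \<forall>m n. sqrt x \<le> real m \<longrightarrow> real m \<le> x ^ 4 \<longrightarrow> sqrt x \<le> real n \<longrightarrow> real n \<le> x ^ 4 \<longrightarrow>
     log_plus (log_plus x) * log_ratio (\<lambda>m. ln (ln (real m))) (\<lambda>n. ln (ln (real n))) m n \<le> C"
  proof (rule exI[of _ 16], rule conjI, simp, rule exI[of _ "exp 16"], intro allI impI)
    fix x :: real and m n :: nat
    assume x: "exp 16 \<le> x" and m: "sqrt x \<le> real m" "real m \<le> x ^ 4" and n: "sqrt x \<le> real n" "real n \<le> x ^ 4"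
    note M = ln_index_in_range[OF x m] and N = ln_index_in_range[OF x n]
    have "log_ratio (\<lambda>m. ln (ln (real m))) (\<lambda>n. ln (ln (real n))) m n \<le> (2 * ln (ln x) + 2 * ln (ln x)) / (ln (ln x) / 2 * (ln (ln x) / 2))"
      unfolding log_ratio_def by (intro frac_le add_mono mult_mono) (use M N in linarith | use M in simp)+
    then have "ln (ln x) * log_ratio (\<lambda>m. ln (ln (real m))) (\<lambda>n. ln (ln (real n))) m n
       \<le> ln (ln x) * ((2 * ln (ln x) + 2 * ln (ln x)) / (ln (ln x) / 2 * (ln (ln x) / 2)))"
      using M by (intro mult_left_mono) auto
    also have "\<dots> = 16" using M(5,6) by simp
    finally show "log_plus (log_plus x) * log_ratio (\<lambda>m. ln (ln (real m))) (\<lambda>n. ln (ln (real n))) m n \<le> 16"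
      by (simp only: M(7) M(8)[unfolded M(7)])
  qed
qed

text \<open>
  The summand \<open>ln (ln n)\<close> of the numerator alone gives \<open>1 / ln m\<close>, and the other one
  adds no more than a constant multiple of this when all iterated logarithms are comparable.
\<close>

lemma moment_rate_ln_lnln: "moment_rate (\<lambda>m. ln (real m)) (\<lambda>n. ln (ln (real n))) log_plus"
  unfolding moment_rate_def
proof (intro conjI allI impI)
  show "log_plus \<in> borel_measurable borel" by measurable
  show "1 \<le> log_plus x" for x by (rule log_plus_ge_1)
  show "\<exists>C>0. \<forall>x\<ge>0. log_plus x \<le> C * max 1 x"
    using log_plus_le_max by (intro exI[of _ 1]) simp
  fix K :: real assume K: "1 \<le> K"
  let ?K = "ln K + 4"
  have K4: "4 \<le> ?K" using K by simp
  show "\<exists>c>0. \<forall>x\<ge>1. \<forall>m\<ge>16. \<forall>n\<ge>16. real m * real n \<le> K * x ^ 4 \<longrightarrow>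
     c \<le> log_plus x * log_ratio (\<lambda>m. ln (real m)) (\<lambda>n. ln (ln (real n))) m n"
  proof (intro exI[of _ "1 / ?K"] conjI allI impI)
    show "0 < 1 / ?K" using K4 by simp
    fix x :: real and m n :: nat
    assume a: "1 \<le> x" "16 \<le> m" "16 \<le> n" "real m * real n \<le> K * x ^ 4"
    define l where "l = log_plus x"
    have l: "1 \<le> l" by (simp add: l_def log_plus_ge_1)
    let ?u = "ln (real m)" and ?A = "ln (ln (real m))" and ?B = "ln (ln (real n))"
    have AB: "0 < ?A" "0 < ?B" using ln_ln_pos a by auto
    have u: "2 < ?u" "?u \<le> ?K * l"
      using ln_gt_2 ln_index_le_log_plus[OF K a] a by (auto simp: l_def)
    have "1 / (?K * l) \<le> 1 / ?u" using u by (intro divide_left_mono) (auto intro!: mult_pos_pos)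
    also have "1 / ?u = ?B / (?u * ?B)" using AB by simp
    also have "\<dots> \<le> (?A + ?B) / (?u * ?B)" using AB u by (intro divide_right_mono mult_nonneg_nonneg) auto
    finally have "l * (1 / (?K * l)) \<le> l * log_ratio (\<lambda>m. ln (real m)) (\<lambda>n. ln (ln (real n))) m n"
      unfolding log_ratio_def using l by (intro mult_left_mono) auto
    moreover have "l * (1 / (?K * l)) = 1 / ?K" using l by simp
    ultimately show "1 / ?K \<le> log_plus x * log_ratio (\<lambda>m. ln (real m)) (\<lambda>n. ln (ln (real n))) m n"
      by (simp only: l_def)
  qed
next
  show "\<exists>C>0. \<exists>x0. \<forall>x\<ge>x0. \<forall>m n. sqrt x \<le> real m \<longrightarrow> real m \<le> x ^ 4 \<longrightarrow> sqrt x \<le> real n \<longrightarrow> real n \<le> x ^ 4 \<longrightarrow>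
     log_plus x * log_ratio (\<lambda>m. ln (real m)) (\<lambda>n. ln (ln (real n))) m n \<le> C"
  proof (rule exI[of _ 16], rule conjI, simp, rule exI[of _ "exp 16"], intro allI impI)
    fix x :: real and m n :: nat
    assume x: "exp 16 \<le> x" and m: "sqrt x \<le> real m" "real m \<le> x ^ 4" and n: "sqrt x \<le> real n" "real n \<le> x ^ 4"
    note M = ln_index_in_range[OF x m] and N = ln_index_in_range[OF x n]
    have "log_ratio (\<lambda>m. ln (real m)) (\<lambda>n. ln (ln (real n))) m n \<le> (2 * ln (ln x) + 2 * ln (ln x)) / (ln x / 2 * (ln (ln x) / 2))"
      unfolding log_ratio_def by (intro frac_le add_mono mult_mono) (use M N in linarith | use M in simp)+
    then have "ln x * log_ratio (\<lambda>m. ln (real m)) (\<lambda>n. ln (ln (real n))) m n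
       \<le> ln x * ((2 * ln (ln x) + 2 * ln (ln x)) / (ln x / 2 * (ln (ln x) / 2)))"
      using M by (intro mult_left_mono) auto
    also have "\<dots> = 16" using M(5,6) by simp
    finally show "log_plus x * log_ratio (\<lambda>m. ln (real m)) (\<lambda>n. ln (ln (real n))) m n \<le> 16"
      by (simp only: M(7))
  qed
qed

section \<open>The limsup theorem\<close>

lemma limsup2_le:
  assumes "\<And>m n. k \<le> m \<Longrightarrow> k \<le> n \<Longrightarrow> F m n \<le> s"
  shows "limsup2 F \<le> ereal s"
  unfolding limsup2_eq_INF_SUP by (rule INF_lower2[of k]) (use assms in \<open>auto intro!: SUP_least\<close>)

lemma limsup2_ge:
  assumes "\<And>k. \<exists>m\<ge>k. \<exists>n\<ge>k. s \<le> F m n"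
  shows "ereal s \<le> limsup2 F"
  unfolding limsup2_eq_INF_SUP
proof (rule INF_greatest)
  fix k
  obtain m n where "k \<le> m" "k \<le> n" "s \<le> F m n" using assms by blast
  then show "ereal s \<le> (SUP (m, n)\<in>{k..} \<times> {k..}. ereal (F m n))"
    by (intro SUP_upper2[of "(m, n)"]) auto
qed

lemma limsup2_cong:
  assumes "\<And>m n. 16 \<le> m \<Longrightarrow> 16 \<le> n \<Longrightarrow> F m n = G m n"
  shows "limsup2 F = limsup2 G"
proof (rule Limsup_eq)
  have "\<forall>\<^sub>F m in sequentially. (16::nat) \<le> m" by (rule eventually_ge_at_top)
  then show "\<forall>\<^sub>F x in sequentially \<times>\<^sub>F sequentially. (case x of (m, n) \<Rightarrow> ereal (F m n)) = (case x of (m, n) \<Rightarrow> ereal (G m n))"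
    unfolding eventually_prod_filter using assms by (intro exI[of _ "\<lambda>m. 16 \<le> m"]) auto
qed

lemma delayed_sum_eq_window_sum:
  assumes f: "window_scale f" and g: "window_scale g" and mn: "16 \<le> m" "16 \<le> n"
  shows "delayed_sum Y (\<lambda>m. real m / f m) (\<lambda>n. real n / g n) m n \<omega>
    = (\<Sum>p\<in>window f m \<times> window g n. (case p of (i, j) \<Rightarrow> Y i j) \<omega>)"
proof -
  have W: "{i::nat. 1 \<le> i \<and> real m \<le> real i \<and> real i \<le> real m + real m / f m} = window f m"
    if "window_scale f" "16 \<le> m" for f m
  proof -
    have "0 \<le> real m / f m" using window_scaleD(1)[OF that] by simp
    note b = window_end_bounds[of m f, OF this]
    have "real i \<le> real m + real m / f m \<longleftrightarrow> i \<le> window_end f m" for i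
    proof
      assume "real i \<le> real m + real m / f m"
      then have "real i < real (Suc (window_end f m))" using b(2) by simp
      then show "i \<le> window_end f m" by (simp only: of_nat_less_iff less_Suc_eq_le)
    next
      assume "i \<le> window_end f m"
      then have "real i \<le> real (window_end f m)" by (simp only: of_nat_le_iff)
      then show "real i \<le> real m + real m / f m" using b(1) by (rule order_trans)
    qed
    then have "{i::nat. 1 \<le> i \<and> real m \<le> real i \<and> real i \<le> real m + real m / f m} = {i. 1 \<le> i \<and> m \<le> i \<and> i \<le> window_end f m}"
      by (simp only: of_nat_le_iff)
    also have "\<dots> = window f m" unfolding window_def using that(2) by auto
    finally show ?thesis .
  qed
  show ?thesis unfolding delayed_sum_def W[OF f mn(1)] W[OF g mn(2)]
    by (simp add: sum.cartesian_product case_prod_unfold)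
qed

context iid_array
begin

text \<open>
  The moment condition bounds the sum of the probabilities that an entry exceeds a small
  multiple of the normalizer at its position; this is the hypothesis of the upper bound. For
  the lower bound it suffices to find, for every column position, arbitrarily large row
  positions with a large window sum.
\<close>

theorem limsup_window_sums:
  assumes f: "window_scale f" and g: "window_scale g" and \<psi>: "moment_rate f g \<psi>" and \<theta>: "1 \<le> \<theta>" and \<sigma>: "0 \<le> \<sigma>"
    and fine_f: "\<And>\<alpha>. 0 < \<alpha> \<Longrightarrow> \<alpha> < 1 / \<theta> \<Longrightarrow> (\<lambda>i. f (grid \<alpha> i) * real i powr (\<alpha> - 1)) \<longlonglongrightarrow> 0"
    and fine_g: "\<And>\<alpha>. 0 < \<alpha> \<Longrightarrow> \<alpha> < 1 / \<theta> \<Longrightarrow> (\<lambda>i. g (grid \<alpha> i) * real i powr (\<alpha> - 1)) \<longlonglongrightarrow> 0"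
    and gap: "\<And>i. i0 \<le> i \<Longrightarrow> 16 \<le> r i \<and> window_end f (r i) < r (Suc i)"
    and growth: "\<And>i. i0 \<le> i \<Longrightarrow> ln (real (r i)) \<le> C * real i powr (1 / \<theta>)"
    and int: "integrable M (\<lambda>\<omega>. (X \<omega>)\<^sup>2 * (log_plus \<bar>X \<omega>\<bar> * \<psi> \<bar>X \<omega>\<bar>))"
    and mean: "expectation X = 0" and var: "expectation (\<lambda>\<omega>. (X \<omega>)\<^sup>2) = \<sigma>\<^sup>2"
  shows "AE \<omega> in M. limsup2 (\<lambda>m n. (\<Sum>p\<in>window f m \<times> window g n. Z p \<omega>) / normalizer (2 * \<theta>) f g m n) = ereal \<sigma>"
proof -
  let ?N = "normalizer (2 * \<theta>) f g"
  let ?T = "\<lambda>m n \<omega>. \<Sum>p\<in>window f m \<times> window g n. Z p \<omega>"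
  have Npos: "0 < ?N m n" if "16 \<le> m" "16 \<le> n" for m n using \<theta> that by (intro normalizer_pos[OF f g]) auto
  have \<psi>1: "1 \<le> \<psi> x" for x using \<psi> by (auto simp: moment_rate_def)
  have int1: "integrable M (\<lambda>\<omega>. (X \<omega>)\<^sup>2 * log_plus \<bar>X \<omega>\<bar>)"
  proof (rule Bochner_Integration.integrable_bound[OF int])
    show "AE \<omega> in M. norm ((X \<omega>)\<^sup>2 * log_plus \<bar>X \<omega>\<bar>) \<le> norm ((X \<omega>)\<^sup>2 * (log_plus \<bar>X \<omega>\<bar> * \<psi> \<bar>X \<omega>\<bar>))"
    proof (intro AE_I2)
      fix \<omega>
      have lp: "0 \<le> (X \<omega>)\<^sup>2 * log_plus \<bar>X \<omega>\<bar>" using log_plus_pos[of "\<bar>X \<omega>\<bar>"] by simp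
      have "(X \<omega>)\<^sup>2 * log_plus \<bar>X \<omega>\<bar> * 1 \<le> (X \<omega>)\<^sup>2 * log_plus \<bar>X \<omega>\<bar> * \<psi> \<bar>X \<omega>\<bar>"
        using lp \<psi>1 by (intro mult_left_mono) auto
      then show "norm ((X \<omega>)\<^sup>2 * log_plus \<bar>X \<omega>\<bar>) \<le> norm ((X \<omega>)\<^sup>2 * (log_plus \<bar>X \<omega>\<bar> * \<psi> \<bar>X \<omega>\<bar>))"
        using lp by (simp add: mult.assoc)
    qed
  qed simp
  note int2 = integrable_square[OF int1 mean]
  have exceed: "AE \<omega> in M. \<exists>k. \<forall>p\<ge>k. \<forall>q\<ge>k. \<bar>Z (p, q) \<omega>\<bar> \<le> \<eta> * ?N p q" if \<eta>: "0 < \<eta>" for \<eta>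
  proof -
    have c: "0 < \<eta>\<^sup>2 * (2 * \<theta>)" using \<eta> \<theta> by simp
    obtain B where B: "\<And>F. finite F \<Longrightarrow> F \<subseteq> {16..} \<times> {16..} \<Longrightarrow>
        (\<Sum>(m, n)\<in>F. \<P>(\<omega> in M. normalizer (\<eta>\<^sup>2 * (2 * \<theta>)) f g m n < \<bar>X \<omega>\<bar>)) \<le> B"
      by (rule sum_prob_exceeds_bounded[OF f g \<psi> c X_measurable int]) (rule that, assumption)
    define E where "E = (\<lambda>m n. if 16 \<le> m \<and> 16 \<le> n then {\<omega>\<in>space M. \<eta> * ?N m n < \<bar>Z (m, n) \<omega>\<bar>} else {})"
    have E_prob: "prob (E m n) = (if 16 \<le> m \<and> 16 \<le> n then \<P>(\<omega> in M. normalizer (\<eta>\<^sup>2 * (2 * \<theta>)) f g m n < \<bar>X \<omega>\<bar>) else 0)" for m n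
    proof (cases "16 \<le> m \<and> 16 \<le> n")
      case True
      then have "(m, n) \<in> {1..} \<times> {1..}" by simp
      then have "\<P>(\<omega> in M. \<eta> * ?N m n < \<bar>Z (m, n) \<omega>\<bar>) = \<P>(\<omega> in M. \<eta> * ?N m n < \<bar>X \<omega>\<bar>)" by (rule prob_Z) measurable
      then show ?thesis using True \<eta> by (simp add: E_def normalizer_scale)
    qed (auto simp: E_def)
    have E_meas: "E m n \<in> events" for m n
    proof (cases "16 \<le> m \<and> 16 \<le> n")
      case True
      then have [measurable]: "Z (m, n) \<in> borel_measurable M" by (intro Z_measurable) simp
      have "{\<omega>\<in>space M. \<eta> * ?N m n < \<bar>Z (m, n) \<omega>\<bar>} \<in> events" by measurable
      then show ?thesis using True by (simp add: E_def)
    qed (auto simp: E_def)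
    have "AE \<omega> in M. \<exists>k. \<forall>i\<ge>k. \<forall>j\<ge>k. \<omega> \<notin> E i j"
    proof (rule borel_cantelli_pairs[OF E_meas])
      fix F :: "(nat \<times> nat) set" assume F: "finite F"
      have "(\<Sum>(i,j)\<in>F. prob (E i j)) = (\<Sum>(i,j)\<in>F \<inter> {16..} \<times> {16..}. prob (E i j))"
        using F by (intro sum.mono_neutral_right) (auto simp: E_prob split: if_splits)
      also have "\<dots> = (\<Sum>(m,n)\<in>F \<inter> {16..} \<times> {16..}. \<P>(\<omega> in M. normalizer (\<eta>\<^sup>2 * (2 * \<theta>)) f g m n < \<bar>X \<omega>\<bar>))"
        by (intro sum.cong) (auto simp: E_prob)
      also have "\<dots> \<le> B" by (rule B) (use F in auto)
      finally show "(\<Sum>(i,j)\<in>F. prob (E i j)) \<le> B" .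
    qed
    with AE_space show ?thesis
    proof eventually_elim
      case (elim \<omega>)
      then obtain k where k: "\<And>i j. k \<le> i \<Longrightarrow> k \<le> j \<Longrightarrow> \<omega> \<notin> E i j" by blast
      have "\<bar>Z (p, q) \<omega>\<bar> \<le> \<eta> * ?N p q" if "max 16 k \<le> p" "max 16 k \<le> q" for p q
        using k[of p q] that elim(1) by (auto simp: E_def not_less)
      then show ?case by blast
    qed
  qed
  have "AE \<omega> in M. \<forall>j::nat. \<exists>k. \<forall>m\<ge>k. \<forall>n\<ge>k. ?T m n \<omega> \<le> (\<sigma> + 1 / real (Suc j)) * ?N m n"
    unfolding AE_all_countable
  proof
    fix j :: nat
    have "\<sigma> < \<sigma> + 1 / real (Suc j)" by simp
    then show "AE \<omega> in M. \<exists>k. \<forall>m\<ge>k. \<forall>n\<ge>k. ?T m n \<omega> \<le> (\<sigma> + 1 / real (Suc j)) * ?N m n"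
      by (rule window_sum_upper_bound[OF int1 mean var \<sigma> _ \<theta> f g fine_f fine_g exceed])
  qed
  then have upper: "AE \<omega> in M. limsup2 (\<lambda>m n. ?T m n \<omega> / ?N m n) \<le> ereal \<sigma>"
  proof eventually_elim
    case (elim \<omega>)
    show ?case
    proof (rule ereal_le_epsilon2)
      fix e :: real assume "0 < e"
      then obtain j where j: "1 / real (Suc j) < e" using reals_Archimedean by (auto simp: inverse_eq_divide)
      obtain k where k: "\<And>m n. k \<le> m \<Longrightarrow> k \<le> n \<Longrightarrow> ?T m n \<omega> \<le> (\<sigma> + 1 / real (Suc j)) * ?N m n" using elim by blast
      have "limsup2 (\<lambda>m n. ?T m n \<omega> / ?N m n) \<le> ereal (\<sigma> + 1 / real (Suc j))"
      proof (rule limsup2_le[of "max k 16"])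
        fix m n assume "max k 16 \<le> m" "max k 16 \<le> n"
        then show "?T m n \<omega> / ?N m n \<le> \<sigma> + 1 / real (Suc j)" using k[of m n] Npos[of m n] by (simp add: pos_divide_le_eq)
      qed
      also have "\<dots> \<le> ereal \<sigma> + ereal e" using j by simp
      finally show "limsup2 (\<lambda>m n. ?T m n \<omega> / ?N m n) \<le> ereal \<sigma> + ereal e" .
    qed
  qed
  have lower: "AE \<omega> in M. ereal \<sigma> \<le> limsup2 (\<lambda>m n. ?T m n \<omega> / ?N m n)"
  \<comment> \<open>The central limit theorem needs a positive variance; for \<open>\<sigma> = 0\<close> all entries vanish almost
    surely.\<close>
  proof (cases "\<sigma> = 0")
    case True
    have "AE \<omega> in M. Z p \<omega> = 0" if p: "p \<in> {1..} \<times> {1..}" for p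
    proof -
      have "integrable M (\<lambda>\<omega>. (Z p \<omega>)\<^sup>2)" using integrable_Z_iff[OF p, of "\<lambda>x. x\<^sup>2"] int2 by simp
      moreover have "expectation (\<lambda>\<omega>. (Z p \<omega>)\<^sup>2) = 0" using integral_Z[OF p, of "\<lambda>x. x\<^sup>2"] var True by simp
      ultimately have "AE \<omega> in M. (Z p \<omega>)\<^sup>2 = 0"
        by (subst (asm) integral_nonneg_eq_0_iff_AE) auto
      then show ?thesis by simp
    qed
    then have "AE \<omega> in M. \<forall>p\<in>{1..} \<times> {1..}. Z p \<omega> = 0" by (subst AE_ball_countable) auto
    then show ?thesis
    proof eventually_elim
      case (elim \<omega>)
      show ?case unfolding True
      proof (rule limsup2_ge)
        fix k
        have "?T (max k 1) (max k 1) \<omega> = 0" by (rule sum.neutral) (use elim in \<open>auto simp: window_def\<close>)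
        then show "\<exists>m\<ge>k. \<exists>n\<ge>k. 0 \<le> ?T m n \<omega> / ?N m n" by (intro exI[of _ "max k 1"] conjI) simp_all
      qed
    qed
  next
    case False
    then have \<sigma>0: "0 < \<sigma>" using \<sigma> by simp
    define x where "x = (\<lambda>j::nat. 1 - 1 / real (Suc (Suc j)))"
    have x: "0 < x j" "x j < 1" for j by (auto simp: x_def)
    have "AE \<omega> in M. \<forall>j n. \<forall>k. \<exists>m\<ge>k. (x j)\<^sup>2 * \<sigma> * ?N m (max 16 n) \<le> ?T m (max 16 n) \<omega>"
      unfolding AE_all_countable[of "\<lambda>j \<omega>. \<forall>n. \<forall>k. \<exists>m\<ge>k. (x j)\<^sup>2 * \<sigma> * ?N m (max 16 n) \<le> ?T m (max 16 n) \<omega>"]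
        AE_all_countable[of "\<lambda>n \<omega>. \<forall>k. \<exists>m\<ge>k. (x j)\<^sup>2 * \<sigma> * ?N m (max 16 n) \<le> ?T m (max 16 n) \<omega>" for j]
    proof (intro allI)
      fix j n :: nat
      have \<theta>0: "0 < \<theta>" using \<theta> by simp
      show "AE \<omega> in M. \<forall>k. \<exists>m\<ge>k. (x j)\<^sup>2 * \<sigma> * ?N m (max 16 n) \<le> ?T m (max 16 n) \<omega>"
        by (rule window_sum_lower_bound[OF mean int2 var \<sigma>0 f g \<theta>0 x max.cobounded1 gap growth])
    qed
    then show ?thesis
    proof eventually_elim
      case (elim \<omega>)
      have ge: "ereal ((x j)\<^sup>2 * \<sigma>) \<le> limsup2 (\<lambda>m n. ?T m n \<omega> / ?N m n)" for j
      proof (rule limsup2_ge)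
        fix k
        obtain m where m: "max 16 k \<le> m" "(x j)\<^sup>2 * \<sigma> * ?N m (max 16 k) \<le> ?T m (max 16 k) \<omega>" using elim by blast
        then have "(x j)\<^sup>2 * \<sigma> \<le> ?T m (max 16 k) \<omega> / ?N m (max 16 k)" using Npos[of m "max 16 k"] by (simp add: pos_le_divide_eq)
        moreover have "k \<le> m" "k \<le> max 16 k" using m(1) by simp_all
        ultimately show "\<exists>m\<ge>k. \<exists>n\<ge>k. (x j)\<^sup>2 * \<sigma> \<le> ?T m n \<omega> / ?N m n" by blast
      qed
      have "x \<longlonglongrightarrow> 1" unfolding x_def by real_asymp
      then have "(\<lambda>j. (x j)\<^sup>2 * \<sigma>) \<longlonglongrightarrow> 1\<^sup>2 * \<sigma>" by (intro tendsto_intros)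
      then have "(\<lambda>j. ereal ((x j)\<^sup>2 * \<sigma>)) \<longlonglongrightarrow> ereal \<sigma>" by simp
      then show ?case by (rule LIMSEQ_le_const2) (use ge in blast)
    qed
  qed
  from upper lower show ?thesis by eventually_elim (rule antisym)
qed

end

lemma iid_field_imp_iid_array:
  assumes "iid_field M X Y" shows "iid_array M X (\<lambda>(i, j). Y i j)"
proof -
  define V where "V = (\<lambda>k. case k of None \<Rightarrow> X | Some (i, j) \<Rightarrow> Y i j)"
  interpret prob_space M using assms by (simp add: iid_field_def)
  have ind: "indep_vars (\<lambda>_. borel) V (insert None (Some ` ({1..} \<times> {1..})))"
    using assms by (simp add: iid_field_def V_def)
  have "indep_vars (\<lambda>_. borel) (\<lambda>p. V (Some p)) ({1..} \<times> {1..})"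
    by (rule indep_vars_reindex) (auto intro!: indep_vars_subset[OF ind])
  moreover have "V None \<in> borel_measurable M" using ind by (auto simp: indep_vars_def)
  moreover have "\<And>p. V (Some p) = (\<lambda>(i, j). Y i j) p" by (simp add: V_def split: prod.split)
  ultimately show ?thesis
    using assms by unfold_locales (auto simp: V_def iid_field_def)
qed

theorem theorem2p1:
  fixes M :: "'a measure"
    and X :: "'a \<Rightarrow> real"
    and Y :: "nat \<Rightarrow> nat \<Rightarrow> 'a \<Rightarrow> real"
    and \<sigma> :: real
  assumes iid: "iid_field M X Y"
    and sigma: "\<sigma> \<ge> 0"
  shows "((integrable M (\<lambda>\<omega>. (X \<omega>)\<^sup>2 * ((log_plus \<bar>X \<omega>\<bar>) ^ 3 / log_plus (log_plus \<bar>X \<omega>\<bar>)))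
      \<and> integral\<^sup>L M X = 0 \<and> integral\<^sup>L M (\<lambda>\<omega>. (X \<omega>)\<^sup>2) = \<sigma>\<^sup>2
      \<longrightarrow> (AE \<omega> in M. limsup2 (\<lambda>m n.
            delayed_sum Y (\<lambda>m. real m / ln (real m)) (\<lambda>n. real n / ln (real n)) m n \<omega>
            / sqrt (4 * real m * real n * ((ln (ln (real m)) + ln (ln (real n))) / (ln (real m) * ln (real n))))) = ereal \<sigma>)))
    \<and> ((\<P>(\<omega> in M. limsup2 (\<lambda>m n.
            \<bar>delayed_sum Y (\<lambda>m. real m / ln (real m)) (\<lambda>n. real n / ln (real n)) m n \<omega>\<bar>
            / sqrt (real m * real n * ((ln (ln (real m)) + ln (ln (real n))) / (ln (real m) * ln (real n))))) < \<infinity>) > 0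
      \<longrightarrow> integrable M (\<lambda>\<omega>. (X \<omega>)\<^sup>2 * ((log_plus \<bar>X \<omega>\<bar>) ^ 3 / log_plus (log_plus \<bar>X \<omega>\<bar>)))
          \<and> integral\<^sup>L M X = 0))
    \<and> ((integrable M (\<lambda>\<omega>. (X \<omega>)\<^sup>2 * log_plus \<bar>X \<omega>\<bar> * log_plus (log_plus \<bar>X \<omega>\<bar>))
      \<and> integral\<^sup>L M X = 0 \<and> integral\<^sup>L M (\<lambda>\<omega>. (X \<omega>)\<^sup>2) = \<sigma>\<^sup>2
      \<longrightarrow> (AE \<omega> in M. limsup2 (\<lambda>m n.
            delayed_sum Y (\<lambda>m. real m / ln (ln (real m))) (\<lambda>n. real n / ln (ln (real n))) m n \<omega>
            / sqrt (2 * real m * real n * ((ln (ln (real m)) + ln (ln (real n))) / (ln (ln (real m)) * ln (ln (real n)))))) = ereal \<sigma>)))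
    \<and> ((\<P>(\<omega> in M. limsup2 (\<lambda>m n.
            \<bar>delayed_sum Y (\<lambda>m. real m / ln (ln (real m))) (\<lambda>n. real n / ln (ln (real n))) m n \<omega>\<bar>
            / sqrt (real m * real n * ((ln (ln (real m)) + ln (ln (real n))) / (ln (ln (real m)) * ln (ln (real n)))))) < \<infinity>) > 0
      \<longrightarrow> integrable M (\<lambda>\<omega>. (X \<omega>)\<^sup>2 * log_plus \<bar>X \<omega>\<bar> * log_plus (log_plus \<bar>X \<omega>\<bar>))
          \<and> integral\<^sup>L M X = 0))
    \<and> ((integrable M (\<lambda>\<omega>. (X \<omega>)\<^sup>2 * (log_plus \<bar>X \<omega>\<bar>)\<^sup>2)
      \<and> integral\<^sup>L M X = 0 \<and> integral\<^sup>L M (\<lambda>\<omega>. (X \<omega>)\<^sup>2) = \<sigma>\<^sup>2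
      \<longrightarrow> (AE \<omega> in M. limsup2 (\<lambda>m n.
            delayed_sum Y (\<lambda>m. real m / ln (real m)) (\<lambda>n. real n / ln (ln (real n))) m n \<omega>
            / sqrt (4 * real m * real n * ((ln (ln (real m)) + ln (ln (real n))) / (ln (real m) * ln (ln (real n)))))) = ereal \<sigma>)))
    \<and> ((\<P>(\<omega> in M. limsup2 (\<lambda>m n.
            \<bar>delayed_sum Y (\<lambda>m. real m / ln (real m)) (\<lambda>n. real n / ln (ln (real n))) m n \<omega>\<bar>
            / sqrt (4 * real m * real n * ((ln (ln (real m)) + ln (ln (real n))) / (ln (real m) * ln (ln (real n)))))) < \<infinity>) > 0
      \<longrightarrow> integrable M (\<lambda>\<omega>. (X \<omega>)\<^sup>2 * (log_plus \<bar>X \<omega>\<bar>)\<^sup>2)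
          \<and> integral\<^sup>L M X = 0))"
proof -
  interpret iid_array M X "\<lambda>(i, j). Y i j" by (rule iid_field_imp_iid_array[OF iid])
  let ?l = "\<lambda>m::nat. ln (real m)" and ?ll = "\<lambda>m::nat. ln (ln (real m))"
  obtain i1 where "\<forall>i\<ge>i1. 16 \<le> nat \<lfloor>exp (2 * sqrt (real i))\<rfloor> \<and>
     window_end ?l (nat \<lfloor>exp (2 * sqrt (real i))\<rfloor>) < nat \<lfloor>exp (2 * sqrt (real (Suc i)))\<rfloor>"
    using ln_windows_disjoint_along_grid by (rule exE)
  note i1 = this[rule_format]
  obtain i2 where "\<forall>i\<ge>i2. 16 \<le> nat \<lfloor>exp (real i)\<rfloor> \<and>
     window_end ?ll (nat \<lfloor>exp (real i)\<rfloor>) < nat \<lfloor>exp (real (Suc i))\<rfloor>"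
    using ln_ln_windows_disjoint_along_grid by (rule exE)
  note i2 = this[rule_format]
  have g1: "ln (real (nat \<lfloor>exp (2 * sqrt (real i))\<rfloor>)) \<le> 2 * real i powr (1 / 2)" for i
    using nat_floor_exp_bounds(4)[of "2 * sqrt (real i)"] by (simp add: powr_half_sqrt)
  have g2: "ln (real (nat \<lfloor>exp (real i)\<rfloor>)) \<le> 1 * real i powr (1 / 1)" for i
    using nat_floor_exp_bounds(4)[of "real i"] by simp
  have fine2: "(\<lambda>i. ?ll (grid \<alpha> i) * real i powr (\<alpha> - 1)) \<longlonglongrightarrow> 0" if "0 < \<alpha>" "\<alpha> < 1 / 2" for \<alpha>
    by (rule ln_ln_grid_fine) (use that in auto)
  have fine1: "(\<lambda>i. ?ll (grid \<alpha> i) * real i powr (\<alpha> - 1)) \<longlonglongrightarrow> 0" if "0 < \<alpha>" "\<alpha> < 1 / 1" for \<alpha>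
    by (rule ln_ln_grid_fine) (use that in auto)
  have D: "limsup2 (\<lambda>m n. delayed_sum Y (\<lambda>m. real m / f m) (\<lambda>n. real n / g n) m n \<omega> / b m n)
      = limsup2 (\<lambda>m n. (\<Sum>p\<in>window f m \<times> window g n. (case p of (i, j) \<Rightarrow> Y i j) \<omega>) / b m n)"
    "limsup2 (\<lambda>m n. \<bar>delayed_sum Y (\<lambda>m. real m / f m) (\<lambda>n. real n / g n) m n \<omega>\<bar> / b m n)
      = limsup2 (\<lambda>m n. \<bar>\<Sum>p\<in>window f m \<times> window g n. (case p of (i, j) \<Rightarrow> Y i j) \<omega>\<bar> / b m n)"
    if "window_scale f" "window_scale g" for f g b \<omega>
    by (rule limsup2_cong, subst delayed_sum_eq_window_sum[OF that], assumption, assumption, rule refl)+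
  note W = ln_window_scale ln_ln_window_scale
  note D11 = D[OF W(1) W(1)] and D22 = D[OF W(2) W(2)] and D12 = D[OF W(1) W(2)]
  have m1: "(X \<omega>)\<^sup>2 * ((log_plus \<bar>X \<omega>\<bar>) ^ 3 / log_plus (log_plus \<bar>X \<omega>\<bar>))
     = (X \<omega>)\<^sup>2 * (log_plus \<bar>X \<omega>\<bar> * ((log_plus \<bar>X \<omega>\<bar>)\<^sup>2 / log_plus (log_plus \<bar>X \<omega>\<bar>)))" for \<omega>
    by (simp add: power2_eq_square power3_eq_cube)
  have m2: "(X \<omega>)\<^sup>2 * log_plus \<bar>X \<omega>\<bar> * log_plus (log_plus \<bar>X \<omega>\<bar>) = (X \<omega>)\<^sup>2 * (log_plus \<bar>X \<omega>\<bar> * log_plus (log_plus \<bar>X \<omega>\<bar>))" for \<omega>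
    by simp
  have m3: "(X \<omega>)\<^sup>2 * (log_plus \<bar>X \<omega>\<bar>)\<^sup>2 = (X \<omega>)\<^sup>2 * (log_plus \<bar>X \<omega>\<bar> * log_plus \<bar>X \<omega>\<bar>)" for \<omega>
    by (simp add: power2_eq_square)
  have n1: "sqrt (real m * real n * ((ln (ln (real m)) + ln (ln (real n))) / (f m * g n))) = normalizer 1 f g m n"
    and n2: "sqrt (2 * real m * real n * ((ln (ln (real m)) + ln (ln (real n))) / (f m * g n))) = normalizer (2 * 1) f g m n"
    and n4: "sqrt (4 * real m * real n * ((ln (ln (real m)) + ln (ln (real n))) / (f m * g n))) = normalizer (2 * 2) f g m n" for f g m n
    by (simp_all add: normalizer_def)
  note N = n1[of _ _ ?l ?l] n1[of _ _ ?ll ?ll] n2[of _ _ ?ll ?ll] n4[of _ _ ?l ?l] n4[of _ _ ?l ?ll]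
  show ?thesis
    unfolding D11 D22 D12 N m1 m2 m3
  proof (intro conjI impI; (elim conjE)?)
    assume a: "integrable M (\<lambda>\<omega>. (X \<omega>)\<^sup>2 * (log_plus \<bar>X \<omega>\<bar> * ((log_plus \<bar>X \<omega>\<bar>)\<^sup>2 / log_plus (log_plus \<bar>X \<omega>\<bar>))))"
      "expectation X = 0" "expectation (\<lambda>\<omega>. (X \<omega>)\<^sup>2) = \<sigma>\<^sup>2"
    show "AE \<omega> in M. limsup2 (\<lambda>m n. (\<Sum>p\<in>window ?l m \<times> window ?l n. (case p of (i, j) \<Rightarrow> Y i j) \<omega>) / normalizer (2 * 2) ?l ?l m n) = ereal \<sigma>"
      by (rule limsup_window_sums[OF W(1) W(1) moment_rate_ln_ln _ sigma ln_grid_fine ln_grid_fine i1 g1 a]) simp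
  next
    assume a: "integrable M (\<lambda>\<omega>. (X \<omega>)\<^sup>2 * (log_plus \<bar>X \<omega>\<bar> * log_plus (log_plus \<bar>X \<omega>\<bar>)))"
      "expectation X = 0" "expectation (\<lambda>\<omega>. (X \<omega>)\<^sup>2) = \<sigma>\<^sup>2"
    show "AE \<omega> in M. limsup2 (\<lambda>m n. (\<Sum>p\<in>window ?ll m \<times> window ?ll n. (case p of (i, j) \<Rightarrow> Y i j) \<omega>) / normalizer (2 * 1) ?ll ?ll m n) = ereal \<sigma>"
      by (rule limsup_window_sums[OF W(2) W(2) moment_rate_lnln_lnln _ sigma fine1 fine1 i2 g2 a]) simp
  next
    assume a: "integrable M (\<lambda>\<omega>. (X \<omega>)\<^sup>2 * (log_plus \<bar>X \<omega>\<bar> * log_plus \<bar>X \<omega>\<bar>))"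
      "expectation X = 0" "expectation (\<lambda>\<omega>. (X \<omega>)\<^sup>2) = \<sigma>\<^sup>2"
    show "AE \<omega> in M. limsup2 (\<lambda>m n. (\<Sum>p\<in>window ?l m \<times> window ?ll n. (case p of (i, j) \<Rightarrow> Y i j) \<omega>) / normalizer (2 * 2) ?l ?ll m n) = ereal \<sigma>"
      by (rule limsup_window_sums[OF W(1) W(2) moment_rate_ln_lnln _ sigma ln_grid_fine fine2 i1 g1 a]) simp
  next
    assume pos: "0 < \<P>(\<omega> in M. limsup2 (\<lambda>m n. \<bar>\<Sum>p\<in>window ?l m \<times> window ?l n. (case p of (i, j) \<Rightarrow> Y i j) \<omega>\<bar> / normalizer 1 ?l ?l m n) < \<infinity>)"
    show "integrable M (\<lambda>\<omega>. (X \<omega>)\<^sup>2 * (log_plus \<bar>X \<omega>\<bar> * ((log_plus \<bar>X \<omega>\<bar>)\<^sup>2 / log_plus (log_plus \<bar>X \<omega>\<bar>))))" "expectation X = 0"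
      by (rule moment_of_finite_limsup[OF W(1) W(1) _ moment_rate_ln_ln pos], simp)+
  next
    assume pos: "0 < \<P>(\<omega> in M. limsup2 (\<lambda>m n. \<bar>\<Sum>p\<in>window ?ll m \<times> window ?ll n. (case p of (i, j) \<Rightarrow> Y i j) \<omega>\<bar> / normalizer 1 ?ll ?ll m n) < \<infinity>)"
    show "integrable M (\<lambda>\<omega>. (X \<omega>)\<^sup>2 * (log_plus \<bar>X \<omega>\<bar> * log_plus (log_plus \<bar>X \<omega>\<bar>)))" "expectation X = 0"
      by (rule moment_of_finite_limsup[OF W(2) W(2) _ moment_rate_lnln_lnln pos], simp)+
  next
    assume pos: "0 < \<P>(\<omega> in M. limsup2 (\<lambda>m n. \<bar>\<Sum>p\<in>window ?l m \<times> window ?ll n. (case p of (i, j) \<Rightarrow> Y i j) \<omega>\<bar> / normalizer (2 * 2) ?l ?ll m n) < \<infinity>)"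
    show "integrable M (\<lambda>\<omega>. (X \<omega>)\<^sup>2 * (log_plus \<bar>X \<omega>\<bar> * log_plus \<bar>X \<omega>\<bar>))" "expectation X = 0"
      by (rule moment_of_finite_limsup[OF W(1) W(2) _ moment_rate_ln_lnln pos], simp)+
  qed
qed

end
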